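(* The maps $M\mapsto\underline{H}_M(x)$ and $M\mapsto H_M(x)$, from the class of all matroids (on finite subsets of the positive integers) to $\mathbb{Z}[x]$, are valuative invariants.
   Context: For a matroid $M$ on $E$, its base polytope $\mathscr{P}(M)\subseteq\mathbb{R}^E$ is the convex hull of the indicator vectors of the bases of $M$. A matroid subdivision $\mathcal{S}$ of $\mathscr{P}(M)$ is a polyhedral subdivision all of whose cells (hence all faces) are base polytopes of matroids on $E$; $\mathcal{S}^{\mathrm{int}}$ denotes the set of polytopes of $\mathcal{S}$ (cells and their faces) not contained in the boundary of $\mathscr{P}(M)$. A map $f$ from matroids to an abelian group is a valuative invariant if (i) $f(M)=f(N)$ whenever $M\cong N$, and (ii) for every matroid $M$ and every matroid subdivision $\mathcal{S}$ of $\mathscr{P}(M)$, $f(M)=\sum_{\mathscr{P}_i\in\mathcal{S}^{\mathrm{int}}}(-1)^{\dim\mathscr{P}(M)-\dim\mathscr{P}_i}f(\mathscr{P}_i)$, where $f$ is evaluated on the matroid whose base polytope is $\mathscr{P}_i$. For a loopless matroid $M$ on $E$ with lattice of flats $\mathcal{L}(M)$: $\underline{\mathrm{CH}}(M)=\mathbb{Q}[x_F: F\in\mathcal{L}(M)\setminus\{\varnothing,E\}]/(I+J)$, $I$ generated by $x_{F_1}x_{F_2}$ for incomparable $F_1,F_2$, $J$ by $\sum_{F\ni i}x_F-\sum_{F\ni j}x_F$ for $i,j\in E$; $\mathrm{CH}(M)=\mathbb{Q}[x_F,y_i: F\in\mathcal{L}(M)\setminus\{E\},\, i\in E]/(I'+J')$,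 $I'$ generated by $y_i-\sum_{F\not\ni i}x_F$, $J'$ by $x_{F_1}x_{F_2}$ for incomparable $F_1,F_2$ and $y_ix_F$ for $i\notin F$. Variables of degree $1$; $\underline{H}_M$, $H_M$ are the Hilbert series. For matroids with loops, by convention $\underline{H}_M(x)=0$ and $H_M(x)=H_{M\setminus\{\text{loops}\}}(x)$. *)

theory Defs
  imports "HOL-Analysis.Analysis" "HOL-Library.Poly_Mapping" "HOL-Analysis.Finite_Function_Topology"
    "HOL-Computational_Algebra.Formal_Power_Series"
begin

definition matroid :: "nat set \<Rightarrow> nat set set \<Rightarrow> bool" where
  "matroid E Bs \<longleftrightarrow> finite E \<and> 0 \<notin> E \<and> Bs \<noteq> {} \<and> (\<forall>B\<in>Bs. B \<subseteq> E) \<and>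
     (\<forall>B1\<in>Bs. \<forall>B2\<in>Bs. \<forall>x\<in>B1 - B2. \<exists>y\<in>B2 - B1. insert y (B1 - {x}) \<in> Bs)"

definition matroid_iso :: "nat set \<Rightarrow> nat set set \<Rightarrow> nat set \<Rightarrow> nat set set \<Rightarrow> bool" where
  "matroid_iso E Bs E' Bs' \<longleftrightarrow> (\<exists>\<sigma>. bij_betw \<sigma> E E' \<and> Bs' = (\<lambda>B. \<sigma> ` B) ` Bs)"

text \<open>Points of R^E are finitely supported functions nat \<Rightarrow> real.\<close>
definition ind_vec :: "nat set \<Rightarrow> (nat \<Rightarrow>\<^sub>0 real)" where
  "ind_vec B = (\<Sum>i\<in>B. Poly_Mapping.single i 1)"

definition base_polytope :: "nat set set \<Rightarrow> (nat \<Rightarrow>\<^sub>0 real) set" where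
  "base_polytope Bs = convex hull (ind_vec ` Bs)"

text \<open>Dimension of a (nonempty) polytope = dimension of its affine hull.\<close>
definition pdim :: "(nat \<Rightarrow>\<^sub>0 real) set \<Rightarrow> nat" where
  "pdim P = dim {x - y | x y. x \<in> P \<and> y \<in> P}"

text \<open>The matroid on E whose base polytope is P: its bases are the 0/1-points of P.\<close>
definition bases_of :: "nat set \<Rightarrow> (nat \<Rightarrow>\<^sub>0 real) set \<Rightarrow> nat set set" where
  "bases_of E P = {B. B \<subseteq> E \<and> ind_vec B \<in> P}"

text \<open>A matroid subdivision, as the polyhedral complex of all (nonempty) cells and their
  faces: finitely many nonempty polytopes, closed under nonempty faces, any two meeting
  in a common face, covering the base polytope, every member a matroid base polytope.\<close>
definition matroid_subdivision ::
  "nat set \<Rightarrow> nat set set \<Rightarrow> (nat \<Rightarrow>\<^sub>0 real) set set \<Rightarrow> bool" where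
  "matroid_subdivision E Bs S \<longleftrightarrow>
     finite S \<and> {} \<notin> S \<and>
     (\<forall>P\<in>S. \<exists>Bs'. matroid E Bs' \<and> P = base_polytope Bs') \<and>
     (\<forall>P\<in>S. \<forall>F. F face_of P \<and> F \<noteq> {} \<longrightarrow> F \<in> S) \<and>
     (\<forall>P\<in>S. \<forall>Q\<in>S. (P \<inter> Q) face_of P \<and> (P \<inter> Q) face_of Q) \<and>
     \<Union>S = base_polytope Bs"

text \<open>Members of S not contained in the (relative) boundary of the base polytope,
  i.e. in the union of its proper faces.\<close>
definition interior_faces ::
  "nat set set \<Rightarrow> (nat \<Rightarrow>\<^sub>0 real) set set \<Rightarrow> (nat \<Rightarrow>\<^sub>0 real) set set" where
  "interior_faces Bs S =
     {P \<in> S. \<not> P \<subseteq> \<Union>{F. F face_of base_polytope Bs \<and> F \<noteq> base_polytope Bs}}"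

definition sign_pow :: "nat \<Rightarrow> 'g::ab_group_add \<Rightarrow> 'g" where
  "sign_pow k v = (if even k then v else - v)"

definition valuative_invariant :: "(nat set \<Rightarrow> nat set set \<Rightarrow> 'g::ab_group_add) \<Rightarrow> bool" where
  "valuative_invariant f \<longleftrightarrow>
     (\<forall>E Bs E' Bs'. matroid E Bs \<and> matroid E' Bs' \<and> matroid_iso E Bs E' Bs' \<longrightarrow>
        f E Bs = f E' Bs') \<and>
     (\<forall>E Bs S. matroid E Bs \<and> matroid_subdivision E Bs S \<longrightarrow>
        f E Bs = (\<Sum>P\<in>interior_faces Bs S.
                    sign_pow (pdim (base_polytope Bs) - pdim P) (f E (bases_of E P))))"

definition mrank :: "nat set set \<Rightarrow> nat set \<Rightarrow> nat" where
  "mrank Bs A = Max ((\<lambda>B. card (A \<inter> B)) ` Bs)"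

definition flats :: "nat set \<Rightarrow> nat set set \<Rightarrow> nat set set" where
  "flats E Bs = {F. F \<subseteq> E \<and> (\<forall>x\<in>E - F. mrank Bs (insert x F) > mrank Bs F)}"

definition loops :: "nat set \<Rightarrow> nat set set \<Rightarrow> nat set" where
  "loops E Bs = E - \<Union>Bs"

datatype cvar = XV "nat set" | YV nat

type_synonym cmono = "cvar \<Rightarrow>\<^sub>0 nat"
type_synonym cpoly = "cmono \<Rightarrow>\<^sub>0 rat"

definition mono_deg :: "cmono \<Rightarrow> nat" where
  "mono_deg m = (\<Sum>v\<in>Poly_Mapping.keys m. Poly_Mapping.lookup m v)"

definition monos_deg :: "cvar set \<Rightarrow> nat \<Rightarrow> cmono set" where
  "monos_deg V d = {m. Poly_Mapping.keys m \<subseteq> V \<and> mono_deg m = d}"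

definition mono :: "cmono \<Rightarrow> cpoly" where
  "mono m = Poly_Mapping.single m 1"

definition var :: "cvar \<Rightarrow> cpoly" where
  "var v = mono (Poly_Mapping.single v 1)"

definition qscale :: "rat \<Rightarrow> cpoly \<Rightarrow> cpoly" where
  "qscale c p = Poly_Mapping.map (\<lambda>a. c * a) p"

definition qdim :: "cpoly set \<Rightarrow> nat" where
  "qdim A = vector_space.dim qscale A"

text \<open>For Q[V]/I with I generated by the homogeneous polynomials g of degree e, (g,e) \<in> G:
  dim of the degree-d part = dim Q[V]_d - dim I_d, where I_d is spanned by m*g with
  m a monomial of degree d - e.\<close>
definition quot_dim :: "cvar set \<Rightarrow> (cpoly \<times> nat) set \<Rightarrow> nat \<Rightarrow> nat" where
  "quot_dim V G d = qdim (mono ` monos_deg V d) -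
     qdim {mono m * g | m g e. (g, e) \<in> G \<and> e \<le> d \<and> m \<in> monos_deg V (d - e)}"

definition hilbert_series :: "cvar set \<Rightarrow> (cpoly \<times> nat) set \<Rightarrow> int fps" where
  "hilbert_series V G = Abs_fps (\<lambda>d. int (quot_dim V G d))"

definition red_flats :: "nat set \<Rightarrow> nat set set \<Rightarrow> nat set set" where
  "red_flats E Bs = flats E Bs - {{}, E}"

definition red_chow_vars :: "nat set \<Rightarrow> nat set set \<Rightarrow> cvar set" where
  "red_chow_vars E Bs = XV ` red_flats E Bs"

definition red_chow_rels :: "nat set \<Rightarrow> nat set set \<Rightarrow> (cpoly \<times> nat) set" where
  "red_chow_rels E Bs =
     {(var (XV F1) * var (XV F2), 2) | F1 F2.
        F1 \<in> red_flats E Bs \<and> F2 \<in> red_flats E Bs \<and> \<not> F1 \<subseteq> F2 \<and> \<not> F2 \<subseteq> F1} \<union>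
     {((\<Sum>F\<in>{F \<in> red_flats E Bs. i \<in> F}. var (XV F)) -
       (\<Sum>F\<in>{F \<in> red_flats E Bs. j \<in> F}. var (XV F)), 1) | i j. i \<in> E \<and> j \<in> E}"

definition aug_flats :: "nat set \<Rightarrow> nat set set \<Rightarrow> nat set set" where
  "aug_flats E Bs = flats E Bs - {E}"

definition aug_chow_vars :: "nat set \<Rightarrow> nat set set \<Rightarrow> cvar set" where
  "aug_chow_vars E Bs = XV ` aug_flats E Bs \<union> YV ` E"

definition aug_chow_rels :: "nat set \<Rightarrow> nat set set \<Rightarrow> (cpoly \<times> nat) set" where
  "aug_chow_rels E Bs =
     {(var (YV i) - (\<Sum>F\<in>{F \<in> aug_flats E Bs. i \<notin> F}. var (XV F)), 1) | i. i \<in> E} \<union>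
     {(var (XV F1) * var (XV F2), 2) | F1 F2.
        F1 \<in> aug_flats E Bs \<and> F2 \<in> aug_flats E Bs \<and> \<not> F1 \<subseteq> F2 \<and> \<not> F2 \<subseteq> F1} \<union>
     {(var (YV i) * var (XV F), 2) | i F. i \<in> E \<and> F \<in> aug_flats E Bs \<and> i \<notin> F}"

text \<open>Hilbert series; with the stated conventions for matroids with loops
  (deleting the loops keeps the same family of bases on the ground set E - loops).\<close>
definition red_hilb :: "nat set \<Rightarrow> nat set set \<Rightarrow> int fps" where
  "red_hilb E Bs = (if loops E Bs \<noteq> {} then 0
     else hilbert_series (red_chow_vars E Bs) (red_chow_rels E Bs))"

definition aug_hilb :: "nat set \<Rightarrow> nat set set \<Rightarrow> int fps" where
  "aug_hilb E Bs = (let E' = E - loops E Bs in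
     hilbert_series (aug_chow_vars E' Bs) (aug_chow_rels E' Bs))"

end

theory Submission
  imports Defs
begin

text \<open>Both Chow rings have a basis of monomials supported on chains of flats, with exponents bounded
  by rank differences (Feichtner and Yuzvinsky). The relations allow one to straighten every monomial.
  For the linear independence, a functional on polynomials in the sums \<open>\<Sum>G \<supseteq> F. x G\<close> is given by the
  dragon Hall--Rado condition, which annihilates the relations by submodularity of the rank, and the
  resulting pairing is triangular on these monomials. Hence each coefficient of the Hilbert series is a
  universal linear combination of the functions that test whether the members of a given chain of sets
  are flats of given ranks.

  Such a function is an alternating sum of functions testing \<open>rk A \<ge> r A\<close> for all \<open>A\<close> in a chain. By the
  greedy algorithm this means that the base polytope meets an open convex set \<open>C\<close>, and these functions are
  valuative: the relative interiors of the interior faces, cut with \<open>C\<close>, partition the relative interior of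
  the polytope cut with \<open>C\<close>, and the Euler characteristic of a relatively open bounded convex set is
  \<open>(-1)\<close> to the power of its dimension.\<close>

section \<open>Matroids from bases\<close>

text \<open>A chain of flats does not determine its ranks. The indicators therefore prescribe a rank
  for every member, and the count of basis monomials runs over all rank assignments bounded by
  \<open>card E\<close>, so that its index sets depend on \<open>E\<close> alone.

  For the lower bound on dimensions one needs a ring in which the top power of \<open>x E\<close> is
  visibly nonzero. It is built outside the quotient, as polynomials modulo the radical of the
  pairing. Straightening, vanishing and triangularity are therefore proved for an abstract ideal;
  this is instantiated for the given relations and for the radical, and a substitution of variables
  carries one to the other.

  Interior faces have the same loops as the whole matroid. This makes the two conventions for loops
  compatible with the signed sum and moves all work to the ground set without loops.

  Points live in an infinite-dimensional space: openness is expressed by prolonging segments,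
  without topology, and dimension counts confine directions to finitely many coordinates.\<close>

definition mclosure :: "nat set \<Rightarrow> nat set set \<Rightarrow> nat set \<Rightarrow> nat set" where
  "mclosure E Bs A = {x\<in>E. mrank Bs (insert x A) = mrank Bs A}"

lemma matroidD:
  assumes "matroid E Bs"
  shows "finite E" "Bs \<noteq> {}" "finite Bs" "B \<in> Bs \<Longrightarrow> B \<subseteq> E" "B \<in> Bs \<Longrightarrow> finite B"
proof -
  show 1: "finite E" and 2: "Bs \<noteq> {}" and 3: "B \<in> Bs \<Longrightarrow> B \<subseteq> E"
    using assms by (auto simp: matroid_def)
  show "B \<in> Bs \<Longrightarrow> finite B" using 1 3 finite_subset by blast
  have "Bs \<subseteq> Pow E" using assms by (auto simp: matroid_def)
  then show "finite Bs" using 1 by (metis finite_Pow_iff finite_subset)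
qed

lemma matroid_exchange:
  assumes "matroid E Bs" "B1 \<in> Bs" "B2 \<in> Bs" "x \<in> B1 - B2"
  obtains y where "y \<in> B2 - B1" "insert y (B1 - {x}) \<in> Bs"
  using assms unfolding matroid_def by blast

text \<open>Each exchange towards \<open>B1\<close> shrinks \<open>B2 - B1\<close> and preserves the
  size of \<open>B2\<close>, until \<open>B2\<close> is contained in \<open>B1\<close>.\<close>

lemma bases_card_eq:
  assumes M: "matroid E Bs" and "B1 \<in> Bs" "B2 \<in> Bs"
  shows "card B1 = card B2"
proof -
  have le: "card B2 \<le> card B1" if b1: "B1 \<in> Bs" and b2: "B2 \<in> Bs" for B1 B2
    using b2
  proof (induction "card (B2 - B1)" arbitrary: B2 rule: less_induct)
    case less
    note fin = matroidD(5)[OF M]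
    show ?case
    proof (cases "B2 \<subseteq> B1")
      case True
      then show ?thesis using fin[OF b1] card_mono by blast
    next
      case False
      then obtain x where x: "x \<in> B2 - B1" by blast
      obtain y where y: "y \<in> B1 - B2" "insert y (B2 - {x}) \<in> Bs"
        using matroid_exchange[OF M less.prems b1 x] by blast
      have "insert y (B2 - {x}) - B1 = (B2 - B1) - {x}" using y by blast
      then have "card (insert y (B2 - {x}) - B1) < card (B2 - B1)"
        using x fin[OF less.prems] by (metis card_Diff1_less finite_Diff)
      from less.hyps[OF this y(2)] have "card (insert y (B2 - {x})) \<le> card B1" .
      moreover have "card (insert y (B2 - {x})) = card B2"
        using x y fin[OF less.prems]
        by (metis DiffD1 DiffD2 card.remove card_insert_disjoint finite_Diff)
      ultimately show ?thesis by simp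
    qed
  qed
  show ?thesis using le assms by (meson le_antisym)
qed

lemma mrank_ge:
  assumes "matroid E Bs" "B \<in> Bs" shows "card (A \<inter> B) \<le> mrank Bs A"
  unfolding mrank_def using assms matroidD(3)[OF assms(1)] by (intro Max_ge) auto

lemma mrank_attained:
  assumes "matroid E Bs" obtains B where "B \<in> Bs" "card (A \<inter> B) = mrank Bs A"
proof -
  have "mrank Bs A \<in> (\<lambda>B. card (A \<inter> B)) ` Bs"
    unfolding mrank_def using matroidD[OF assms] by (intro Max_in) auto
  then show ?thesis using that by auto
qed

text \<open>This is the greedy algorithm: one basis is optimal for a whole chain. Remove the largest
  member \<open>A\<close>, and among the bases optimal for the rest take one closest to a basis
  \<open>B'\<close> optimal for \<open>A\<close>. If it were not optimal for \<open>A\<close>,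
  counting would give it an element outside both \<open>A\<close> and \<open>B'\<close>; exchanging
  that element towards \<open>B'\<close> loses nothing on the smaller members and comes closer to
  \<open>B'\<close>.\<close>

lemma chain_basis:
  assumes M: "matroid E Bs" and "finite C" "\<And>X Y. X \<in> C \<Longrightarrow> Y \<in> C \<Longrightarrow> X \<subseteq> Y \<or> Y \<subseteq> X"
  obtains B where "B \<in> Bs" "\<And>X. X \<in> C \<Longrightarrow> card (X \<inter> B) = mrank Bs X"
proof -
  have "\<exists>B\<in>Bs. \<forall>X\<in>C. card (X \<inter> B) = mrank Bs X"
    using assms(2,3)
  proof (induction "card C" arbitrary: C rule: less_induct)
    case less
    show ?case
    proof (cases "C = {}")
      case True
      then show ?thesis using matroidD(2)[OF M] by auto
    next
      case False
      then obtain A where A: "A \<in> C" "\<And>X. X \<in> C \<Longrightarrow> A \<subseteq> X \<Longrightarrow> A = X"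
        using finite_has_maximal[OF less.prems(1)] by metis
      have sub: "X \<subseteq> A" if "X \<in> C" for X using less.prems(2)[OF A(1) that] A(2)[OF that] by auto
      have "card (C - {A}) < card C" using A less.prems(1) by (metis card_Diff1_less)
      then have "\<exists>B\<in>Bs. \<forall>X\<in>C-{A}. card (X \<inter> B) = mrank Bs X"
        using less.hyps[of "C - {A}"] less.prems by auto
      then obtain B0 where B0: "B0 \<in> Bs \<and> (\<forall>X\<in>C-{A}. card (X \<inter> B0) = mrank Bs X)" by blast
      obtain B' where B': "B' \<in> Bs" "card (A \<inter> B') = mrank Bs A" using mrank_attained[OF M] .
      define B where "B = (ARG_MIN (\<lambda>B. card (B - B')) B.
        B \<in> Bs \<and> (\<forall>X\<in>C-{A}. card (X \<inter> B) = mrank Bs X))"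
      have B: "B \<in> Bs" "\<forall>X\<in>C-{A}. card (X \<inter> B) = mrank Bs X"
        using arg_min_natI[of "\<lambda>B. B \<in> Bs \<and> (\<forall>X\<in>C-{A}. card (X \<inter> B) = mrank Bs X)", OF B0]
        unfolding B_def by auto
      have least: "card (B - B') \<le> card (D - B')"
        if "D \<in> Bs" "\<forall>X\<in>C-{A}. card (X \<inter> D) = mrank Bs X" for D
        unfolding B_def by (rule arg_min_nat_le) (use that in blast)
      note fin = matroidD(5)[OF M]
      have "card (A \<inter> B) = mrank Bs A"
      proof (rule ccontr)
        assume "card (A \<inter> B) \<noteq> mrank Bs A"
        then have lt: "card (A \<inter> B) < card (A \<inter> B')" using mrank_ge[OF M B(1), of A] B' by simp
        have "card (B - A) + card (A \<inter> B) = card B" "card (B' - A) + card (A \<inter> B') = card B'"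
          using card_Int_Diff[OF fin[OF B(1)], of A] card_Int_Diff[OF fin[OF B'(1)], of A]
          by (simp_all add: Int_commute)
        then have "card (B' - A) < card (B - A)" using lt bases_card_eq[OF M B(1) B'(1)] by simp
        then have "\<not> B - A \<subseteq> B' - A" using fin[OF B'(1)]
          by (meson card_mono finite_Diff leD)
        then obtain x where x: "x \<in> B - B'" "x \<notin> A" by blast
        obtain y where y: "y \<in> B' - B" "insert y (B - {x}) \<in> Bs"
          using matroid_exchange[OF M B(1) B'(1) x(1)] by blast
        have "card (X \<inter> insert y (B - {x})) = mrank Bs X" if X: "X \<in> C - {A}" for X
        proof (rule antisym)
          show "card (X \<inter> insert y (B - {x})) \<le> mrank Bs X" using mrank_ge[OF M y(2)] .
          have "X \<inter> B \<subseteq> X \<inter> insert y (B - {x})" using X x sub by blast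
          then have "card (X \<inter> B) \<le> card (X \<inter> insert y (B - {x}))"
            using fin[OF y(2)] by (intro card_mono) auto
          then show "mrank Bs X \<le> card (X \<inter> insert y (B - {x}))" using B(2) X by simp
        qed
        from least[OF y(2)] this have "card (B - B') \<le> card (insert y (B - {x}) - B')" by blast
        moreover have "insert y (B - {x}) - B' = (B - B') - {x}" using y by blast
        moreover have "card ((B - B') - {x}) < card (B - B')"
          using x(1) fin[OF B(1)] by (intro card_Diff1_less) auto
        ultimately show False by simp
      qed
      then show ?thesis using B by (metis Diff_iff singletonD)
    qed
  qed
  then show ?thesis using that by blast
qed

lemma mrank_mono:
  assumes M: "matroid E Bs" and "A \<subseteq> B" shows "mrank Bs A \<le> mrank Bs B"
proof -
  obtain C where C: "C \<in> Bs" "card (A \<inter> C) = mrank Bs A" using mrank_attained[OF M] .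
  have "card (A \<inter> C) \<le> card (B \<inter> C)" using assms matroidD(5)[OF M C(1)] by (intro card_mono) auto
  then show ?thesis using C mrank_ge[OF M C(1), of B] by simp
qed

text \<open>The sets \<open>A \<inter> B\<close> and \<open>A \<union> B\<close> form a chain, so
  one basis is optimal for both, and intersection sizes with a fixed basis are modular.\<close>

lemma mrank_submodular:
  assumes M: "matroid E Bs"
  shows "mrank Bs (A \<union> B) + mrank Bs (A \<inter> B) \<le> mrank Bs A + mrank Bs B"
proof -
  obtain C where C: "C \<in> Bs" "\<And>X. X \<in> {A \<inter> B, A \<union> B} \<Longrightarrow> card (X \<inter> C) = mrank Bs X"
    by (rule chain_basis[OF M, of "{A \<inter> B, A \<union> B}"]) auto
  have f: "finite C" using matroidD(5)[OF M C(1)] .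
  have "card (A \<inter> C) + card (B \<inter> C) = card ((A \<inter> C) \<union> (B \<inter> C)) + card ((A \<inter> C) \<inter> (B \<inter> C))"
    using f by (intro card_Un_Int) auto
  also have "(A \<inter> C) \<union> (B \<inter> C) = (A \<union> B) \<inter> C" by blast
  also have "(A \<inter> C) \<inter> (B \<inter> C) = (A \<inter> B) \<inter> C" by blast
  finally have "card (A \<inter> C) + card (B \<inter> C) = mrank Bs (A \<union> B) + mrank Bs (A \<inter> B)" using C by simp
  then show ?thesis using mrank_ge[OF M C(1), of A] mrank_ge[OF M C(1), of B] by linarith
qed

lemma mrank_le_card:
  assumes M: "matroid E Bs" "finite A" shows "mrank Bs A \<le> card A"
proof -
  obtain B where "B \<in> Bs" "card (A \<inter> B) = mrank Bs A" using mrank_attained[OF M(1)] .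
  then show ?thesis using card_mono[OF M(2), of "A \<inter> B"] by simp
qed

lemma mrank_empty: "matroid E Bs \<Longrightarrow> mrank Bs {} = 0"
  using mrank_le_card[of E Bs "{}"] by simp

lemma mrank_insert_le:
  assumes M: "matroid E Bs" shows "mrank Bs (insert x A) \<le> Suc (mrank Bs A)"
  using mrank_submodular[OF M, of A "{x}"] mrank_le_card[OF M, of "{x}"] by simp

text \<open>Submodularity for \<open>A \<union> X\<close> and \<open>insert x A\<close>, whose
  intersection still has at least the rank of \<open>A\<close>, absorbs one more element at a
  time.\<close>

lemma mrank_absorb:
  assumes M: "matroid E Bs" and "finite X" "\<And>x. x \<in> X \<Longrightarrow> mrank Bs (insert x A) = mrank Bs A"
  shows "mrank Bs (A \<union> X) = mrank Bs A"
  using assms(2,3)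
proof (induction X rule: finite_induct)
  case (insert x X)
  have "mrank Bs ((A \<union> X) \<union> insert x A) + mrank Bs ((A \<union> X) \<inter> insert x A)
      \<le> mrank Bs (A \<union> X) + mrank Bs (insert x A)" by (rule mrank_submodular[OF M])
  moreover have "mrank Bs A \<le> mrank Bs ((A \<union> X) \<inter> insert x A)" by (rule mrank_mono[OF M]) blast
  moreover have "mrank Bs (A \<union> X) = mrank Bs A" "mrank Bs (insert x A) = mrank Bs A"
    using insert by auto
  moreover have "(A \<union> X) \<union> insert x A = A \<union> insert x X" by blast
  moreover have "mrank Bs A \<le> mrank Bs (A \<union> insert x X)" by (rule mrank_mono[OF M]) blast
  ultimately show ?case by simp
qed auto

section \<open>Closure and flats\<close>

lemma subset_closure: "A \<subseteq> E \<Longrightarrow> A \<subseteq> mclosure E Bs A"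
  unfolding mclosure_def by (auto simp: insert_absorb)

lemma closure_subset: "mclosure E Bs A \<subseteq> E"
  unfolding mclosure_def by auto

lemma mrank_closure:
  assumes M: "matroid E Bs" and "A \<subseteq> E"
  shows "mrank Bs (mclosure E Bs A) = mrank Bs A"
proof -
  have "finite (mclosure E Bs A)" using closure_subset matroidD(1)[OF M] finite_subset by metis
  from mrank_absorb[OF M this, of A] have "mrank Bs (A \<union> mclosure E Bs A) = mrank Bs A"
    by (auto simp: mclosure_def)
  then show ?thesis using subset_closure[OF assms(2)] by (simp add: sup.absorb2)
qed

lemma flatsD: "F \<in> flats E Bs \<Longrightarrow> F \<subseteq> E" by (simp add: flats_def)

lemma closure_flat:
  assumes M: "matroid E Bs" and A: "A \<subseteq> E"
  shows "mclosure E Bs A \<in> flats E Bs"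
proof -
  let ?C = "mclosure E Bs A"
  have "mrank Bs ?C < mrank Bs (insert x ?C)" if x: "x \<in> E - ?C" for x
  proof -
    have "mrank Bs A \<le> mrank Bs (insert x A)" by (rule mrank_mono[OF M]) blast
    moreover have "mrank Bs (insert x A) \<noteq> mrank Bs A" using x unfolding mclosure_def by auto
    ultimately have "mrank Bs A < mrank Bs (insert x A)" by simp
    moreover have "mrank Bs (insert x A) \<le> mrank Bs (insert x ?C)"
      using subset_closure[OF A] by (intro mrank_mono[OF M]) blast
    ultimately show ?thesis using mrank_closure[OF M A] by simp
  qed
  then show ?thesis unfolding flats_def using closure_subset by blast
qed

text \<open>If \<open>x\<close> lay outside the flat \<open>F\<close>, submodularity for
  \<open>F\<close> and \<open>insert x A\<close> would bound the rank of \<open>insert x F\<close>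
  by that of \<open>F\<close>.\<close>

lemma closure_minimal:
  assumes M: "matroid E Bs" and F: "F \<in> flats E Bs" and AF: "A \<subseteq> F"
  shows "mclosure E Bs A \<subseteq> F"
proof
  fix x assume x: "x \<in> mclosure E Bs A"
  show "x \<in> F"
  proof (rule ccontr)
    assume "x \<notin> F"
    then have lt: "mrank Bs F < mrank Bs (insert x F)" using F x
      by (auto simp: flats_def mclosure_def)
    have "mrank Bs (F \<union> insert x A) + mrank Bs (F \<inter> insert x A) \<le> mrank Bs F + mrank Bs (insert x A)"
      by (rule mrank_submodular[OF M])
    moreover have "mrank Bs A \<le> mrank Bs (F \<inter> insert x A)" using AF by (intro mrank_mono[OF M]) blast
    moreover have "F \<union> insert x A = insert x F" using AF by blast
    moreover have "mrank Bs (insert x A) = mrank Bs A" using x by (simp add: mclosure_def)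
    ultimately show False using lt by simp
  qed
qed

lemma flats_mrank_strict:
  assumes M: "matroid E Bs" and F: "F \<in> flats E Bs" and "G \<in> flats E Bs" "F \<subset> G"
  shows "mrank Bs F < mrank Bs G"
proof -
  obtain x where x: "x \<in> G - F" using assms by blast
  then have "x \<in> E - F" using flatsD[OF assms(3)] by blast
  then have "mrank Bs F < mrank Bs (insert x F)" using F by (auto simp: flats_def)
  also have "\<dots> \<le> mrank Bs G" using x assms by (intro mrank_mono[OF M]) blast
  finally show ?thesis .
qed

lemma flats_Int:
  assumes M: "matroid E Bs" and F: "F \<in> flats E Bs" and G: "G \<in> flats E Bs"
  shows "F \<inter> G \<in> flats E Bs"
proof -
  have s: "F \<inter> G \<subseteq> E" using flatsD[OF F] by blast
  have "mclosure E Bs (F \<inter> G) \<subseteq> F \<inter> G"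
    using closure_minimal[OF M F] closure_minimal[OF M G] by (metis inf_le1 inf_le2 le_inf_iff)
  then have "mclosure E Bs (F \<inter> G) = F \<inter> G" using subset_closure[OF s] by blast
  then show ?thesis using closure_flat[OF M s] by simp
qed

lemma ground_flat: "E \<in> flats E Bs" by (simp add: flats_def)

lemma finite_flats: "matroid E Bs \<Longrightarrow> finite (flats E Bs)"
  by (rule finite_subset[of _ "Pow E"]) (auto simp: flats_def matroidD(1))

text \<open>An element has positive rank exactly when some basis contains it. The locale
  \<open>loopless_matroid\<close> assumes the absence of loops in this form.\<close>

lemma empty_flat_iff:
  assumes M: "matroid E Bs"
  shows "{} \<in> flats E Bs \<longleftrightarrow> loops E Bs = {}"
proof -
  have "0 < mrank Bs {x} \<longleftrightarrow> x \<in> \<Union>Bs" if "x \<in> E" for x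
  proof
    assume "0 < mrank Bs {x}"
    then obtain B where "B \<in> Bs" "0 < card ({x} \<inter> B)" using mrank_attained[OF M] by metis
    then show "x \<in> \<Union>Bs" using card_gt_0_iff by fastforce
  next
    assume "x \<in> \<Union>Bs"
    then obtain B where B: "B \<in> Bs" "x \<in> B" by blast
    then show "0 < mrank Bs {x}" using mrank_ge[OF M B(1), of "{x}"] by simp
  qed
  then show ?thesis unfolding flats_def loops_def using mrank_empty[OF M] by auto
qed

section \<open>Euler characteristic of relatively open convex sets\<close>

text \<open>For a finite-dimensional convex set this is openness in the affine hull, stated without
  topology: the segment from \<open>y\<close> to \<open>x\<close> can be prolonged beyond
  \<open>x\<close>.\<close>

definition relopen :: "(nat \<Rightarrow>\<^sub>0 real) set \<Rightarrow> bool" where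
  "relopen Q \<longleftrightarrow> (\<forall>x\<in>Q. \<forall>y\<in>Q. \<exists>t>0. x + t *\<^sub>R (x - y) \<in> Q)"

abbreviation diffs :: "(nat \<Rightarrow>\<^sub>0 real) set \<Rightarrow> (nat \<Rightarrow>\<^sub>0 real) set" where
  "diffs P \<equiv> {x - y | x y. x \<in> P \<and> y \<in> P}"

lemma lookup_scaleR_real [simp]:
  "Poly_Mapping.lookup (c *\<^sub>R x) i = c * Poly_Mapping.lookup (x :: 'a \<Rightarrow>\<^sub>0 real) i"
proof -
  have "finite {i. c * Poly_Mapping.lookup x i \<noteq> 0}"
    by (rule finite_subset[OF _ finite_lookup[of x]]) auto
  then show ?thesis by (simp add: scaleR_poly_mapping_def)
qed

lemma linear_lookup: "linear (\<lambda>x. Poly_Mapping.lookup (x :: nat \<Rightarrow>\<^sub>0 real) i)"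
  by (rule linearI) (simp_all add: lookup_add)

lemma convex_convex_comb:
  fixes x y :: "'a::real_vector"
  assumes "convex Q" "x \<in> Q" "y \<in> Q" "0 \<le> t" "t \<le> 1" shows "x + t *\<^sub>R (y - x) \<in> Q"
proof -
  have "(1 - t) *\<^sub>R x + t *\<^sub>R y \<in> Q" using assms by (simp add: convex_alt)
  then show ?thesis by (simp add: algebra_simps)
qed

text \<open>Seen from any point \<open>p\<close>, the admissible directions already form a subspace:
  convexity gives sums, and prolonging segments gives negatives. The direction space of a slice can
  thus be read off at a single point.\<close>

lemma relopen_directions:
  assumes C: "convex Q" and R: "relopen Q" and p: "p \<in> Q"
  shows "span (diffs Q) = {d. \<exists>t>0. p + t *\<^sub>R d \<in> Q}" (is "_ = ?D")
proof
  have "0 \<in> ?D" using p by (auto intro!: exI[of _ 1])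
  moreover have "d1 + d2 \<in> ?D" if d: "d1 \<in> ?D" "d2 \<in> ?D" for d1 d2
  proof -
    obtain t u where t: "t > 0" "p + t *\<^sub>R d1 \<in> Q" and u: "u > 0" "p + u *\<^sub>R d2 \<in> Q" using d by blast
    \<comment> \<open>The ratio \<open>t / (t + u)\<close> gives \<open>d1\<close> and
      \<open>d2\<close> the same coefficient \<open>t * u / (t + u)\<close>.\<close>
    have "(p + t *\<^sub>R d1) + (t / (t + u)) *\<^sub>R ((p + u *\<^sub>R d2) - (p + t *\<^sub>R d1)) \<in> Q"
      using t u by (intro convex_convex_comb[OF C]) auto
    also have "(p + t *\<^sub>R d1) + (t / (t + u)) *\<^sub>R ((p + u *\<^sub>R d2) - (p + t *\<^sub>R d1))
       = p + (t - t * t / (t + u)) *\<^sub>R d1 + (t * u / (t + u)) *\<^sub>R d2"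
      by (simp add: algebra_simps)
    also have "t - t * t / (t + u) = t * u / (t + u)" using t u by (simp add: field_simps)
    finally have "p + (t * u / (t + u)) *\<^sub>R (d1 + d2) \<in> Q" by (simp add: algebra_simps)
    then show ?thesis using t u by (auto intro!: exI[of _ "t * u / (t + u)"])
  qed
  moreover have "c *\<^sub>R d \<in> ?D" if d: "d \<in> ?D" for c d
  proof -
    obtain t where t: "t > 0" "p + t *\<^sub>R d \<in> Q" using d by blast
    obtain e where e: "e > 0" "p + e *\<^sub>R (p - (p + t *\<^sub>R d)) \<in> Q" using R p t unfolding relopen_def by blast
    consider "c = 0" | "c > 0" | "c < 0" by linarith
    then show ?thesis
    proof cases
      case 1
      then show ?thesis using \<open>0 \<in> ?D\<close> by simp
    next
      case 2
      then show ?thesis using t by (auto intro!: exI[of _ "t / c"])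
    next
      case 3
      then have "(e * t / (- c)) > 0" using e t by (intro divide_pos_pos mult_pos_pos) auto
      moreover have "p + (e * t / (- c)) *\<^sub>R (c *\<^sub>R d) \<in> Q" using 3 e by (simp add: algebra_simps)
      ultimately show ?thesis by blast
    qed
  qed
  ultimately have sub: "subspace ?D" by (auto simp: subspace_def)
  have D: "x - p \<in> ?D" if "x \<in> Q" for x using that by (auto intro!: exI[of _ 1])
  have "diffs Q \<subseteq> ?D"
  proof
    fix d assume "d \<in> diffs Q"
    then obtain x y where d: "d = (x - p) - (y - p)" "x \<in> Q" "y \<in> Q" by auto
    show "d \<in> ?D" unfolding d(1) using subspace_diff[OF sub D[OF d(2)] D[OF d(3)]] .
  qed
  then show "span (diffs Q) \<subseteq> ?D" using span_minimal[OF _ sub] by blast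
  show "?D \<subseteq> span (diffs Q)"
  proof
    fix d assume "d \<in> ?D"
    then obtain t where t: "t > 0" "p + t *\<^sub>R d \<in> Q" by blast
    have "(p + t *\<^sub>R d) - p \<in> span (diffs Q)" using t p by (intro span_base) blast
    then have "(1 / t) *\<^sub>R ((p + t *\<^sub>R d) - p) \<in> span (diffs Q)" by (rule span_scale)
    then show "d \<in> span (diffs Q)" using t by simp
  qed
qed

text \<open>Rank and nullity for one functional: a basis of the kernel together with
  \<open>v\<close> is a basis of \<open>V\<close>. The finite set \<open>W\<close> makes this basis
  finite, so that its cardinality counts the dimension.\<close>

lemma dim_kernel:
  fixes V :: "'a::real_vector set" and f :: "'a \<Rightarrow> real"
  assumes V: "subspace V" "V \<subseteq> span W" "finite W" and f: "linear f" and v: "v \<in> V" "f v \<noteq> 0"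
  shows "dim V = Suc (dim {x\<in>V. f x = 0})"
proof -
  let ?K = "{x\<in>V. f x = 0}"
  have K: "subspace ?K" using V(1) f
    by (auto simp: subspace_def linear_0 linear_add linear_scale)
  obtain B where B: "B \<subseteq> ?K" "independent B" "?K \<subseteq> span B" "card B = dim ?K"
    using real_vector.basis_exists by blast
  have fin: "finite B" using real_vector.independent_span_bound[OF V(3) B(2)] B(1) V(2) by blast
  have "span B \<subseteq> ?K" using span_minimal[OF B(1) K] .
  then have vB: "v \<notin> span B" using v by auto
  then have ind: "independent (insert v B)" using B(2) by (simp add: real_vector.independent_insert)
  have "V \<subseteq> span (insert v B)"
  proof
    fix x assume x: "x \<in> V"
    have "x - (f x / f v) *\<^sub>R v \<in> ?K"
      using x v V(1) f by (auto simp: subspace_diff subspace_scale linear_diff linear_scale)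
    then show "x \<in> span (insert v B)" using B(3) by (auto simp: real_vector.span_insert)
  qed
  moreover have "insert v B \<subseteq> V" using B v by auto
  ultimately have "dim V = card (insert v B)" using real_vector.dim_unique[of "insert v B" V] ind by simp
  also have "\<dots> = Suc (card B)" using fin vB real_vector.span_base by (metis card_insert_disjoint)
  finally show ?thesis using B by simp
qed

lemma span_support:
  fixes x :: "nat \<Rightarrow>\<^sub>0 real"
  assumes "finite X" "\<And>i. i \<notin> X \<Longrightarrow> Poly_Mapping.lookup x i = 0"
  shows "x \<in> span ((\<lambda>i. Poly_Mapping.single i (1::real)) ` X)"
proof -
  have "x = (\<Sum>i\<in>X. Poly_Mapping.lookup x i *\<^sub>R Poly_Mapping.single i 1)"
  proof (rule poly_mapping_eqI)
    fix k
    have "(\<Sum>i\<in>X. Poly_Mapping.lookup x i * (1 when i = k)) =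
      (\<Sum>i\<in>X. if i = k then Poly_Mapping.lookup x i else 0)" by (rule sum.cong) auto
    then show "Poly_Mapping.lookup x k =
        Poly_Mapping.lookup (\<Sum>i\<in>X. Poly_Mapping.lookup x i *\<^sub>R Poly_Mapping.single i 1) k"
      using assms by (simp add: lookup_sum lookup_single)
  qed
  also have "\<dots> \<in> span ((\<lambda>i. Poly_Mapping.single i (1::real)) ` X)"
    by (intro span_sum span_scale span_base) auto
  finally show ?thesis .
qed

text \<open>The directions of the slice are the directions of \<open>Q\<close> on which coordinate
  \<open>e\<close> vanishes, and \<open>y - p\<close> is one on which it does not. Prescribing the
  coordinates outside \<open>X\<close> by \<open>z\<close> confines all directions to a
  finite-dimensional space.\<close>

lemma pdim_slice:
  assumes Q: "convex Q" "relopen Q" and X: "finite X"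
    and sup: "\<And>x i. x \<in> Q \<Longrightarrow> i \<notin> X \<Longrightarrow> Poly_Mapping.lookup x i = z i"
    and p: "p \<in> Q" "Poly_Mapping.lookup p e = s" and y: "y \<in> Q" "Poly_Mapping.lookup y e \<noteq> s"
  shows "pdim Q = Suc (pdim {x\<in>Q. Poly_Mapping.lookup x e = s})"
    and "convex {x\<in>Q. Poly_Mapping.lookup x e = s}"
    and "relopen {x\<in>Q. Poly_Mapping.lookup x e = s}"
proof -
  let ?Q = "{x\<in>Q. Poly_Mapping.lookup x e = s}"
  show conv: "convex ?Q"
  proof (rule convexI)
    fix x y u v assume "x \<in> ?Q" "y \<in> ?Q" "0 \<le> (u::real)" "0 \<le> v" "u + v = 1"
    moreover from this have "u *\<^sub>R x + v *\<^sub>R y \<in> Q" using Q(1) unfolding convex_def by blast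
    moreover have "u * s + v * s = s" using \<open>u + v = 1\<close> by (metis distrib_right mult_1)
    ultimately show "u *\<^sub>R x + v *\<^sub>R y \<in> ?Q" by (simp add: lookup_add)
  qed
  show ro: "relopen ?Q" unfolding relopen_def
  proof (intro ballI)
    fix x y assume xy: "x \<in> ?Q" "y \<in> ?Q"
    then obtain t where "t > 0" "x + t *\<^sub>R (x - y) \<in> Q" using Q(2) unfolding relopen_def by blast
    then show "\<exists>t>0. x + t *\<^sub>R (x - y) \<in> ?Q" using xy
      by (auto intro!: exI[of _ t] simp: lookup_add lookup_minus)
  qed
  have pQ: "p \<in> ?Q" using p by simp
  note dQ = relopen_directions[OF Q p(1)] and dQ' = relopen_directions[OF conv ro pQ]
  let ?V = "span (diffs Q)"
  have eq: "span (diffs ?Q) = {d\<in>?V. Poly_Mapping.lookup d e = 0}"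
    unfolding dQ dQ' using p by (auto simp: lookup_add)
  have "?V \<subseteq> span ((\<lambda>i. Poly_Mapping.single i (1::real)) ` X)"
  proof (rule real_vector.span_minimal)
    show "diffs Q \<subseteq> span ((\<lambda>i. Poly_Mapping.single i (1::real)) ` X)"
      using sup by (auto intro!: span_support[OF X] simp: lookup_minus)
  qed simp
  moreover have "y - p \<in> ?V" using p y by (intro span_base) blast
  ultimately have "dim ?V = Suc (dim {d\<in>?V. Poly_Mapping.lookup d e = 0})"
    using X p y by (intro dim_kernel[OF _ _ _ linear_lookup, where v = "y - p"]) (auto simp: lookup_minus)
  then show "pdim Q = Suc (pdim ?Q)" unfolding pdim_def eq[symmetric] by simp
qed

text \<open>The ends are the infimum and the supremum of the coordinate. Neither is attained,
  because a segment ending at an extremal point could be prolonged; convexity fills in what lies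
  between.\<close>

lemma projection_interval:
  assumes Q: "convex Q" "relopen Q"
    and bd: "\<And>x. x \<in> Q \<Longrightarrow> \<bar>Poly_Mapping.lookup x e\<bar> \<le> M"
    and ne: "x0 \<in> Q" "y0 \<in> Q" "Poly_Mapping.lookup x0 e \<noteq> Poly_Mapping.lookup y0 e"
  obtains a b where "a < b" "\<And>s. (\<exists>x\<in>Q. Poly_Mapping.lookup x e = s) \<longleftrightarrow> a < s \<and> s < b"
proof -
  define S where "S = (\<lambda>x. Poly_Mapping.lookup x e) ` Q"
  have bd': "- M \<le> s \<and> s \<le> M" if "s \<in> S" for s using bd that unfolding S_def by fastforce
  have bdd: "bdd_below S" "bdd_above S" using bd' by (meson bdd_belowI bdd_aboveI)+
  have S0: "S \<noteq> {}" using ne(1) S_def by blast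
  have iff: "s \<in> S \<longleftrightarrow> Inf S < s \<and> s < Sup S" for s
  proof
    assume "s \<in> S"
    then obtain x where x: "x \<in> Q" "s = Poly_Mapping.lookup x e" unfolding S_def by blast
    obtain y where y: "y \<in> Q" "Poly_Mapping.lookup y e \<noteq> s" using ne by metis
    obtain t where t: "t > 0" "x + t *\<^sub>R (x - y) \<in> Q" using Q(2) x y unfolding relopen_def by blast
    have m: "s + t * (s - Poly_Mapping.lookup y e) \<in> S" "Poly_Mapping.lookup y e \<in> S"
      using t x y unfolding S_def by (auto simp: lookup_add lookup_minus intro!: rev_image_eqI)
    show "Inf S < s \<and> s < Sup S"
    proof (cases "Poly_Mapping.lookup y e < s")
      case True
      then have "t * (s - Poly_Mapping.lookup y e) > 0" using t by simp
      then show ?thesis using True cInf_lower[OF m(2) bdd(1)] cSup_upper[OF m(1) bdd(2)] by linarith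
    next
      case False
      then have "t * (s - Poly_Mapping.lookup y e) < 0" using t y by (simp add: mult_pos_neg)
      then show ?thesis using False y cInf_lower[OF m(1) bdd(1)] cSup_upper[OF m(2) bdd(2)] by linarith
    qed
  next
    assume s: "Inf S < s \<and> s < Sup S"
    obtain u v where uv: "u \<in> S" "u < s" "v \<in> S" "s < v"
      using s cInf_lessD[OF S0] less_cSupD[OF S0] by meson
    then obtain x y where xy: "x \<in> Q" "y \<in> Q" "u = Poly_Mapping.lookup x e" "v = Poly_Mapping.lookup y e"
      unfolding S_def by blast
    have "x + ((s - u) / (v - u)) *\<^sub>R (y - x) \<in> Q" using uv by (intro convex_convex_comb[OF Q(1) xy(1,2)]) auto
    moreover have "Poly_Mapping.lookup (x + ((s - u) / (v - u)) *\<^sub>R (y - x)) e = s"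
      using uv xy(3,4) by (simp add: lookup_add lookup_minus)
    ultimately show "s \<in> S" unfolding S_def by (metis imageI)
  qed
  have "Poly_Mapping.lookup x0 e \<in> S" using ne(1) S_def by blast
  then have "Inf S < Sup S" using iff by fastforce
  moreover have "(\<exists>x\<in>Q. Poly_Mapping.lookup x e = s) \<longleftrightarrow> s \<in> S" for s unfolding S_def by auto
  ultimately show ?thesis using that iff by metis
qed

text \<open>The one-dimensional case: sum the jumps \<open>g s - g (s+)\<close> of a step function \<open>g\<close>.\<close>

lemma euler_line:
  fixes d :: "'j \<Rightarrow> int" and a lo hi :: "'j \<Rightarrow> real"
  assumes fin: "finite P" "finite I" and lt: "\<And>j. j \<in> I \<Longrightarrow> lo j < hi j"
    and eq: "\<And>s. (\<Sum>j\<in>{j\<in>P. a j = s}. d j) = (\<Sum>j\<in>{j\<in>I. lo j < s \<and> s < hi j}. d j)"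
  shows "sum d P + sum d I = 0"
proof -
  \<comment> \<open>All positions at which the step function can change.\<close>
  define T where "T = a ` P \<union> lo ` I \<union> hi ` I"
  have T: "finite T" unfolding T_def using fin by simp
  have "\<exists>r>0. \<forall>x\<in>T. \<forall>y\<in>T. x < y \<longrightarrow> x + r < y"
  proof (cases "{y - x | x y. x \<in> T \<and> y \<in> T \<and> x < y} = {}")
    case True
    then show ?thesis by (intro exI[of _ 1]) auto
  next
    case False
    define D where "D = {y - x | x y. x \<in> T \<and> y \<in> T \<and> x < y}"
    have "D \<subseteq> (\<lambda>(x, y). y - x) ` (T \<times> T)" unfolding D_def by auto
    then have "finite D" using T finite_subset by blast
    then have "Min D \<in> D" "\<And>x. x \<in> D \<Longrightarrow> Min D \<le> x" using False unfolding D_def[symmetric] by auto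
    moreover have "x > 0" if "x \<in> D" for x using that unfolding D_def by auto
    ultimately have pos: "Min D > 0" and le: "\<And>x. x \<in> D \<Longrightarrow> Min D \<le> x" by blast+
    have "x + Min D / 2 < y" if "x \<in> T" "y \<in> T" "x < y" for x y
    proof -
      have "y - x \<in> D" using that unfolding D_def by blast
      then show ?thesis using le[of "y - x"] pos by linarith
    qed
    then show ?thesis using pos by (intro exI[of _ "Min D / 2"]) auto
  qed
  then obtain r where r: "r > 0" "\<And>x y. x \<in> T \<Longrightarrow> y \<in> T \<Longrightarrow> x < y \<Longrightarrow> x + r < y" by blast
  have jump: "(\<Sum>j\<in>{j\<in>P. a j = x}. d j) = - (\<Sum>j\<in>{j\<in>I. lo j = x}. d j)" if x: "x \<in> T" for x
  proof -
    \<comment> \<open>No point mass sits at \<open>x + r\<close>, and the intervals containing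
      \<open>x + r\<close> are those containing \<open>x\<close> together with those starting at
      \<open>x\<close>. Evaluation at \<open>x + r\<close> thus plays the part of the limit from the
      right at \<open>x\<close>.\<close>
    have "a j \<noteq> x + r" if "j \<in> P" for j
      using r(2)[OF x, of "a j"] r(1) that unfolding T_def by force
    then have "{j\<in>P. a j = x + r} = {}" by blast
    then have "0 = (\<Sum>j\<in>{j\<in>I. lo j < x + r \<and> x + r < hi j}. d j)" using eq[of "x + r"] by (metis sum.empty)
    also have "{j\<in>I. lo j < x + r \<and> x + r < hi j} = {j\<in>I. lo j < x \<and> x < hi j} \<union> {j\<in>I. lo j = x}"
    proof -
      have "lo j < x + r \<and> x + r < hi j \<longleftrightarrow> (lo j < x \<and> x < hi j) \<or> lo j = x" if j: "j \<in> I" for j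
      proof -
        have "lo j \<in> T" "hi j \<in> T" using j unfolding T_def by auto
        then show ?thesis using r(1) r(2)[OF x, of "lo j"] r(2)[OF x, of "hi j"] lt[OF j]
          by (smt (verit))
      qed
      then show ?thesis by blast
    qed
    also have "sum d \<dots> = (\<Sum>j\<in>{j\<in>I. lo j < x \<and> x < hi j}. d j) + (\<Sum>j\<in>{j\<in>I. lo j = x}. d j)"
      using fin by (intro sum.union_disjoint) auto
    finally show ?thesis using eq[of x] by simp
  qed
  have "sum d P = (\<Sum>x\<in>T. \<Sum>j\<in>{j\<in>P. a j = x}. d j)"
    by (rule sum.group[symmetric]) (use fin T in \<open>auto simp: T_def\<close>)
  also have "\<dots> = - (\<Sum>x\<in>T. \<Sum>j\<in>{j\<in>I. lo j = x}. d j)" by (simp add: jump sum_negf)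
  also have "(\<Sum>x\<in>T. \<Sum>j\<in>{j\<in>I. lo j = x}. d j) = sum d I"
    by (rule sum.group) (use fin T in \<open>auto simp: T_def\<close>)
  finally show ?thesis by simp
qed

text \<open>Slicing by one coordinate lowers the dimension by one, except for the sets on which the
  coordinate is constant; integrating over the slices is the one-dimensional case.\<close>

lemma euler_relation:
  fixes c :: "'j \<Rightarrow> int" and z :: "nat \<Rightarrow> real"
  assumes "finite X" "finite J"
    and "\<And>j. j \<in> J \<Longrightarrow> Q j \<noteq> {} \<and> convex (Q j) \<and> relopen (Q j)"
    and "\<And>j x i. j \<in> J \<Longrightarrow> x \<in> Q j \<Longrightarrow> \<bar>Poly_Mapping.lookup x i\<bar> \<le> M"
    and "\<And>j x i. j \<in> J \<Longrightarrow> x \<in> Q j \<Longrightarrow> i \<notin> X \<Longrightarrow> Poly_Mapping.lookup x i = z i"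
    and "\<And>x. (\<Sum>j\<in>{j\<in>J. x \<in> Q j}. c j) = 0"
  shows "(\<Sum>j\<in>J. c j * (-1) ^ pdim (Q j)) = 0"
  using assms
proof (induction X arbitrary: J Q z rule: finite_induct)
  case empty
  show ?case
  proof (cases "J = {}")
    case False
    then obtain j0 x0 where j0: "j0 \<in> J" "x0 \<in> Q j0" using empty.prems(2) by blast
    \<comment> \<open>With every coordinate prescribed by \<open>z\<close>, all the sets are one and
      the same point.\<close>
    have Qeq: "Q j = {x0}" if "j \<in> J" for j
    proof -
      have "x = x0" if "x \<in> Q j" for x
        by (rule poly_mapping_eqI) (use empty.prems(4) j0 that \<open>j \<in> J\<close> in auto)
      then show ?thesis using empty.prems(2)[OF that] by auto
    qed
    have "{j\<in>J. x0 \<in> Q j} = J" using Qeq by auto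
    then have "sum c J = 0" using empty.prems(5)[of x0] by simp
    moreover have "pdim {x0} = 0"
    proof -
      have "diffs {x0} = {0}" by auto
      moreover have "dim {0 :: nat \<Rightarrow>\<^sub>0 real} = 0"
        using real_vector.dim_span[of "{}"] real_vector.dim_le_card[of "{0}" "{}"] by simp
      ultimately show ?thesis unfolding pdim_def by (simp only:)
    qed
    ultimately show ?thesis using Qeq by simp
  qed simp
next
  case (insert e X)
  note conv = insert.prems(2) and bd = insert.prems(3) and sup = insert.prems(4)
  let ?l = "\<lambda>x. Poly_Mapping.lookup x e"
  define d where "d j = c j * (-1) ^ pdim (Q j)" for j
  \<comment> \<open>Sets on which coordinate \<open>e\<close> is constant act as point masses, the
    others as open intervals.\<close>
  define P where "P = {j\<in>J. \<exists>a. \<forall>x\<in>Q j. ?l x = a}"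
  define I where "I = J - P"
  have fin: "finite P" "finite I" unfolding P_def I_def using insert.prems(1) by auto
  define a where "a j = (SOME a. \<forall>x\<in>Q j. ?l x = a)" for j
  have a: "?l x = a j" if "j \<in> P" "x \<in> Q j" for j x
    using someI_ex[of "\<lambda>a. \<forall>x\<in>Q j. ?l x = a"] that unfolding P_def a_def by blast
  have "\<exists>u v. u < v \<and> (\<forall>s. (\<exists>x\<in>Q j. ?l x = s) \<longleftrightarrow> u < s \<and> s < v)" if "j \<in> I" for j
  proof -
    have j: "j \<in> J" "\<nexists>a. \<forall>x\<in>Q j. ?l x = a" using that unfolding I_def P_def by auto
    then obtain x0 where x0: "x0 \<in> Q j" using conv by blast
    then obtain y0 where y0: "y0 \<in> Q j" "?l x0 \<noteq> ?l y0" using j(2) by metis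
    show ?thesis using projection_interval[of "Q j" e M x0 y0] conv[OF j(1)] bd[OF j(1)] x0 y0 by metis
  qed
  then obtain lo hi where lh: "\<And>j. j \<in> I \<Longrightarrow> lo j < hi j"
    "\<And>j s. j \<in> I \<Longrightarrow> (\<exists>x\<in>Q j. ?l x = s) \<longleftrightarrow> lo j < s \<and> s < hi j" by metis
  have "(\<Sum>j\<in>{j\<in>P. a j = s}. d j) = (\<Sum>j\<in>{j\<in>I. lo j < s \<and> s < hi j}. d j)" for s
  proof -
    define K where "K = {j\<in>J. \<exists>x\<in>Q j. ?l x = s}"
    define R where "R j = {x\<in>Q j. ?l x = s}" for j
    have KP: "{j\<in>P. a j = s} = K \<inter> P" 
    proof -
      have "a j = s \<longleftrightarrow> (\<exists>x\<in>Q j. ?l x = s)" if "j \<in> P" for j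
      proof -
        obtain x where "x \<in> Q j" using conv[of j] \<open>j \<in> P\<close> unfolding P_def by blast
        then show ?thesis using a[OF that] by metis
      qed
      then show ?thesis unfolding K_def P_def by blast
    qed
    have KI: "{j\<in>I. lo j < s \<and> s < hi j} = K \<inter> I" using lh(2) unfolding K_def I_def by blast
    have K: "K = (K \<inter> P) \<union> (K \<inter> I)" "finite K" using insert.prems(1) unfolding K_def I_def by auto
    have RP: "R j = Q j" if "j \<in> K \<inter> P" for j using a that KP unfolding R_def by auto
    have RI: "pdim (Q j) = Suc (pdim (R j)) \<and> convex (R j) \<and> relopen (R j)" if jK: "j \<in> K \<inter> I" for j
    proof -
      have j: "j \<in> J" "\<nexists>a. \<forall>x\<in>Q j. ?l x = a" using jK unfolding I_def P_def by auto
      obtain p where p: "p \<in> Q j" "?l p = s" using jK unfolding K_def by blast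
      obtain y where y: "y \<in> Q j" "?l y \<noteq> s" using j(2) by blast
      show ?thesis unfolding R_def
        using pdim_slice[of "Q j" "insert e X" z p e s y] conv[OF j(1)] sup[OF j(1)] p y insert.hyps(1)
        by blast
    qed
    \<comment> \<open>The induction hypothesis applies to the slices at height \<open>s\<close>,
      where coordinate \<open>e\<close> joins the prescribed ones. A slice of a set in
      \<open>P\<close> is the set itself; a slice of a set in \<open>I\<close> has dimension one
      less, which produces the sign change in terms of \<open>d\<close>.\<close>
    have "(\<Sum>j\<in>K. c j * (-1) ^ pdim (R j)) = 0"
    proof (rule insert.IH[where z = "z(e := s)"])
      show "finite K" by (rule K(2))
      show "R j \<noteq> {} \<and> convex (R j) \<and> relopen (R j)" if "j \<in> K" for j
      proof -
        have "R j \<noteq> {}" using that unfolding K_def R_def by blast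
        moreover have "convex (R j) \<and> relopen (R j)"
        proof (cases "j \<in> P")
          case True
          then have "R j = Q j" using RP that by blast
          then show ?thesis using conv[of j] that unfolding K_def by simp
        next
          case False
          then have "j \<in> K \<inter> I" using that unfolding K_def I_def by blast
          then show ?thesis using RI by blast
        qed
        ultimately show ?thesis by blast
      qed
      show "\<bar>Poly_Mapping.lookup x i\<bar> \<le> M" if "j \<in> K" "x \<in> R j" for j x i
        using bd that unfolding K_def R_def by auto
      show "Poly_Mapping.lookup x i = (z(e := s)) i" if "j \<in> K" "x \<in> R j" "i \<notin> X" for j x i
        using sup that unfolding K_def R_def by auto
      show "(\<Sum>j\<in>{j\<in>K. x \<in> R j}. c j) = 0" for x
      proof (cases "?l x = s")
        case True
        then have "{j\<in>K. x \<in> R j} = {j\<in>J. x \<in> Q j}" unfolding K_def R_def by auto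
        then show ?thesis using insert.prems(5) by simp
      next
        case False
        then have "{j\<in>K. x \<in> R j} = {}" unfolding R_def by auto
        then show ?thesis by (metis sum.empty)
      qed
    qed
    also have "(\<Sum>j\<in>K. c j * (-1) ^ pdim (R j)) =
      (\<Sum>j\<in>K \<inter> P. c j * (-1) ^ pdim (R j)) + (\<Sum>j\<in>K \<inter> I. c j * (-1) ^ pdim (R j))"
      by (subst K(1), rule sum.union_disjoint) (use K(2) in \<open>auto simp: I_def\<close>)
    also have "(\<Sum>j\<in>K \<inter> P. c j * (-1) ^ pdim (R j)) = sum d (K \<inter> P)"
      by (rule sum.cong) (simp_all add: d_def RP)
    also have "(\<Sum>j\<in>K \<inter> I. c j * (-1) ^ pdim (R j)) = (\<Sum>j\<in>K \<inter> I. - d j)"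
      by (rule sum.cong) (simp_all add: d_def RI)
    finally show ?thesis unfolding KP KI by (simp add: sum_negf)
  qed
  from euler_line[OF fin lh(1) this] have "sum d P + sum d I = 0" .
  moreover have "sum d J = sum d P + sum d I" unfolding I_def
    by (subst sum.subset_diff[of P J d]) (use insert.prems(1) in \<open>auto simp: P_def\<close>)
  ultimately show ?case unfolding d_def by simp
qed

section \<open>Interior faces of a matroid subdivision\<close>

text \<open>The relative interior of a polytope as the complement of its proper faces, matching the
  boundary used in \<open>interior_faces\<close>.\<close>

definition ri :: "(nat \<Rightarrow>\<^sub>0 real) set \<Rightarrow> (nat \<Rightarrow>\<^sub>0 real) set" where
  "ri P = P - \<Union>{F. F face_of P \<and> F \<noteq> P}"

text \<open>The points \<open>y\<close> of \<open>P\<close> such that the segment from \<open>y\<close> to \<open>x\<close> can be prolonged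
  beyond \<open>x\<close> inside \<open>P\<close> form the smallest face of \<open>P\<close> containing \<open>x\<close>.\<close>

lemma ri_extend:
  assumes C: "convex P" and x: "x \<in> ri P" and y: "y \<in> P"
  shows "\<exists>t>0. x + t *\<^sub>R (x - y) \<in> P"
proof -
  define F where "F = {y\<in>P. \<exists>t>0. x + t *\<^sub>R (x - y) \<in> P}"
  have xP: "x \<in> P" using x by (simp add: ri_def)
  have dir: "y \<in> F" if "y \<in> P" "t > 0" "x + t *\<^sub>R (x - y) \<in> P" for y t using that unfolding F_def by blast
  have "convex F"
  proof (rule convexI)
    fix y z u v assume y: "y \<in> F" and z: "z \<in> F" and uv: "0 \<le> (u::real)" "0 \<le> v" "u + v = 1"
    obtain s where s: "s > 0" "x + s *\<^sub>R (x - y) \<in> P" using y unfolding F_def by blast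
    obtain t where t: "t > 0" "x + t *\<^sub>R (x - z) \<in> P" using z unfolding F_def by blast
    define r where "r = min s t"
    have r: "r > 0" "r \<le> s" "r \<le> t" using s t unfolding r_def by auto
    have "x + (r / s) *\<^sub>R ((x + s *\<^sub>R (x - y)) - x) \<in> P"
      using r s by (intro convex_convex_comb[OF C xP]) auto
    then have 1: "x + r *\<^sub>R (x - y) \<in> P" using s by simp
    have "x + (r / t) *\<^sub>R ((x + t *\<^sub>R (x - z)) - x) \<in> P"
      using r t by (intro convex_convex_comb[OF C xP]) auto
    then have 2: "x + r *\<^sub>R (x - z) \<in> P" using t by simp
    have v: "u = 1 - v" using uv by simp
    have "(x + r *\<^sub>R (x - y)) + v *\<^sub>R ((x + r *\<^sub>R (x - z)) - (x + r *\<^sub>R (x - y))) \<in> P"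
      using uv by (intro convex_convex_comb[OF C 1 2]) auto
    also have "(x + r *\<^sub>R (x - y)) + v *\<^sub>R ((x + r *\<^sub>R (x - z)) - (x + r *\<^sub>R (x - y)))
       = x + r *\<^sub>R (x - (u *\<^sub>R y + v *\<^sub>R z))" unfolding v by (simp add: algebra_simps)
    finally have "x + r *\<^sub>R (x - (u *\<^sub>R y + v *\<^sub>R z)) \<in> P" .
    moreover have "u *\<^sub>R y + v *\<^sub>R z \<in> P" using y z uv C unfolding F_def convex_def by blast
    ultimately show "u *\<^sub>R y + v *\<^sub>R z \<in> F" using dir r by blast
  qed
  have key: "a \<in> F" if a: "a \<in> P" and b: "b \<in> P" and z: "z \<in> F" "z = (1 - u) *\<^sub>R a + u *\<^sub>R b" and u: "0 < u" "u < 1"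
    for a b z u
  proof -
    obtain t where t: "t > 0" "x + t *\<^sub>R (x - z) \<in> P" using z unfolding F_def by blast
    have pos: "1 + t * u > 0" using t u by (simp add: add_pos_pos)
    \<comment> \<open>The weight solves \<open>w = (1 - w) * t * u\<close>, which removes
      \<open>b\<close> from the combination; what remains is a prolongation of the segment from
      \<open>a\<close> to \<open>x\<close>.\<close>
    define w where "w = t * u / (1 + t * u)"
    have w: "0 \<le> w" "w \<le> 1" using t u pos unfolding w_def by (auto simp: field_simps)
    have "(x + t *\<^sub>R (x - z)) + w *\<^sub>R (b - (x + t *\<^sub>R (x - z))) \<in> P"
      using w by (intro convex_convex_comb[OF C t(2) b]) auto
    moreover have "(x + t *\<^sub>R (x - z)) + w *\<^sub>R (b - (x + t *\<^sub>R (x - z)))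
       = x + (t * (1 - u) / (1 + t * u)) *\<^sub>R (x - a)"
    proof -
      have eq: "1 - w = 1 / (1 + t * u)" using pos unfolding w_def by (simp add: field_simps)
      have "(x + t *\<^sub>R (x - z)) + w *\<^sub>R (b - (x + t *\<^sub>R (x - z)))
         = ((1 - w) * (1 + t)) *\<^sub>R x - ((1 - w) * t * (1 - u)) *\<^sub>R a + (w - (1 - w) * t * u) *\<^sub>R b"
        unfolding z(2) by (simp add: algebra_simps)
      also have "w - (1 - w) * t * u = 0" unfolding eq by (simp add: w_def)
      also have "(1 - w) * (1 + t) = 1 + t * (1 - u) / (1 + t * u)" unfolding eq using pos by (simp add: field_simps)
      also have "(1 - w) * t * (1 - u) = t * (1 - u) / (1 + t * u)" unfolding eq by simp
      finally show ?thesis by (simp add: algebra_simps)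
    qed
    moreover have "t * (1 - u) / (1 + t * u) > 0" using t u pos by (intro divide_pos_pos) auto
    ultimately show ?thesis using dir a by metis
  qed
  have "F face_of P" unfolding face_of_def
  proof (intro conjI ballI impI)
    show "F \<subseteq> P" unfolding F_def by blast
    fix a b z assume ab: "a \<in> P" "b \<in> P" "z \<in> F" "z \<in> open_segment a b"
    then obtain u where u: "0 < u" "u < 1" "z = (1 - u) *\<^sub>R a + u *\<^sub>R b" by (auto simp: in_segment)
    show "a \<in> F" using key[OF ab(1,2,3) u(3,1,2)] .
    show "b \<in> F" by (rule key[OF ab(2,1,3), of "1 - u"]) (use u in auto)
  qed fact
  moreover have "x \<in> F" using xP dir[of x 1] by simp
  ultimately have "F = P" using x unfolding ri_def by blast
  then show ?thesis using y unfolding F_def by blast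
qed

lemma ri_subset: "ri P \<subseteq> P" by (auto simp: ri_def)

text \<open>Prolonging from \<open>y\<close> past \<open>x\<close> puts \<open>x\<close> strictly
  between two points of \<open>P\<close>, so every face containing \<open>x\<close> contains
  \<open>y\<close>.\<close>

lemma ri_I:
  assumes x: "x \<in> P" and ext: "\<And>y. y \<in> P \<Longrightarrow> \<exists>t>0. x + t *\<^sub>R (x - y) \<in> P"
  shows "x \<in> ri P"
proof -
  have "F = P" if F: "F face_of P" "x \<in> F" for F
  proof -
    have "y \<in> F" if y: "y \<in> P" for y
    proof (cases "y = x")
      case False
      obtain t where t: "t > 0" "x + t *\<^sub>R (x - y) \<in> P" using ext y by blast
      have "x = (1 - 1 / (1 + t)) *\<^sub>R y + (1 / (1 + t)) *\<^sub>R (x + t *\<^sub>R (x - y))"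
      proof -
        define a where "a = 1 / (1 + t)"
        have a: "1 - a = t * a" "a + t * a = 1" using t unfolding a_def by (simp_all add: field_simps)
        have "(t * a) *\<^sub>R y + a *\<^sub>R (x + t *\<^sub>R (x - y)) = (a + t * a) *\<^sub>R x" by (simp add: algebra_simps)
        then show ?thesis unfolding a_def[symmetric] a by simp
      qed
      moreover have "y \<noteq> x + t *\<^sub>R (x - y)"
      proof
        assume "y = x + t *\<^sub>R (x - y)"
        then have "(1 + t) *\<^sub>R (x - y) = 0" by (simp add: algebra_simps)
        then show False using t False by simp
      qed
      ultimately have "x \<in> open_segment y (x + t *\<^sub>R (x - y))"
        using t by (auto simp: in_segment intro!: exI[of _ "1 / (1 + t)"])
      then show ?thesis using F y t(2) unfolding face_of_def by blast
    qed (use F in simp)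
    then show ?thesis using F face_of_imp_subset by blast
  qed
  then show ?thesis using x unfolding ri_def by blast
qed

text \<open>A face that meets the open segment contains its end \<open>x\<close>, hence is not
  proper.\<close>

lemma ri_segment:
  assumes C: "convex P" and x: "x \<in> ri P" and y: "y \<in> P" and t: "0 \<le> t" "t < 1"
  shows "x + t *\<^sub>R (y - x) \<in> ri P"
proof (cases "t = 0 \<or> x = y")
  case False
  have xP: "x \<in> P" using x ri_subset by blast
  have "x + t *\<^sub>R (y - x) \<in> P" using t by (intro convex_convex_comb[OF C xP y]) auto
  moreover have "x + t *\<^sub>R (y - x) \<in> open_segment x y"
    using False t by (auto simp: in_segment algebra_simps intro!: exI[of _ t])
  ultimately show ?thesis using x xP y unfolding ri_def face_of_def by blast
qed (use x in auto)

lemma convex_ri: assumes C: "convex P" shows "convex (ri P)"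
proof (rule convexI)
  fix x y u v assume xy: "x \<in> ri P" "y \<in> ri P" and uv: "0 \<le> (u::real)" "0 \<le> v" "u + v = 1"
  have u: "u = 1 - v" using uv by simp
  show "u *\<^sub>R x + v *\<^sub>R y \<in> ri P"
  proof (cases "v = 1")
    case False
    then have "x + v *\<^sub>R (y - x) \<in> ri P" using uv xy ri_subset by (intro ri_segment[OF C]) auto
    then show ?thesis unfolding u by (simp add: algebra_simps)
  qed (use xy u in simp)
qed

lemma relopen_ri: assumes C: "convex P" shows "relopen (ri P)"
  unfolding relopen_def
proof (intro ballI)
  fix x y assume x: "x \<in> ri P" and y: "y \<in> ri P"
  then obtain t where t: "t > 0" "x + t *\<^sub>R (x - y) \<in> P" using ri_extend[OF C x] ri_subset by blast
  have "x + (1/2) *\<^sub>R ((x + t *\<^sub>R (x - y)) - x) \<in> ri P" using t by (intro ri_segment[OF C x]) auto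
  then show "\<exists>t>0. x + t *\<^sub>R (x - y) \<in> ri P" using t by (intro exI[of _ "t / 2"]) simp
qed

text \<open>The barycentre of \<open>V\<close> works, because its weights \<open>1/n\<close> leave
  room to move away from any other point.\<close>

lemma ri_nonempty:
  assumes "finite V" "V \<noteq> {}" shows "ri (convex hull V) \<noteq> {}"
proof -
  define n where "n = real (card V)"
  have n: "n > 0" using assms unfolding n_def by (simp add: card_gt_0_iff)
  define x where "x = (\<Sum>v\<in>V. (1/n) *\<^sub>R v)"
  have sum1: "(\<Sum>v\<in>V. 1/n) = 1" using n unfolding n_def by simp
  have "x \<in> ri (convex hull V)"
  proof (rule ri_I)
    show "x \<in> convex hull V" unfolding x_def convex_hull_finite[OF assms(1)]
      using n sum1 by (auto intro!: exI[of _ "\<lambda>_. 1/n"])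
    fix y assume "y \<in> convex hull V"
    then obtain u where u: "\<forall>v\<in>V. 0 \<le> u v" "sum u V = 1" "y = (\<Sum>v\<in>V. u v *\<^sub>R v)"
      unfolding convex_hull_finite[OF assms(1)] by auto
    \<comment> \<open>These are the weights after moving away from \<open>y\<close> by the factor
      \<open>1/n\<close>. They stay nonnegative because no coefficient of \<open>y\<close> exceeds
      one.\<close>
    define w where "w v = 1/n + (1/n) * (1/n - u v)" for v
    have "u v \<le> 1" if "v \<in> V" for v
    proof -
      have "u v \<le> sum u V" using u(1) that assms(1) by (intro member_le_sum) auto
      then show ?thesis using u(2) by simp
    qed
    then have "0 \<le> w v" if "v \<in> V" for v
    proof -
      have "0 < 1/n" using n by simp
      then have "0 \<le> 1/n" "0 \<le> 1 + (1/n - u v)"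
        using \<open>\<And>v. v \<in> V \<Longrightarrow> u v \<le> 1\<close>[OF that] by linarith+
      then have "0 \<le> (1/n) * (1 + (1/n - u v))" by (rule mult_nonneg_nonneg)
      then show ?thesis unfolding w_def by (simp add: algebra_simps)
    qed
    moreover have "sum w V = 1" unfolding w_def
      using sum1 u(2) by (simp only: sum.distrib sum_distrib_left[symmetric] sum_subtractf) simp
    moreover have "x + (1/n) *\<^sub>R (x - y) = (\<Sum>v\<in>V. w v *\<^sub>R v)"
      unfolding x_def u(3) w_def
      by (simp add: scaleR_sum_right sum.distrib[symmetric] sum_subtractf[symmetric] algebra_simps)
    ultimately have "x + (1/n) *\<^sub>R (x - y) \<in> convex hull V"
      unfolding convex_hull_finite[OF assms(1)] by auto
    then show "\<exists>t>0. x + t *\<^sub>R (x - y) \<in> convex hull V" using n by (intro exI[of _ "1/n"]) auto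
  qed
  then show ?thesis by blast
qed

text \<open>Take the intersection of all faces through \<open>x\<close>: a face of it through
  \<open>x\<close> is again a face of \<open>P\<close>, hence equal to it.\<close>

lemma minimal_face:
  assumes "convex P" "x \<in> P" obtains F where "F face_of P" "x \<in> ri F"
proof -
  define F where "F = \<Inter>{G. G face_of P \<and> x \<in> G}"
  have P: "P \<in> {G. G face_of P \<and> x \<in> G}" using assms by (simp add: face_of_refl)
  have F: "F face_of P" unfolding F_def by (rule face_of_Inter) (use P in auto)
  have "G = F" if "G face_of F" "x \<in> G" for G
  proof -
    have "G face_of P" using face_of_trans[OF that(1) F] .
    then have "F \<subseteq> G" using that unfolding F_def by blast
    then show ?thesis using that face_of_imp_subset by blast
  qed
  moreover have "x \<in> F" unfolding F_def using assms by blast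
  ultimately have "x \<in> ri F" unfolding ri_def by blast
  then show ?thesis using that F by blast
qed

text \<open>Every direction from \<open>p\<close> into \<open>P\<close> is a multiple of one
  realized inside \<open>Q\<close>. This shows that cutting with an open set leaves the dimension
  alone.\<close>

lemma pdim_dense:
  assumes "Q \<subseteq> P" "p \<in> Q" "\<And>y. y \<in> P \<Longrightarrow> \<exists>t>0. p + t *\<^sub>R (y - p) \<in> Q"
  shows "pdim Q = pdim P"
proof -
  have 1: "y - p \<in> span (diffs Q)" if "y \<in> P" for y
  proof -
    obtain t where t: "t > 0" "p + t *\<^sub>R (y - p) \<in> Q" using assms(3)[OF \<open>y \<in> P\<close>] by blast
    have "(p + t *\<^sub>R (y - p)) - p \<in> span (diffs Q)" using t assms(2) by (intro span_base) blast
    then have "(1/t) *\<^sub>R ((p + t *\<^sub>R (y - p)) - p) \<in> span (diffs Q)" by (rule span_scale)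
    then show ?thesis using t by simp
  qed
  have "d \<in> span (diffs Q)" if "d \<in> diffs P" for d
  proof -
    obtain x y where d: "d = x - y" "x \<in> P" "y \<in> P" using \<open>d \<in> diffs P\<close> by blast
    then show ?thesis using span_diff[OF 1[OF d(2)] 1[OF d(3)]] by simp
  qed
  then have "span (diffs P) \<subseteq> span (diffs Q)" by (intro real_vector.span_minimal) auto
  moreover have "span (diffs Q) \<subseteq> span (diffs P)" using assms(1) by (intro real_vector.span_mono) blast
  ultimately show ?thesis unfolding pdim_def by (intro real_vector.span_eq_dim) blast
qed

text \<open>Openness in the whole space, again along lines only: \<open>d\<close> ranges over all
  directions, in contrast to \<open>relopen\<close>.\<close>

definition opencvx :: "(nat \<Rightarrow>\<^sub>0 real) set \<Rightarrow> bool" where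
  "opencvx C \<longleftrightarrow> convex C \<and> (\<forall>p\<in>C. \<forall>d. \<exists>t>0. p + t *\<^sub>R d \<in> C)"

lemma opencvx_small:
  assumes "opencvx C" "p \<in> C" "r > 0" obtains t where "t > 0" "t \<le> r" "p + t *\<^sub>R d \<in> C"
proof -
  obtain t where t: "t > 0" "p + t *\<^sub>R d \<in> C" using assms unfolding opencvx_def by blast
  have C: "convex C" using assms unfolding opencvx_def by blast
  have "p + (min t r / t) *\<^sub>R ((p + t *\<^sub>R d) - p) \<in> C"
    using t assms by (intro convex_convex_comb[OF C]) auto
  then have "p + min t r *\<^sub>R d \<in> C" using t by simp
  then show ?thesis using that[of "min t r"] t assms by simp
qed

text \<open>From a common point of \<open>P\<close> and \<open>C\<close>, a short move towards a
  relative interior point stays in \<open>C\<close> and enters \<open>ri P\<close>. Short moves from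
  there realize every direction of \<open>P\<close>, hence the equality of dimensions.\<close>

lemma ri_Int_opencvx:
  assumes P: "P = convex hull V" "finite V" and C: "opencvx C" and ne: "P \<inter> C \<noteq> {}"
  shows "ri P \<inter> C \<noteq> {}" "convex (ri P \<inter> C)" "relopen (ri P \<inter> C)" "pdim (ri P \<inter> C) = pdim P"
proof -
  have cP: "convex P" using P by simp
  have cC: "convex C" using C opencvx_def by blast
  obtain y where y: "y \<in> P" "y \<in> C" using ne by blast
  then have "V \<noteq> {}" using P by auto
  then obtain x where x: "x \<in> ri P" using ri_nonempty P by blast
  have xP: "x \<in> P" using x ri_subset by blast
  obtain t where t: "t > 0" "t \<le> 1" "y + t *\<^sub>R (x - y) \<in> C" using opencvx_small[OF C y(2), of 1] by auto
  have "x + (1 - t) *\<^sub>R (y - x) \<in> ri P" using t by (intro ri_segment[OF cP x y(1)]) auto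
  then have p: "y + t *\<^sub>R (x - y) \<in> ri P \<inter> C" using t by (simp add: algebra_simps)
  then show "ri P \<inter> C \<noteq> {}" by blast
  show "convex (ri P \<inter> C)" using convex_ri[OF cP] cC by (rule convex_Int)
  show "relopen (ri P \<inter> C)" unfolding relopen_def
  proof (intro ballI)
    fix u v assume uv: "u \<in> ri P \<inter> C" "v \<in> ri P \<inter> C"
    then obtain r where r: "r > 0" "u + r *\<^sub>R (u - v) \<in> ri P" using relopen_ri[OF cP] unfolding relopen_def by blast
    obtain s where s: "s > 0" "s \<le> r" "u + s *\<^sub>R (u - v) \<in> C" using opencvx_small[OF C, of u r "u - v"] uv r by auto
    have "u + (s / r) *\<^sub>R ((u + r *\<^sub>R (u - v)) - u) \<in> ri P"
      using uv r s by (intro convex_convex_comb[OF convex_ri[OF cP]]) auto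
    then have "u + s *\<^sub>R (u - v) \<in> ri P" using r by simp
    then show "\<exists>t>0. u + t *\<^sub>R (u - v) \<in> ri P \<inter> C" using s by blast
  qed
  show "pdim (ri P \<inter> C) = pdim P"
  proof (rule pdim_dense)
    show "ri P \<inter> C \<subseteq> P" using ri_subset by blast
    show "y + t *\<^sub>R (x - y) \<in> ri P \<inter> C" by fact
    fix w assume w: "w \<in> P"
    have q: "y + t *\<^sub>R (x - y) \<in> ri P" using p by blast
    obtain s where s: "s > 0" "s \<le> 1/2" "(y + t *\<^sub>R (x - y)) + s *\<^sub>R (w - (y + t *\<^sub>R (x - y))) \<in> C"
      using opencvx_small[OF C, of "y + t *\<^sub>R (x - y)" "1/2" "w - (y + t *\<^sub>R (x - y))"] p by auto
    moreover have "(y + t *\<^sub>R (x - y)) + s *\<^sub>R (w - (y + t *\<^sub>R (x - y))) \<in> ri P"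
      by (rule ri_segment[OF cP q w]) (use s in auto)
    ultimately show "\<exists>s>0. (y + t *\<^sub>R (x - y)) + s *\<^sub>R (w - (y + t *\<^sub>R (x - y))) \<in> ri P \<inter> C" by blast
  qed
qed

section \<open>Base polytopes and the cells of a subdivision\<close>

lemma lookup_ind_vec:
  assumes "finite B" shows "Poly_Mapping.lookup (ind_vec B) i = (if i \<in> B then 1 else 0)"
proof -
  have "(\<Sum>j\<in>B. (1::real) when j = i) = (\<Sum>j\<in>B. if j = i then 1 else 0)" by (rule sum.cong) auto
  then show ?thesis unfolding ind_vec_def using assms by (simp add: lookup_sum lookup_single)
qed

lemma base_polytope_bounds:
  assumes M: "matroid E Bs" and x: "x \<in> base_polytope Bs"
  shows "0 \<le> Poly_Mapping.lookup x i" "Poly_Mapping.lookup x i \<le> 1" "i \<notin> E \<Longrightarrow> Poly_Mapping.lookup x i = 0"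
proof -
  let ?U = "{x :: nat \<Rightarrow>\<^sub>0 real. \<forall>i. 0 \<le> Poly_Mapping.lookup x i \<and> Poly_Mapping.lookup x i \<le> 1
    \<and> (i \<notin> E \<longrightarrow> Poly_Mapping.lookup x i = 0)}"
  have "base_polytope Bs \<subseteq> ?U" unfolding base_polytope_def
  proof (rule hull_minimal)
    show "ind_vec ` Bs \<subseteq> ?U" using matroidD(4,5)[OF M] by (fastforce simp: lookup_ind_vec)
    show "convex ?U"
    proof (rule convexI, safe)
      fix x y :: "nat \<Rightarrow>\<^sub>0 real" and u v :: real and i
      assume a: "\<forall>i. 0 \<le> Poly_Mapping.lookup x i \<and> Poly_Mapping.lookup x i \<le> 1 \<and> (i \<notin> E \<longrightarrow> Poly_Mapping.lookup x i = 0)"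
        "\<forall>i. 0 \<le> Poly_Mapping.lookup y i \<and> Poly_Mapping.lookup y i \<le> 1 \<and> (i \<notin> E \<longrightarrow> Poly_Mapping.lookup y i = 0)"
        "0 \<le> u" "0 \<le> v" "u + v = 1"
      show "0 \<le> Poly_Mapping.lookup (u *\<^sub>R x + v *\<^sub>R y) i" using a by (simp add: lookup_add)
      have "u * Poly_Mapping.lookup x i + v * Poly_Mapping.lookup y i \<le> u * 1 + v * 1"
        using a by (intro add_mono mult_left_mono) auto
      then show "Poly_Mapping.lookup (u *\<^sub>R x + v *\<^sub>R y) i \<le> 1" using a by (simp add: lookup_add)
      show "Poly_Mapping.lookup (u *\<^sub>R x + v *\<^sub>R y) i = 0" if "i \<notin> E" using a that by (simp add: lookup_add)
    qed
  qed
  then show "0 \<le> Poly_Mapping.lookup x i" "Poly_Mapping.lookup x i \<le> 1" "i \<notin> E \<Longrightarrow> Poly_Mapping.lookup x i = 0"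
    using x by auto
qed

text \<open>The finite support \<open>X\<close> gives the direction space a finite basis. The
  inequality ensures that the difference of dimensions in the signs, taken in the natural numbers,
  is a true difference.\<close>

lemma pdim_mono:
  assumes "P \<subseteq> Q" "finite X" "\<And>x i. x \<in> Q \<Longrightarrow> i \<notin> X \<Longrightarrow> Poly_Mapping.lookup x i = 0"
  shows "pdim P \<le> pdim Q"
proof -
  obtain B where B: "B \<subseteq> diffs Q" "independent B" "diffs Q \<subseteq> span B" "card B = dim (diffs Q)"
    using real_vector.basis_exists by blast
  have "diffs Q \<subseteq> span ((\<lambda>i. Poly_Mapping.single i (1::real)) ` X)"
    using assms(3) by (auto intro!: span_support[OF assms(2)] simp: lookup_minus)
  then have "B \<subseteq> span ((\<lambda>i. Poly_Mapping.single i (1::real)) ` X)" using B(1) by (rule order_trans[rotated])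
  then have "finite B" using real_vector.independent_span_bound[OF finite_imageI[OF assms(2)] B(2)] by simp
  moreover have "diffs P \<subseteq> span B" using B(3) assms(1) by blast
  ultimately have "dim (diffs P) \<le> card B" by (intro real_vector.dim_le_card)
  then show ?thesis unfolding pdim_def B(4) .
qed

lemma subdivisionD:
  assumes "matroid_subdivision E Bs S"
  shows "finite S" "Q \<in> S \<Longrightarrow> Q \<noteq> {}" "Q \<in> S \<Longrightarrow> \<exists>Bs'. matroid E Bs' \<and> Q = base_polytope Bs'"
    "Q \<in> S \<Longrightarrow> F face_of Q \<Longrightarrow> F \<noteq> {} \<Longrightarrow> F \<in> S"
    "Q \<in> S \<Longrightarrow> R \<in> S \<Longrightarrow> Q \<inter> R face_of Q \<and> Q \<inter> R face_of R" "\<Union>S = base_polytope Bs"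
  using assms unfolding matroid_subdivision_def by blast+

text \<open>A face of the base polytope cuts \<open>Q\<close> in a face of \<open>Q\<close>. If it
  contains a relative interior point of \<open>Q\<close>, it contains all of \<open>Q\<close>, which
  an interior face forbids for proper faces.\<close>

lemma interior_face_ri_subset:
  assumes S: "matroid_subdivision E Bs S" and Q: "Q \<in> interior_faces Bs S"
  shows "ri Q \<subseteq> ri (base_polytope Bs)"
proof
  let ?P = "base_polytope Bs"
  fix x assume x: "x \<in> ri Q"
  have QS: "Q \<in> S" "\<not> Q \<subseteq> \<Union>{F. F face_of ?P \<and> F \<noteq> ?P}" using Q unfolding interior_faces_def by auto
  have QP: "Q \<subseteq> ?P" using subdivisionD(6)[OF S] QS(1) by blast
  obtain Bs' where "Q = base_polytope Bs'" using subdivisionD(3)[OF S QS(1)] by blast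
  then have cQ: "convex Q" by (simp add: base_polytope_def)
  have "F = ?P" if F: "F face_of ?P" "x \<in> F" for F
  proof (rule ccontr)
    assume "F \<noteq> ?P"
    have "F \<inter> Q face_of Q"
      unfolding face_of_def
    proof (intro conjI ballI impI)
      show "convex (F \<inter> Q)" using F(1) cQ unfolding face_of_def by (intro convex_Int) auto
      fix a b z assume "a \<in> Q" "b \<in> Q" "z \<in> F \<inter> Q" "z \<in> open_segment a b"
      then show "a \<in> F \<inter> Q" "b \<in> F \<inter> Q" using face_ofD[OF F(1)] QP by blast+
    qed blast
    then have "F \<inter> Q = Q" using x F(2) unfolding ri_def by blast
    then show False using QS(2) F(1) \<open>F \<noteq> ?P\<close> by blast
  qed
  then show "x \<in> ri ?P" using x QP ri_subset unfolding ri_def by blast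
qed

text \<open>Existence: take the minimal face through \<open>x\<close> of a cell containing
  \<open>x\<close>. Uniqueness: the intersection of two members is a face of both and contains a
  relative interior point of each.\<close>

lemma ri_partition:
  assumes S: "matroid_subdivision E Bs S" and x: "x \<in> ri (base_polytope Bs)"
  shows "\<exists>!Q. Q \<in> interior_faces Bs S \<and> x \<in> ri Q"
proof -
  have "x \<in> \<Union>S" using x ri_subset subdivisionD(6)[OF S] by blast
  then obtain R where R: "R \<in> S" "x \<in> R" by blast
  obtain Bs' where "R = base_polytope Bs'" using subdivisionD(3)[OF S R(1)] by blast
  then have "convex R" by (simp add: base_polytope_def)
  then obtain Q where Q: "Q face_of R" "x \<in> ri Q" using minimal_face R(2) by blast
  have xQ: "x \<in> Q" using Q(2) ri_subset by blast
  then have "Q \<in> S" using subdivisionD(4)[OF S R(1) Q(1)] by blast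
  then have "Q \<in> interior_faces Bs S" using x xQ unfolding interior_faces_def ri_def by blast
  moreover have "Q1 = Q2" if "Q1 \<in> S" "Q2 \<in> S" "x \<in> ri Q1" "x \<in> ri Q2" for Q1 Q2
  proof -
    have "x \<in> Q1 \<inter> Q2" using that ri_subset by blast
    then have "Q1 \<inter> Q2 = Q1" "Q1 \<inter> Q2 = Q2" using that subdivisionD(5)[OF S that(1,2)] unfolding ri_def by blast+
    then show ?thesis by simp
  qed
  ultimately show ?thesis using Q(2) unfolding interior_faces_def by blast
qed

text \<open>The sets \<open>ri Q \<inter> C\<close> with weight one and
  \<open>ri P \<inter> C\<close> with weight minus one, \<open>P\<close> being the base polytope,
  cancel at every point, so \<open>euler_relation\<close> applies; each set has the dimension of its
  polytope. The index \<open>None\<close> stands for \<open>P\<close>.\<close>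

lemma interior_faces_euler:
  assumes M: "matroid E Bs" and S: "matroid_subdivision E Bs S" and C: "opencvx C"
  shows "(\<Sum>Q\<in>interior_faces Bs S. sign_pow (pdim (base_polytope Bs) - pdim Q)
      (of_bool (Q \<inter> C \<noteq> {}) :: int)) = of_bool (base_polytope Bs \<inter> C \<noteq> {})"
proof -
  define P where "P = base_polytope Bs"
  define T where "T = {Q\<in>interior_faces Bs S. Q \<inter> C \<noteq> {}}"
  have finS: "finite (interior_faces Bs S)" using subdivisionD(1)[OF S] unfolding interior_faces_def by simp
  have QP: "Q \<subseteq> P" if "Q \<in> interior_faces Bs S" for Q
    using that subdivisionD(6)[OF S] unfolding interior_faces_def P_def by blast
  have dimle: "pdim Q \<le> pdim P" if "Q \<in> interior_faces Bs S" for Q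
    using QP[OF that] matroidD(1)[OF M] base_polytope_bounds(3)[OF M] unfolding P_def by (rule pdim_mono)
  have sgn: "sign_pow (pdim P - pdim Q) (of_bool b :: int) = (-1) ^ pdim P * (if b then (-1) ^ pdim Q else 0)"
    if "pdim Q \<le> pdim P" for Q b
  proof -
    have "even (pdim P - pdim Q) \<longleftrightarrow> (even (pdim P) \<longleftrightarrow> even (pdim Q))" using that by (simp add: even_diff_nat)
    then show ?thesis by (auto simp: sign_pow_def minus_one_power_iff)
  qed
  have "(\<Sum>Q\<in>interior_faces Bs S. sign_pow (pdim P - pdim Q) (of_bool (Q \<inter> C \<noteq> {}) :: int))
     = (\<Sum>Q\<in>interior_faces Bs S. (-1) ^ pdim P * (if Q \<inter> C \<noteq> {} then (-1) ^ pdim Q else 0))"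
    by (rule sum.cong) (simp_all add: sgn dimle)
  also have "\<dots> = (-1) ^ pdim P * (\<Sum>Q\<in>T. (-1) ^ pdim Q)"
    unfolding T_def sum_distrib_left[symmetric] using finS by (simp add: sum.inter_filter)
  also have "\<dots> = of_bool (P \<inter> C \<noteq> {})"
  proof (cases "P \<inter> C = {}")
    case True
    then have "T = {}" using QP unfolding T_def by blast
    then show ?thesis using True by simp
  next
    case False
    define R where "R j = (case j of None \<Rightarrow> ri P \<inter> C | Some Q \<Rightarrow> ri Q \<inter> C)" for j
    define c :: "(nat \<Rightarrow>\<^sub>0 real) set option \<Rightarrow> int" where "c j = (if j = None then -1 else 1)" for j
    have hull: "\<exists>V. finite V \<and> Q = convex hull V" if "Q \<in> T" for Q
    proof -
      obtain Bs' where "matroid E Bs'" "Q = base_polytope Bs'"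
        using \<open>Q \<in> T\<close> subdivisionD(3)[OF S] unfolding T_def interior_faces_def by blast
      then show ?thesis unfolding base_polytope_def using matroidD(3) by blast
    qed
    have hullP: "P = convex hull (ind_vec ` Bs)" "finite (ind_vec ` Bs)"
      unfolding P_def base_polytope_def using matroidD(3)[OF M] by auto
    have RP: "R j \<subseteq> P" if j: "j \<in> insert None (Some ` T)" for j
    proof (cases j)
      case None
      then show ?thesis using ri_subset unfolding R_def by auto
    next
      case (Some Q)
      then have "ri Q \<inter> C \<subseteq> P" using j ri_subset[of Q] QP[of Q] unfolding T_def by blast
      then show ?thesis using Some unfolding R_def by simp
    qed
    have finT: "finite T" using finS unfolding T_def by simp
    have "(\<Sum>j\<in>insert None (Some ` T). c j * (-1) ^ pdim (R j)) = 0"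
    proof (rule euler_relation[where X = E and M = 1 and z = "\<lambda>_. 0"])
      show "finite E" using matroidD(1)[OF M] .
      show "finite (insert None (Some ` T))" using finT by simp
      show "R j \<noteq> {} \<and> convex (R j) \<and> relopen (R j)" if "j \<in> insert None (Some ` T)" for j
      proof (cases j)
        case None
        then show ?thesis unfolding R_def using ri_Int_opencvx[OF hullP C False] by simp
      next
        case (Some Q)
        then have Q: "Q \<in> T" using that by auto
        then obtain V where V: "finite V" "Q = convex hull V" using hull by blast
        have "Q \<inter> C \<noteq> {}" using Q unfolding T_def by blast
        from ri_Int_opencvx[OF V(2,1) C this] show ?thesis using Some unfolding R_def by simp
      qed
      show "\<bar>Poly_Mapping.lookup x i\<bar> \<le> 1" if "j \<in> insert None (Some ` T)" "x \<in> R j" for j x i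
        using base_polytope_bounds(1,2)[OF M, of x i] RP[OF that(1)] that(2) unfolding P_def by auto
      show "Poly_Mapping.lookup x i = 0" if "j \<in> insert None (Some ` T)" "x \<in> R j" "i \<notin> E" for j x i
        using base_polytope_bounds(3)[OF M] RP[OF that(1)] that(2,3) unfolding P_def by auto
      show "(\<Sum>j\<in>{j\<in>insert None (Some ` T). x \<in> R j}. c j) = 0" for x
      proof (cases "x \<in> ri P \<inter> C")
        case True
        then have "x \<in> ri (base_polytope Bs)" unfolding P_def by blast
        from ri_partition[OF S this] obtain Q where Q: "Q \<in> interior_faces Bs S" "x \<in> ri Q"
          and uniq: "\<And>Q'. Q' \<in> interior_faces Bs S \<and> x \<in> ri Q' \<Longrightarrow> Q' = Q"
          by (metis (no_types, lifting))
        have QT: "Q \<in> T" using Q True ri_subset unfolding T_def by blast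
        have "x \<in> R (Some Q') \<longleftrightarrow> Q' = Q" if "Q' \<in> T" for Q'
          using uniq[of Q'] that Q True unfolding R_def T_def by auto
        moreover have "x \<in> R None" using True unfolding R_def by simp
        ultimately have "{j\<in>insert None (Some ` T). x \<in> R j} = {None, Some Q}" using QT by blast
        then show ?thesis unfolding c_def by simp
      next
        case nP: False
        have "x \<notin> ri Q \<inter> C" if "Q \<in> T" for Q
          using nP interior_face_ri_subset[OF S] that unfolding T_def P_def by blast
        then have "x \<notin> R j" if "j \<in> insert None (Some ` T)" for j
          using nP that unfolding R_def by (auto split: option.splits)
        then have "{j\<in>insert None (Some ` T). x \<in> R j} = {}" by blast
        then show ?thesis by (metis sum.empty)
      qed
    qed
    also have "(\<Sum>j\<in>insert None (Some ` T). c j * (-1) ^ pdim (R j)) =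
        - ((-1) ^ pdim P) + (\<Sum>Q\<in>T. (-1) ^ pdim Q)"
    proof -
      have "pdim (ri Q \<inter> C) = pdim Q" if "Q \<in> T" for Q
      proof -
        obtain V where V: "finite V" "Q = convex hull V" using hull \<open>Q \<in> T\<close> by blast
        have "Q \<inter> C \<noteq> {}" using \<open>Q \<in> T\<close> unfolding T_def by blast
        from ri_Int_opencvx(4)[OF V(2,1) C this] show ?thesis .
      qed
      moreover have "pdim (ri P \<inter> C) = pdim P" using ri_Int_opencvx(4)[OF hullP C False] .
      ultimately show ?thesis using finT
        by (simp add: c_def R_def sum.reindex image_iff)
    qed
    finally have "(\<Sum>Q\<in>T. (-1) ^ pdim Q) = ((-1) ^ pdim P :: int)" by simp
    then show ?thesis using False by (simp add: power_add[symmetric])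
  qed
  finally show ?thesis unfolding P_def .
qed

section \<open>Valuative functions of chains of flats\<close>

text \<open>The functional \<open>x(B) - x(E - B)\<close> is smaller by at least one at every other
  basis than at \<open>ind_vec B\<close>. A convex combination of bases different from
  \<open>B\<close> therefore cannot reach its value there.\<close>

lemma ind_vec_in_base_polytope:
  assumes M: "matroid E Bs" and B: "B \<subseteq> E" and x: "ind_vec B \<in> base_polytope Bs"
  shows "B \<in> Bs"
proof (rule ccontr)
  assume nB: "B \<notin> Bs"
  have finE: "finite E" and finB: "finite B" using matroidD(1)[OF M] B finite_subset by auto
  let ?f = "\<lambda>x. (\<Sum>i\<in>B. Poly_Mapping.lookup x i) - (\<Sum>i\<in>E - B. Poly_Mapping.lookup x i) :: real"
  let ?U = "{x. ?f x \<le> real (card B) - 1}"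
  have lin: "?f (u *\<^sub>R x + v *\<^sub>R y) = u * ?f x + v * ?f y" for u v x y
    by (simp add: lookup_add sum.distrib sum_distrib_left algebra_simps)
  have "base_polytope Bs \<subseteq> ?U" unfolding base_polytope_def
  proof (rule hull_minimal)
    show "convex ?U"
    proof (rule convexI)
      fix x y :: "nat \<Rightarrow>\<^sub>0 real" and u v :: real
      assume a: "x \<in> ?U" "y \<in> ?U" "0 \<le> u" "0 \<le> v" "u + v = 1"
      have "u * ?f x + v * ?f y \<le> u * (real (card B) - 1) + v * (real (card B) - 1)"
        using a by (intro add_mono mult_left_mono) auto
      also have "\<dots> = (u + v) * (real (card B) - 1)" by (simp add: algebra_simps)
      finally show "u *\<^sub>R x + v *\<^sub>R y \<in> ?U" using a(5) lin by simp
    qed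
    show "ind_vec ` Bs \<subseteq> ?U"
    proof
      fix y assume "y \<in> ind_vec ` Bs"
      then obtain C where C: "C \<in> Bs" "y = ind_vec C" by blast
      have CE: "C \<subseteq> E" "finite C" using matroidD(4,5)[OF M C(1)] by auto
      have "(\<Sum>i\<in>B. Poly_Mapping.lookup y i) = real (card (B \<inter> C))"
        using finB CE unfolding C(2) by (simp add: lookup_ind_vec sum.If_cases Int_def)
      moreover have "(\<Sum>i\<in>E - B. Poly_Mapping.lookup y i) = real (card (C - B))"
      proof -
        have "(E - B) \<inter> {i. i \<in> C} = C - B" using CE by blast
        then show ?thesis using finE CE unfolding C(2) by (simp add: lookup_ind_vec sum.If_cases)
      qed
      moreover have "card (B \<inter> C) + 1 \<le> card B + card (C - B)"
      proof (cases "B \<subseteq> C")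
        case True
        then have "C - B \<noteq> {}" using nB C(1) by auto
        then have "card (C - B) > 0" using CE by (simp add: card_gt_0_iff)
        moreover have "card (B \<inter> C) \<le> card B" using finB by (intro card_mono) auto
        ultimately show ?thesis by simp
      next
        case False
        then have "card (B \<inter> C) < card B" using finB by (intro psubset_card_mono) auto
        then show ?thesis by simp
      qed
      ultimately show "y \<in> ?U" by simp
    qed
  qed
  then have "?f (ind_vec B) \<le> real (card B) - 1" using x by blast
  moreover have "(\<Sum>i\<in>E - B. Poly_Mapping.lookup (ind_vec B) i) = 0"
    using finB by (intro sum.neutral) (simp add: lookup_ind_vec)
  ultimately show False using finB by (simp add: lookup_ind_vec)
qed

lemma bases_of_base_polytope:
  assumes M: "matroid E Bs" shows "bases_of E (base_polytope Bs) = Bs"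
proof -
  have "ind_vec B \<in> base_polytope Bs" if "B \<in> Bs" for B
    unfolding base_polytope_def using that by (intro hull_inc) blast
  then show ?thesis unfolding bases_of_def using ind_vec_in_base_polytope[OF M] matroidD(4)[OF M] by blast
qed

lemma bases_of_subdivision:
  assumes S: "matroid_subdivision E Bs S" and Q: "Q \<in> S"
  shows "matroid E (bases_of E Q)" "base_polytope (bases_of E Q) = Q"
proof -
  obtain Bs' where "matroid E Bs'" "Q = base_polytope Bs'" using subdivisionD(3)[OF S Q] by blast
  then show "matroid E (bases_of E Q)" "base_polytope (bases_of E Q) = Q"
    using bases_of_base_polytope by auto
qed

text \<open>Valuativity of one integer-valued function for one fixed subdivision. In this form it
  passes to linear combinations while the ground set stays fixed.\<close>

definition balanced ::
  "nat set \<Rightarrow> nat set set \<Rightarrow> (nat \<Rightarrow>\<^sub>0 real) set set \<Rightarrow> (nat set set \<Rightarrow> int) \<Rightarrow> bool" where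
  "balanced E Bs S f \<longleftrightarrow> f Bs = (\<Sum>P\<in>interior_faces Bs S.
     sign_pow (pdim (base_polytope Bs) - pdim P) (f (bases_of E P)))"

lemma sign_pow_eq: "sign_pow k (v::int) = (-1) ^ k * v"
  by (simp add: sign_pow_def minus_one_power_iff)

lemma balanced_sum:
  assumes "\<And>i. i \<in> I \<Longrightarrow> balanced E Bs S (f i)"
  shows "balanced E Bs S (\<lambda>X. \<Sum>i\<in>I. f i X)"
proof -
  have "(\<Sum>i\<in>I. f i Bs) = (\<Sum>i\<in>I. \<Sum>P\<in>interior_faces Bs S.
     sign_pow (pdim (base_polytope Bs) - pdim P) (f i (bases_of E P)))"
    using assms unfolding balanced_def by (intro sum.cong) auto
  also have "\<dots> = (\<Sum>P\<in>interior_faces Bs S. \<Sum>i\<in>I.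
     sign_pow (pdim (base_polytope Bs) - pdim P) (f i (bases_of E P)))" by (rule sum.swap)
  finally show ?thesis unfolding balanced_def by (simp add: sign_pow_eq sum_distrib_left)
qed

lemma balanced_scale:
  assumes "balanced E Bs S f" shows "balanced E Bs S (\<lambda>X. c * f X)"
  using assms unfolding balanced_def by (simp add: sign_pow_eq sum_distrib_left mult_ac)

lemma balanced_diff:
  assumes "balanced E Bs S f" "balanced E Bs S g" shows "balanced E Bs S (\<lambda>X. f X - g X)"
  using assms unfolding balanced_def by (simp add: sign_pow_eq right_diff_distrib sum_subtractf)

lemma bases_of_cell_subset:
  assumes M: "matroid E Bs" and S: "matroid_subdivision E Bs S" and P: "P \<in> S"
  shows "bases_of E P \<subseteq> Bs"
proof
  fix B assume "B \<in> bases_of E P"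
  then have "B \<subseteq> E" "ind_vec B \<in> base_polytope Bs"
    using P subdivisionD(6)[OF S] unfolding bases_of_def by auto
  then show "B \<in> Bs" by (rule ind_vec_in_base_polytope[OF M])
qed

text \<open>If \<open>e\<close> is a loop of an interior face, that face lies in the face of the
  base polytope where coordinate \<open>e\<close> vanishes. The latter cannot be proper, so
  \<open>e\<close> is a loop of the whole matroid.\<close>

lemma loops_interior_face:
  assumes M: "matroid E Bs" and S: "matroid_subdivision E Bs S" and P: "P \<in> interior_faces Bs S"
  shows "loops E (bases_of E P) = loops E Bs"
proof
  have PS: "P \<in> S" "\<not> P \<subseteq> \<Union>{F. F face_of base_polytope Bs \<and> F \<noteq> base_polytope Bs}"
    using P unfolding interior_faces_def by auto
  show "loops E Bs \<subseteq> loops E (bases_of E P)"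
    using bases_of_cell_subset[OF M S PS(1)] unfolding loops_def by blast
  show "loops E (bases_of E P) \<subseteq> loops E Bs"
  proof
    fix e assume e: "e \<in> loops E (bases_of E P)"
    let ?l = "\<lambda>x. Poly_Mapping.lookup x e"
    define F where "F = {x\<in>base_polytope Bs. ?l x = 0}"
    have cP: "convex (base_polytope Bs)" by (simp add: base_polytope_def)
    have F: "F face_of base_polytope Bs" unfolding face_of_def
    proof (intro conjI ballI impI)
      show "F \<subseteq> base_polytope Bs" unfolding F_def by blast
      show "convex F"
      proof (rule convexI)
        fix x y u v assume "x \<in> F" "y \<in> F" "0 \<le> (u::real)" "0 \<le> v" "u + v = 1"
        then show "u *\<^sub>R x + v *\<^sub>R y \<in> F"
          using convexD[OF cP] unfolding F_def by (simp add: lookup_add)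
      qed
      fix a b x assume ab: "a \<in> base_polytope Bs" "b \<in> base_polytope Bs" and x: "x \<in> F" "x \<in> open_segment a b"
      obtain u where u: "0 < u" "u < 1" "x = (1 - u) *\<^sub>R a + u *\<^sub>R b" using x(2) by (auto simp: in_segment)
      have n: "0 \<le> ?l a" "0 \<le> ?l b" using base_polytope_bounds(1)[OF M] ab by auto
      have "(1 - u) * ?l a + u * ?l b = 0" using x(1) u unfolding F_def by (simp add: lookup_add)
      moreover have "0 \<le> (1 - u) * ?l a" "0 \<le> u * ?l b" using n u by auto
      ultimately have "(1 - u) * ?l a = 0" "u * ?l b = 0" by linarith+
      then show "a \<in> F" "b \<in> F" using ab u unfolding F_def by auto
    qed
    have "P \<subseteq> F"
    proof
      fix x assume x: "x \<in> P"
      have "matroid (E - {e}) (bases_of E P)"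
      proof -
        have m: "matroid E (bases_of E P)" using bases_of_subdivision(1)[OF S PS(1)] .
        have "\<forall>B\<in>bases_of E P. B \<subseteq> E - {e}" using e matroidD(4)[OF m] unfolding loops_def by blast
        then show ?thesis using m unfolding matroid_def by auto
      qed
      then have "?l x = 0" using base_polytope_bounds(3)[of "E - {e}" "bases_of E P" x e] x
        bases_of_subdivision(2)[OF S PS(1)] by simp
      moreover have "x \<in> base_polytope Bs" using x PS(1) subdivisionD(6)[OF S] by blast
      ultimately show "x \<in> F" unfolding F_def by simp
    qed
    then have "F = base_polytope Bs" using PS(2) F by blast
    then have zero: "?l x = 0" if "x \<in> base_polytope Bs" for x using that unfolding F_def by blast
    have "e \<notin> B" if "B \<in> Bs" for B
    proof -
      have "ind_vec B \<in> base_polytope Bs" unfolding base_polytope_def using that by (intro hull_inc) blast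
      then have "?l (ind_vec B) = 0" by (rule zero)
      then show ?thesis using matroidD(5)[OF M that] by (auto simp: lookup_ind_vec split: if_splits)
    qed
    then show "e \<in> loops E Bs" using e unfolding loops_def by blast
  qed
qed

text \<open>Agreement is tested only on matroids with the loops of \<open>Bs\<close>; by
  \<open>loops_interior_face\<close> these cover all terms of the sum. This admits formulas that
  hold for loopless matroids.\<close>

lemma balanced_cong:
  assumes M: "matroid E Bs" and S: "matroid_subdivision E Bs S" and f: "balanced E Bs S f"
    and eq: "\<And>X. matroid E X \<Longrightarrow> loops E X = loops E Bs \<Longrightarrow> f X = g X"
  shows "balanced E Bs S g"
proof -
  have "f (bases_of E P) = g (bases_of E P)" if "P \<in> interior_faces Bs S" for P
    using eq[OF bases_of_subdivision(1)[OF S, of P] loops_interior_face[OF M S that]] that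
    unfolding interior_faces_def by blast
  then show ?thesis using f eq[OF M refl] unfolding balanced_def by simp
qed

lemma sum_lookup_le_mrank:
  assumes M: "matroid E Bs" and A: "finite A" and x: "x \<in> base_polytope Bs"
  shows "(\<Sum>i\<in>A. Poly_Mapping.lookup x i) \<le> real (mrank Bs A)"
proof -
  let ?U = "{x :: nat \<Rightarrow>\<^sub>0 real. (\<Sum>i\<in>A. Poly_Mapping.lookup x i) \<le> real (mrank Bs A)}"
  have "base_polytope Bs \<subseteq> ?U" unfolding base_polytope_def
  proof (rule hull_minimal)
    show "ind_vec ` Bs \<subseteq> ?U"
    proof
      fix y assume "y \<in> ind_vec ` Bs"
      then obtain C where C: "C \<in> Bs" "y = ind_vec C" by blast
      then have "(\<Sum>i\<in>A. Poly_Mapping.lookup y i) = real (card (A \<inter> C))"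
        using A matroidD(5)[OF M C(1)] by (simp add: lookup_ind_vec sum.If_cases Int_def)
      then show "y \<in> ?U" using mrank_ge[OF M C(1), of A] by simp
    qed
    show "convex ?U"
    proof (rule convexI)
      fix x y :: "nat \<Rightarrow>\<^sub>0 real" and u v :: real
      assume a: "x \<in> ?U" "y \<in> ?U" "0 \<le> u" "0 \<le> v" "u + v = 1"
      have "u * (\<Sum>i\<in>A. Poly_Mapping.lookup x i) + v * (\<Sum>i\<in>A. Poly_Mapping.lookup y i)
        \<le> u * real (mrank Bs A) + v * real (mrank Bs A)"
        using a by (intro add_mono mult_left_mono) auto
      also have "\<dots> = (u + v) * real (mrank Bs A)" by (simp add: algebra_simps)
      finally show "u *\<^sub>R x + v *\<^sub>R y \<in> ?U" using a(5)
        by (simp add: lookup_add sum.distrib sum_distrib_left)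
    qed
  qed
  then show ?thesis using x by blast
qed

text \<open>A finite intersection of open halfspaces \<open>x(A) > r A - 1\<close> over a chain meets the base
  polytope if and only if it contains a greedy basis.\<close>

lemma balanced_rank_ge:
  assumes M: "matroid E Bs" and S: "matroid_subdivision E Bs S"
    and C: "finite C" "\<And>A B. A \<in> C \<Longrightarrow> B \<in> C \<Longrightarrow> A \<subseteq> B \<or> B \<subseteq> A" "\<And>A. A \<in> C \<Longrightarrow> A \<subseteq> E"
  shows "balanced E Bs S (\<lambda>X. of_bool (\<forall>A\<in>C. r A \<le> mrank X A))"
proof -
  \<comment> \<open>Strictness makes the set open. As ranks are integers, a rank above
    \<open>r A - 1\<close> is at least \<open>r A\<close>.\<close>
  define H where "H = {x :: nat \<Rightarrow>\<^sub>0 real. \<forall>A\<in>C. real (r A) - 1 < (\<Sum>i\<in>A. Poly_Mapping.lookup x i)}"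
  have lin: "(\<Sum>i\<in>A. Poly_Mapping.lookup (x + t *\<^sub>R y) i) =
     (\<Sum>i\<in>A. Poly_Mapping.lookup x i) + t * (\<Sum>i\<in>A. Poly_Mapping.lookup y i)" for A t and x y :: "nat \<Rightarrow>\<^sub>0 real"
    by (simp add: lookup_add sum.distrib sum_distrib_left)
  have "opencvx H" unfolding opencvx_def
  proof (intro conjI ballI allI)
    show "convex H"
    proof (rule convexI)
      fix x y :: "nat \<Rightarrow>\<^sub>0 real" and u v :: real
      assume a: "x \<in> H" "y \<in> H" "0 \<le> u" "0 \<le> v" "u + v = 1"
      have "real (r A) - 1 < (\<Sum>i\<in>A. Poly_Mapping.lookup (u *\<^sub>R x + v *\<^sub>R y) i)" if "A \<in> C" for A
      proof -
        let ?x = "\<Sum>i\<in>A. Poly_Mapping.lookup x i" and ?y = "\<Sum>i\<in>A. Poly_Mapping.lookup y i"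
        have xy: "real (r A) - 1 < ?x" "real (r A) - 1 < ?y" using a that unfolding H_def by auto
        have "(u + v) * (real (r A) - 1) < u * ?x + v * ?y"
        proof (cases "u = 0")
          case True
          then show ?thesis using xy a by simp
        next
          case False
          then have "u * (real (r A) - 1) < u * ?x" using xy a by simp
          moreover have "v * (real (r A) - 1) \<le> v * ?y" using xy a by (intro mult_left_mono) auto
          ultimately show ?thesis by (simp add: algebra_simps)
        qed
        then show ?thesis using a(5) by (simp add: lookup_add sum.distrib sum_distrib_left)
      qed
      then show "u *\<^sub>R x + v *\<^sub>R y \<in> H" unfolding H_def by blast
    qed
    fix p d :: "nat \<Rightarrow>\<^sub>0 real" assume p: "p \<in> H"
    show "\<exists>t>0. p + t *\<^sub>R d \<in> H"
    proof -
      have "\<exists>t>0. \<forall>A\<in>C. \<forall>s. 0 < s \<and> s \<le> t \<longrightarrow> real (r A) - 1 < (\<Sum>i\<in>A. Poly_Mapping.lookup (p + s *\<^sub>R d) i)"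
        using C(1) p unfolding H_def
      proof (induction C rule: finite_induct)
        case empty
        then show ?case by (intro exI[of _ 1]) auto
      next
        case (insert A C)
        then obtain t where t: "t > 0" "\<forall>A\<in>C. \<forall>s. 0 < s \<and> s \<le> t \<longrightarrow>
            real (r A) - 1 < (\<Sum>i\<in>A. Poly_Mapping.lookup (p + s *\<^sub>R d) i)" by auto
        let ?a = "\<Sum>i\<in>A. Poly_Mapping.lookup p i" and ?d = "\<Sum>i\<in>A. Poly_Mapping.lookup d i"
        \<comment> \<open>The available slack divided by a bound on the rate of change; the summand
          one keeps the denominator positive and the resulting inequality strict.\<close>
        define e where "e = (?a - (real (r A) - 1)) / (\<bar>?d\<bar> + 1)"
        have e: "e > 0" unfolding e_def using insert.prems by (intro divide_pos_pos) auto
        have "real (r A) - 1 < (\<Sum>i\<in>A. Poly_Mapping.lookup (p + s *\<^sub>R d) i)" if s: "0 < s" "s \<le> e" for s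
        proof -
          have "s * (\<bar>?d\<bar> + 1) \<le> e * (\<bar>?d\<bar> + 1)" using s by (intro mult_right_mono) auto
          also have "\<dots> = ?a - (real (r A) - 1)" unfolding e_def by (simp add: add_nonneg_eq_0_iff)
          finally have "s * \<bar>?d\<bar> + s \<le> ?a - (real (r A) - 1)" by (simp add: algebra_simps)
          moreover have "- (s * ?d) \<le> s * \<bar>?d\<bar>" using s mult_left_mono[of "- ?d" "\<bar>?d\<bar>" s] by simp
          ultimately show ?thesis unfolding lin using s by linarith
        qed
        then show ?case using t e by (intro exI[of _ "min t e"]) auto
      qed
      then obtain t where "t > 0" "\<forall>A\<in>C. \<forall>s. 0 < s \<and> s \<le> t \<longrightarrow>
          real (r A) - 1 < (\<Sum>i\<in>A. Poly_Mapping.lookup (p + s *\<^sub>R d) i)" by blast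
      then show ?thesis unfolding H_def by (intro exI[of _ t]) auto
    qed
  qed
  note eul = interior_faces_euler[OF M S this]
  have meets: "base_polytope X \<inter> H \<noteq> {} \<longleftrightarrow> (\<forall>A\<in>C. r A \<le> mrank X A)" if X: "matroid E X" for X
  proof
    assume "base_polytope X \<inter> H \<noteq> {}"
    then obtain x where x: "x \<in> base_polytope X" "x \<in> H" by blast
    show "\<forall>A\<in>C. r A \<le> mrank X A"
    proof
      fix A assume A: "A \<in> C"
      then have "finite A" using C(3) matroidD(1)[OF M] finite_subset by blast
      from sum_lookup_le_mrank[OF X this x(1)] have "real (r A) - 1 < real (mrank X A)"
        using x(2) A unfolding H_def by force
      then show "r A \<le> mrank X A" by linarith
    qed
  next
    assume le: "\<forall>A\<in>C. r A \<le> mrank X A"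
    obtain B where B: "B \<in> X" "\<And>A. A \<in> C \<Longrightarrow> card (A \<inter> B) = mrank X A"
      using chain_basis[OF X C(1,2)] by metis
    have "ind_vec B \<in> H" unfolding H_def
    proof (intro CollectI ballI)
      fix A assume A: "A \<in> C"
      then have fin: "finite A" using C(3) matroidD(1)[OF M] finite_subset by blast
      have sum: "(\<Sum>i\<in>A. Poly_Mapping.lookup (ind_vec B) i) = real (card (A \<inter> B))"
        using fin matroidD(5)[OF X B(1)] by (simp add: lookup_ind_vec sum.If_cases Int_def)
      show "real (r A) - 1 < (\<Sum>i\<in>A. Poly_Mapping.lookup (ind_vec B) i)"
      proof -
        have "real (r A) \<le> real (mrank X A)" using le A by simp
        then show ?thesis unfolding sum B(2)[OF A] by linarith
      qed
    qed
    moreover have "ind_vec B \<in> base_polytope X" unfolding base_polytope_def using B(1) by (intro hull_inc) blast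
    ultimately show "base_polytope X \<inter> H \<noteq> {}" by blast
  qed
  have "(of_bool (\<forall>A\<in>C. r A \<le> mrank (bases_of E P) A) :: int) = of_bool (P \<inter> H \<noteq> {})"
    if "P \<in> interior_faces Bs S" for P
    using meets[OF bases_of_subdivision(1)[OF S, of P]] bases_of_subdivision(2)[OF S, of P] that
    unfolding interior_faces_def by simp
  then show ?thesis unfolding balanced_def using eul meets[OF M] by simp
qed

text \<open>Equality at \<open>A\<close> is the difference of the conditions with thresholds
  \<open>r A\<close> and \<open>Suc (r A)\<close>. The induction converts one set after another and
  keeps the thresholds \<open>s\<close> of the remaining sets arbitrary, since both values are
  inserted there.\<close>

lemma balanced_rank_eq:
  assumes M: "matroid E Bs" and S: "matroid_subdivision E Bs S"
    and C: "finite C" "\<And>A B. A \<in> C \<Longrightarrow> B \<in> C \<Longrightarrow> A \<subseteq> B \<or> B \<subseteq> A" "\<And>A. A \<in> C \<Longrightarrow> A \<subseteq> E"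
  shows "balanced E Bs S (\<lambda>X. of_bool (\<forall>A\<in>C. mrank X A = r A))"
proof -
  have "balanced E Bs S (\<lambda>X. of_bool ((\<forall>A\<in>D. mrank X A = r A) \<and> (\<forall>A\<in>C - D. s A \<le> mrank X A)))"
    if "D \<subseteq> C" for D s
  proof -
    have "finite D" using that C(1) finite_subset by blast
    then show ?thesis using that
    proof (induction D arbitrary: s rule: finite_induct)
      case empty
      then show ?case using balanced_rank_ge[OF M S C, of s] by simp
    next
      case (insert A D)
      have D: "C - D = insert A (C - insert A D)" using insert by blast
      have upd: "(\<forall>B\<in>C - D. (s(A := k)) B \<le> mrank X B) \<longleftrightarrow>
          k \<le> mrank X A \<and> (\<forall>B\<in>C - insert A D. s B \<le> mrank X B)" for k X
        unfolding D by auto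
      have "balanced E Bs S (\<lambda>X.
         of_bool ((\<forall>B\<in>D. mrank X B = r B) \<and> (\<forall>B\<in>C - D. (s(A := r A)) B \<le> mrank X B)) -
         of_bool ((\<forall>B\<in>D. mrank X B = r B) \<and> (\<forall>B\<in>C - D. (s(A := Suc (r A))) B \<le> mrank X B)))"
        using insert.IH insert.prems by (intro balanced_diff) auto
      then show ?case
      proof (rule balanced_cong[OF M S])
        fix X
        show "of_bool ((\<forall>B\<in>D. mrank X B = r B) \<and> (\<forall>B\<in>C - D. (s(A := r A)) B \<le> mrank X B)) -
         of_bool ((\<forall>B\<in>D. mrank X B = r B) \<and> (\<forall>B\<in>C - D. (s(A := Suc (r A))) B \<le> mrank X B)) =
         (of_bool ((\<forall>B\<in>insert A D. mrank X B = r B) \<and> (\<forall>B\<in>C - insert A D. s B \<le> mrank X B)) :: int)"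
          unfolding upd by auto
      qed
    qed
  qed
  from this[of C] show ?thesis by simp
qed

section \<open>Flatness in terms of ranks\<close>

lemma sum_alternating_interval:
  assumes "finite G" "F \<subseteq> G"
  shows "(\<Sum>B\<in>{B. F \<subseteq> B \<and> B \<subseteq> G}. (-1) ^ card (B - F) :: int) = of_bool (G = F)"
proof -
  have "(\<Sum>B\<in>{B. F \<subseteq> B \<and> B \<subseteq> G}. (-1) ^ card (B - F) :: int) = (\<Sum>D\<in>Pow (G - F). (-1) ^ card D)"
    by (rule sum.reindex_bij_witness[where i = "\<lambda>D. F \<union> D" and j = "\<lambda>B. B - F"])
      (use assms in \<open>auto intro!: arg_cong[where f = card]\<close>)
  also have "\<dots> = of_bool (G - F = {})"
  proof (cases "G - F = {}")
    case False
    \<comment> \<open>Sets with and without the fixed element \<open>a\<close> cancel in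
      pairs.\<close>
    then obtain a where a: "a \<in> G - F" by blast
    have fin: "finite (G - F - {a})" using assms by simp
    have P: "Pow (G - F) = Pow (G - F - {a}) \<union> insert a ` Pow (G - F - {a})"
      using a by (metis Pow_insert insert_Diff)
    have "(\<Sum>D\<in>Pow (G - F). (-1) ^ card D :: int) = (\<Sum>D\<in>Pow (G - F - {a}). (-1) ^ card D)
       + (\<Sum>D\<in>insert a ` Pow (G - F - {a}). (-1) ^ card D)"
      unfolding P using fin by (intro sum.union_disjoint) auto
    also have "(\<Sum>D\<in>insert a ` Pow (G - F - {a}). (-1) ^ card D :: int) = (\<Sum>D\<in>Pow (G - F - {a}). (-1) ^ card (insert a D))"
    proof (subst sum.reindex)
      show "inj_on (insert a) (Pow (G - F - {a}))"
        by (rule inj_onI) (metis Diff_iff Pow_iff insert_ident singletonI subsetD)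
    qed simp
    also have "\<dots> = (\<Sum>D\<in>Pow (G - F - {a}). - ((-1) ^ card D))"
    proof (rule sum.cong)
      fix D assume "D \<in> Pow (G - F - {a})"
      then have "card (insert a D) = Suc (card D)" using fin finite_subset by (intro card_insert_disjoint) auto
      then show "(-1) ^ card (insert a D) = - ((-1) ^ card D :: int)" by simp
    qed simp
    finally show ?thesis using False by (simp add: sum_negf)
  next
    case True
    show ?thesis unfolding True by simp
  qed
  also have "of_bool (G - F = {}) = (of_bool (G = F) :: int)" using assms by auto
  finally show ?thesis .
qed

text \<open>Flatness is tested from the top of the chain: given that \<open>N\<close> is a flat containing \<open>F\<close>, the set
  \<open>F\<close> is a flat if and only if no larger subset of \<open>N\<close> has the same rank, and the sets of that rank
  between \<open>F\<close> and \<open>N\<close> form the interval from \<open>F\<close> to its closure.\<close>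

lemma flat_indicator:
  assumes X: "matroid E X" and N: "N \<in> flats E X" and F: "F \<subseteq> N"
  shows "(\<Sum>B\<in>{B. F \<subseteq> B \<and> B \<subseteq> N}. (-1) ^ card (B - F) * of_bool (mrank X F = r \<and> mrank X B = r)) =
    (of_bool (mrank X F = r \<and> F \<in> flats E X) :: int)"
proof (cases "mrank X F = r")
  case True
  have FE: "F \<subseteq> E" and NE: "N \<subseteq> E" using F flatsD[OF N] by auto
  have finN: "finite N" using NE matroidD(1)[OF X] finite_subset by blast
  let ?C = "mclosure E X F"
  have CN: "?C \<subseteq> N" by (rule closure_minimal[OF X N F])
  have FC: "F \<subseteq> ?C" by (rule subset_closure[OF FE])
  have iff: "mrank X B = r \<longleftrightarrow> B \<subseteq> ?C" if B: "F \<subseteq> B" "B \<subseteq> N" for B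
  proof
    assume r: "mrank X B = r"
    show "B \<subseteq> ?C"
    proof
      fix x assume x: "x \<in> B"
      have "mrank X F \<le> mrank X (insert x F)" by (rule mrank_mono[OF X]) blast
      moreover have "mrank X (insert x F) \<le> mrank X B" using x B by (intro mrank_mono[OF X]) blast
      ultimately show "x \<in> ?C" using True r x B NE unfolding mclosure_def by auto
    qed
  next
    assume "B \<subseteq> ?C"
    then have "mrank X B \<le> mrank X ?C" by (rule mrank_mono[OF X])
    moreover have "mrank X F \<le> mrank X B" using B by (intro mrank_mono[OF X])
    ultimately show "mrank X B = r" using True mrank_closure[OF X FE] by simp
  qed
  have "(\<Sum>B\<in>{B. F \<subseteq> B \<and> B \<subseteq> N}. (-1) ^ card (B - F) * of_bool (mrank X F = r \<and> mrank X B = r)) =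
     (\<Sum>B\<in>{B. F \<subseteq> B \<and> B \<subseteq> ?C}. (-1) ^ card (B - F) :: int)"
    using finN CN True iff by (intro sum.mono_neutral_cong_right) auto
  also have "\<dots> = of_bool (?C = F)"
    using finite_subset[OF CN finN] FC by (rule sum_alternating_interval)
  also have "?C = F \<longleftrightarrow> F \<in> flats E X"
    using closure_flat[OF X FE] closure_minimal[OF X _ subset_refl, of F] FC by auto
  finally show ?thesis using True by simp
qed simp

text \<open>Conditions are given as pairs because the induction for flats can prescribe two ranks
  for the same set; the indicator is then identically zero.\<close>

lemma balanced_rank_pairs:
  assumes M: "matroid E Bs" and S: "matroid_subdivision E Bs S"
    and D: "finite D" "\<And>p q. p \<in> D \<Longrightarrow> q \<in> D \<Longrightarrow> fst p \<subseteq> fst q \<or> fst q \<subseteq> fst p" "\<And>p. p \<in> D \<Longrightarrow> fst p \<subseteq> E"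
  shows "balanced E Bs S (\<lambda>X. of_bool (\<forall>p\<in>D. mrank X (fst p) = snd p))"
proof (cases "\<exists>p\<in>D. \<exists>q\<in>D. fst p = fst q \<and> snd p \<noteq> snd q")
  case True
  then obtain p q where pq: "p \<in> D" "q \<in> D" "fst p = fst q" "snd p \<noteq> snd q" by blast
  have no: "(\<forall>p\<in>D. mrank X (fst p) = snd p) = False" for X using pq by metis
  have zero: "(\<lambda>X. of_bool (\<forall>p\<in>D. mrank X (fst p) = snd p)) = (\<lambda>X. 0::int)" unfolding no by simp
  show ?thesis unfolding zero balanced_def by (simp add: sign_pow_eq)
next
  case False
  define r where "r A = (SOME k. (A, k) \<in> D)" for A
  have r: "snd p = r (fst p)" if p: "p \<in> D" for p
  proof -
    have "(fst p, snd p) \<in> D" using p by simp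
    then have "(fst p, r (fst p)) \<in> D" unfolding r_def by (rule someI)
    then show ?thesis using False p by force
  qed
  have "(\<forall>p\<in>D. mrank X (fst p) = snd p) \<longleftrightarrow> (\<forall>A\<in>fst ` D. mrank X A = r A)" for X using r by auto
  moreover have "balanced E Bs S (\<lambda>X. of_bool (\<forall>A\<in>fst ` D. mrank X A = r A))"
  proof (rule balanced_rank_eq[OF M S])
    show "finite (fst ` D)" using D(1) by simp
    show "A \<subseteq> B \<or> B \<subseteq> A" if AB: "A \<in> fst ` D" "B \<in> fst ` D" for A B
    proof -
      obtain p q where "p \<in> D" "q \<in> D" "A = fst p" "B = fst q" using AB by blast
      then show ?thesis using D(2) by simp
    qed
    show "A \<subseteq> E" if A: "A \<in> fst ` D" for A using A D(3) by blast
  qed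
  ultimately show ?thesis by simp
qed

text \<open>The induction also carries rank conditions \<open>D\<close> on sets below the chain. The
  smallest member \<open>F\<close> of \<open>K\<close> is traded for rank conditions on
  \<open>F\<close> and on the sets \<open>B\<close> between \<open>F\<close> and the next member, so
  that flatness is left to be treated only higher up.\<close>

lemma balanced_chain_of_flats:
  assumes M: "matroid E Bs" and S: "matroid_subdivision E Bs S"
    and K: "finite K" "\<And>F G. F \<in> K \<Longrightarrow> G \<in> K \<Longrightarrow> F \<subseteq> G \<or> G \<subseteq> F" "\<And>F. F \<in> K \<Longrightarrow> F \<subseteq> E"
  shows "balanced E Bs S (\<lambda>X. of_bool (\<forall>F\<in>K. F \<in> flats E X \<and> mrank X F = r F))"
proof -
  have "balanced E Bs S (\<lambda>X. of_bool ((\<forall>p\<in>D. mrank X (fst p) = snd p) \<and>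
      (\<forall>F\<in>K. F \<in> flats E X \<and> mrank X F = r F)))"
    if "finite D" "\<And>p q. p \<in> D \<Longrightarrow> q \<in> D \<Longrightarrow> fst p \<subseteq> fst q \<or> fst q \<subseteq> fst p" "\<And>p. p \<in> D \<Longrightarrow> fst p \<subseteq> E"
      "\<And>p F. p \<in> D \<Longrightarrow> F \<in> K \<Longrightarrow> fst p \<subseteq> F" for D
    using K that
  proof (induction "card K" arbitrary: K D rule: less_induct)
    case less
    note K = less.prems(1-3) and D = less.prems(4-7)
    show ?case
    proof (cases "K = {}")
      case True
      then show ?thesis using balanced_rank_pairs[OF M S D(1-3)] by simp
    next
      case False
      obtain F where F: "F \<in> K" "\<And>G. G \<in> K \<Longrightarrow> G \<subseteq> F \<Longrightarrow> F = G"
        using finite_has_minimal[OF K(1) False] by metis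
      have Fle: "F \<subseteq> G" if "G \<in> K" for G using K(2)[OF F(1) that] F(2)[OF that] by auto
      define K' where "K' = K - {F}"
      have K': "K = insert F K'" "F \<notin> K'" "finite K'" using F(1) K(1) unfolding K'_def by auto
      \<comment> \<open>The next member of the chain above \<open>F\<close>, or the ground set if
        there is none; a flat as soon as the remaining members are.\<close>
      define N where "N = (if K' = {} then E else \<Inter>K')"
      have FN: "F \<subseteq> N" using Fle K(3)[OF F(1)] unfolding N_def K'_def by auto
      have NE: "N \<subseteq> E" using K(3) K' unfolding N_def by auto
      have NK: "N \<subseteq> G" if "G \<in> K'" for G using that unfolding N_def by auto
      have N: "N \<in> flats E X" if flat: "\<forall>G\<in>K'. G \<in> flats E X" for X
      proof (cases "K' = {}")
        case True
        then show ?thesis unfolding N_def using ground_flat by simp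
      next
        case ne: False
        obtain G where G: "G \<in> K'" "\<And>H. H \<in> K' \<Longrightarrow> H \<subseteq> G \<Longrightarrow> G = H"
          using finite_has_minimal[OF K'(3) ne] by metis
        have "G \<subseteq> H" if "H \<in> K'" for H
        proof -
          have "G \<subseteq> H \<or> H \<subseteq> G" using K(2) G(1) that K'(1) by blast
          then show ?thesis using G(2)[OF that] by auto
        qed
        then have "\<Inter>K' = G" using G(1) by blast
        then show ?thesis using flat G(1) ne unfolding N_def by simp
      qed
      have card: "card K' < card K" using K' by simp
      let ?I = "{B. F \<subseteq> B \<and> B \<subseteq> N}"
      let ?flat = "\<lambda>X. \<forall>G\<in>K'. G \<in> flats E X \<and> mrank X G = r G"
      \<comment> \<open>Both sets get the rank \<open>r F\<close>. They lie above the sets of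
        \<open>D\<close> and below those of \<open>K'\<close>, so the enlarged family is still a
        chain below \<open>K'\<close>.\<close>
      let ?D = "\<lambda>B. insert (F, r F) (insert (B, r F) D)"
      have one: "balanced E Bs S (\<lambda>X. (-1) ^ card (B - F) *
          of_bool ((\<forall>p\<in>?D B. mrank X (fst p) = snd p) \<and> ?flat X))" if B: "B \<in> ?I" for B
      proof (rule balanced_scale, rule less.hyps[OF card])
        show "finite K'" "finite (?D B)" using K'(3) D(1) by auto
        show "G \<subseteq> H \<or> H \<subseteq> G" if "G \<in> K'" "H \<in> K'" for G H using K(2) that K'(1) by blast
        show "G \<subseteq> E" if "G \<in> K'" for G using K(3) that K'(1) by blast
        have DF: "fst p \<subseteq> F" if "p \<in> D" for p using D(4)[OF that F(1)] .
        show "fst p \<subseteq> E" if "p \<in> ?D B" for p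
        proof -
          have "fst p = F \<or> fst p = B \<or> p \<in> D" using that by auto
          moreover have "B \<subseteq> E" "F \<subseteq> E" using B NE FN by blast+
          ultimately show ?thesis using D(3)[of p] by blast
        qed
        show "fst p \<subseteq> G" if "p \<in> ?D B" "G \<in> K'" for p G
        proof -
          have "fst p = F \<or> fst p = B \<or> p \<in> D" using that(1) by auto
          moreover have "B \<subseteq> N" using B by blast
          ultimately have "fst p \<subseteq> N" using FN DF[of p] by blast
          then show ?thesis using NK[OF that(2)] by blast
        qed
        show "fst p \<subseteq> fst q \<or> fst q \<subseteq> fst p" if "p \<in> ?D B" "q \<in> ?D B" for p q
        proof -
          have "fst p = F \<or> fst p = B \<or> p \<in> D" "fst q = F \<or> fst q = B \<or> q \<in> D" using that by auto
          moreover have "F \<subseteq> B" using B by blast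
          ultimately show ?thesis using D(2)[of p q] DF[of p] DF[of q] by blast
        qed
      qed
      have "balanced E Bs S (\<lambda>X. \<Sum>B\<in>?I. (-1) ^ card (B - F) *
          of_bool ((\<forall>p\<in>?D B. mrank X (fst p) = snd p) \<and> ?flat X))"
        using one by (rule balanced_sum)
      then show ?thesis
      proof (rule balanced_cong[OF M S])
        fix X assume X: "matroid E X"
        let ?d = "\<forall>p\<in>D. mrank X (fst p) = snd p"
        have "(\<Sum>B\<in>?I. (-1) ^ card (B - F) * of_bool ((\<forall>p\<in>?D B. mrank X (fst p) = snd p) \<and> ?flat X)) =
          (\<Sum>B\<in>?I. of_bool (?d \<and> ?flat X) * ((-1) ^ card (B - F) * of_bool (mrank X F = r F \<and> mrank X B = r F)) :: int)"
          by (rule sum.cong) auto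
        also have "\<dots> = of_bool (?d \<and> ?flat X) *
          (\<Sum>B\<in>?I. (-1) ^ card (B - F) * of_bool (mrank X F = r F \<and> mrank X B = r F))"
          by (simp only: sum_distrib_left)
        also have "\<dots> = (of_bool (?d \<and> (\<forall>F\<in>K. F \<in> flats E X \<and> mrank X F = r F)) :: int)"
        proof (cases "?flat X")
          case True
          show ?thesis using flat_indicator[OF X N FN, of "r F"] True K'(1) by auto
        next
          case False
          then show ?thesis using K'(1) by auto
        qed
        finally show "(\<Sum>B\<in>?I. (-1) ^ card (B - F) * of_bool ((\<forall>p\<in>?D B. mrank X (fst p) = snd p) \<and> ?flat X)) =
          (of_bool (?d \<and> (\<forall>F\<in>K. F \<in> flats E X \<and> mrank X F = r F)) :: int)" .
      qed
    qed
  qed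
  from this[of "{}"] show ?thesis by simp
qed

section \<open>Straightening in Chow rings\<close>

text \<open>Nonemptiness puts \<open>E\<close> itself among the nonempty flats \<open>Lp\<close>;
  powers of its variable will represent the top degree of the ring.\<close>

locale loopless_matroid =
  fixes E :: "nat set" and Bs :: "nat set set"
  assumes M: "matroid E Bs" and empty_flat: "{} \<in> flats E Bs" and nonempty: "E \<noteq> {}"
begin

abbreviation rk :: "nat set \<Rightarrow> nat" where "rk \<equiv> mrank Bs"
abbreviation cl :: "nat set \<Rightarrow> nat set" where "cl \<equiv> mclosure E Bs"
abbreviation Lp :: "nat set set" where "Lp \<equiv> flats E Bs - {{}}"

lemma finite_Lp: "finite Lp" using finite_flats[OF M] by simp

lemma E_Lp: "E \<in> Lp" using ground_flat nonempty by simp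

lemma Lp_subset: "F \<in> Lp \<Longrightarrow> F \<subseteq> E" using flatsD by blast

lemma finite_in_Lp: "F \<in> Lp \<Longrightarrow> finite F" using Lp_subset matroidD(1)[OF M] finite_subset by blast

lemma rk_strict: "F \<in> Lp \<Longrightarrow> G \<in> Lp \<Longrightarrow> F \<subset> G \<Longrightarrow> rk F < rk G"
  using flats_mrank_strict[OF M] by blast

lemma rk_pos: "F \<in> Lp \<Longrightarrow> 0 < rk F"
  using flats_mrank_strict[OF M empty_flat, of F] by (cases "rk F") (auto simp: psubset_eq)

lemma rk_le_rk_E: "F \<in> Lp \<Longrightarrow> rk F \<le> rk E"
  using mrank_mono[OF M Lp_subset] .

lemma rk_E_pos: "0 < rk E" using rk_pos[OF E_Lp] .

lemma cl_Lp: "A \<subseteq> E \<Longrightarrow> A \<noteq> {} \<Longrightarrow> cl A \<in> Lp"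
  using closure_flat[OF M] subset_closure by blast

lemma cl_subset_iff: "A \<subseteq> E \<Longrightarrow> F \<in> Lp \<Longrightarrow> cl A \<subseteq> F \<longleftrightarrow> A \<subseteq> F"
  using closure_minimal[OF M] subset_closure by (metis DiffD1 order_trans)

lemma rk_cl: "A \<subseteq> E \<Longrightarrow> rk (cl A) = rk A" using mrank_closure[OF M] .

lemma rk_cl_insert:
  assumes A: "A \<in> flats E Bs" and i: "i \<in> E - A"
  shows "rk (cl (insert i A)) = Suc (rk A)"
proof -
  have "A \<subseteq> E" using A flatsD by blast
  moreover have "rk A < rk (insert i A)" using A i unfolding flats_def by blast
  ultimately show ?thesis using rk_cl[of "insert i A"] mrank_insert_le[OF M, of i A] i by simp
qed

text \<open>Termination measure of the straightening, which trades factors for larger flats.\<close>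

definition weight :: "nat set multiset \<Rightarrow> nat" where
  "weight m = (\<Sum>F\<in>#m. card E - card F)"

definition chain_mset :: "nat set multiset \<Rightarrow> bool" where
  "chain_mset m \<longleftrightarrow> set_mset m \<subseteq> Lp \<and> (\<forall>F\<in>#m. \<forall>G\<in>#m. F \<subseteq> G \<or> G \<subseteq> F)"

text \<open>The monomial basis of Feichtner and Yuzvinsky: \<open>\<epsilon> = 0\<close> for the reduced and \<open>\<epsilon> = 1\<close> for the
  augmented Chow ring. The flat \<open>E\<close> may occur, see \<open>chow_ring\<close>.\<close>

definition std :: "nat \<Rightarrow> nat set multiset \<Rightarrow> bool" where
  "std \<epsilon> m \<longleftrightarrow> chain_mset m \<and>
     (\<forall>G\<in>#m. count m G < rk G + \<epsilon> \<and> (\<forall>F\<in>#m. F \<subset> G \<longrightarrow> count m G + rk F < rk G))"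

lemma weight_up:
  assumes "B \<in> Lp" "set_mset w \<subseteq> Lp" "\<And>H. H \<in># w \<Longrightarrow> B \<subseteq> H"
  shows "weight w \<le> size w * (card E - card B)"
    and "H \<in># w \<Longrightarrow> H \<noteq> B \<Longrightarrow> weight w < size w * (card E - card B)"
proof -
  have le: "card E - card H \<le> card E - card B" if "H \<in># w" for H
    using that assms finite_in_Lp by (intro diff_le_mono2 card_mono) blast+
  have "weight v \<le> size v * (card E - card B)" if "set_mset v \<subseteq> set_mset w" for v
    using that
  proof (induction v)
    case (add H v)
    then have "weight v \<le> size v * (card E - card B)" "card E - card H \<le> card E - card B"
      using le by simp_all
    then show ?case unfolding weight_def by simp
  qed (simp add: weight_def)
  note gen = this
  show "weight w \<le> size w * (card E - card B)" using gen by simp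
  assume H: "H \<in># w" "H \<noteq> B"
  obtain v where v: "w = add_mset H v" using H by (metis insert_DiffM)
  have "B \<subset> H" "H \<in> Lp" using H assms by auto
  then have "card B < card H" "card H \<le> card E"
    using finite_in_Lp psubset_card_mono Lp_subset[of H] matroidD(1)[OF M] card_mono by blast+
  then have "card E - card H < card E - card B" by simp
  moreover have "weight v \<le> size v * (card E - card B)" using gen v by auto
  ultimately show "weight w < size w * (card E - card B)" unfolding v weight_def by simp
qed

end

text \<open>The bounds telescope along the chain: each \<open>c G\<close> is less than the increase
  of \<open>\<rho>\<close> over the next smaller member, or over the base level \<open>a\<close> at
  the bottom. By contraposition this locates an exponent that is too large.\<close>

lemma chain_sum_bound:
  fixes c :: "'a set \<Rightarrow> nat" and \<rho> :: "'a set \<Rightarrow> nat"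
  assumes "finite U" "U \<noteq> {}" "\<And>F G. F \<in> U \<Longrightarrow> G \<in> U \<Longrightarrow> F \<subseteq> G \<or> G \<subseteq> F"
    and "\<And>G. G \<in> U \<Longrightarrow> c G + a < \<rho> G"
    and "\<And>F G. F \<in> U \<Longrightarrow> G \<in> U \<Longrightarrow> F \<subset> G \<Longrightarrow> c G + \<rho> F < \<rho> G"
  shows "\<exists>T\<in>U. (\<forall>G\<in>U. G \<subseteq> T) \<and> sum c U + a < \<rho> T"
  using assms
proof (induction "card U" arbitrary: U rule: less_induct)
  case less
  obtain T where T: "T \<in> U" "\<And>X. X \<in> U \<Longrightarrow> T \<subseteq> X \<Longrightarrow> T = X"
    using finite_has_maximal[OF less.prems(1,2)] by metis
  have top: "\<forall>G\<in>U. G \<subseteq> T" using T less.prems(3) by blast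
  have s: "sum c U = c T + sum c (U - {T})" using T less.prems(1) by (simp add: sum.remove)
  show ?case
  proof (cases "U - {T} = {}")
    case True
    then have "sum c (U - {T}) = 0" by (metis sum.empty)
    then show ?thesis using T top s less.prems(4)[OF T(1)] by (intro bexI[of _ T]) auto
  next
    case False
    have "card (U - {T}) < card U" using T less.prems(1) by (intro card_Diff1_less)
    then obtain T' where T': "T' \<in> U - {T}" "sum c (U - {T}) + a < \<rho> T'"
      using less.hyps[of "U - {T}"] less.prems False by auto
    have "c T + \<rho> T' < \<rho> T" using less.prems(5) T T' top by blast
    then show ?thesis using T' s T top by (intro bexI[of _ T]) auto
  qed
qed

text \<open>A common presentation of both Chow rings by one variable for each nonempty flat, including \<open>E\<close>.
  In the reduced ring put \<open>x E = - (\<Sum>F \<ni> i, F \<noteq> E. x F)\<close>, which does not depend on \<open>i\<close>; in the augmented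
  ring put \<open>x E = - (\<Sum>F \<noteq> E. x F)\<close>, the sum including the variable of the empty flat, so that
  \<open>y i = - (\<Sum>F \<ni> i. x F)\<close> and \<open>y i\<^sup>2 = 0\<close>.\<close>

locale chow_ring = loopless_matroid E Bs for E Bs +
  fixes \<epsilon> :: nat and J :: "'a::comm_ring_1 set" and x :: "nat set \<Rightarrow> 'a"
  assumes zero_J: "0 \<in> J" and add_J: "a \<in> J \<Longrightarrow> b \<in> J \<Longrightarrow> a + b \<in> J" and mult_J: "a \<in> J \<Longrightarrow> r * a \<in> J"
    and incomparable: "F \<in> Lp \<Longrightarrow> G \<in> Lp \<Longrightarrow> \<not> F \<subseteq> G \<Longrightarrow> \<not> G \<subseteq> F \<Longrightarrow> x F * x G \<in> J"
    and outside: "G \<in> Lp \<Longrightarrow> i \<in> E - G \<Longrightarrow> x G * (\<Sum>H\<in>{H\<in>Lp. i \<in> H}. x H) \<in> J"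
    and atom_power: "i \<in> E \<Longrightarrow> (\<Sum>H\<in>{H\<in>Lp. i \<in> H}. x H) ^ Suc \<epsilon> \<in> J"
    and eps_le: "\<epsilon> \<le> 1"
begin

text \<open>Up to sign the simplicial generator attached to \<open>F\<close>. For the closure of a
  single element it is the sum occurring in \<open>outside\<close> and
  \<open>atom_power\<close>.\<close>

definition S :: "nat set \<Rightarrow> 'a" where "S F = (\<Sum>H\<in>{H\<in>Lp. F \<subseteq> H}. x H)"

definition X :: "nat set multiset \<Rightarrow> 'a" where "X m = (\<Prod>F\<in>#m. x F)"

lemma X_simps [simp]: "X {#} = 1" "X (add_mset F m) = x F * X m" "X (m + m') = X m * X m'"
    "X (replicate_mset n F) = x F ^ n"
  by (simp_all add: X_def image_replicate_mset)

lemma mult_J_right: "a \<in> J \<Longrightarrow> a * r \<in> J" using mult_J[of a r] by (simp add: mult.commute)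

lemma minus_J: "a \<in> J \<Longrightarrow> - a \<in> J" using mult_J[of a "-1"] by simp

lemma diff_J: "a \<in> J \<Longrightarrow> b \<in> J \<Longrightarrow> a - b \<in> J" using add_J[of a "-b"] minus_J by simp

lemma sum_J: "(\<And>i. i \<in> I \<Longrightarrow> f i \<in> J) \<Longrightarrow> sum f I \<in> J"
  by (induction I rule: infinite_finite_induct) (auto simp: zero_J add_J)

lemma J_transfer: "a \<in> J \<Longrightarrow> a - b \<in> J \<Longrightarrow> b \<in> J" using diff_J[of a "a - b"] by simp

lemma power_le_J: "a * b ^ m \<in> J \<Longrightarrow> m \<le> n \<Longrightarrow> a * b ^ n \<in> J"
  using mult_J_right[of "a * b ^ m" "b ^ (n - m)"]
  by (simp add: mult.assoc power_add[symmetric])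

lemma power_cong_J:
  assumes "a * b - a * c \<in> J" shows "a * b ^ n - a * c ^ n \<in> J"
proof (induction n)
  case (Suc n)
  have "a * b ^ Suc n - a * c ^ Suc n = (a * b ^ n - a * c ^ n) * b + (a * b - a * c) * c ^ n"
    by (simp add: algebra_simps)
  then show ?case using Suc assms add_J mult_J_right by metis
qed (simp add: zero_J)

lemma sum_split_J:
  assumes fin: "finite T" and "T' \<subseteq> T" "\<And>H. H \<in> T - T' \<Longrightarrow> a * x H \<in> J"
  shows "a * sum x T - a * sum x T' \<in> J"
proof -
  have "sum x T = sum x T' + sum x (T - T')" using sum.subset_diff[OF assms(2,1)] by (simp add: add.commute)
  then have "a * sum x T - a * sum x T' = (\<Sum>H\<in>T - T'. a * x H)" by (simp add: algebra_simps sum_distrib_left)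
  then show ?thesis using sum_J assms(3) by metis
qed

lemma finite_up: "finite {H\<in>Lp. P H}" using finite_Lp by simp

text \<open>A flat above \<open>B\<close> but not above \<open>H\<close> is incomparable to
  \<open>H\<close>, since \<open>B\<close> is not inside \<open>H\<close>; so its variable is killed
  by \<open>x H\<close>.\<close>

lemma x_S_join:
  assumes H: "H \<in> Lp" and B: "B \<in> Lp" and nB: "\<not> B \<subseteq> H"
  shows "x H * S B - x H * S (cl (B \<union> H)) \<in> J"
  unfolding S_def
proof (rule sum_split_J[OF finite_up])
  have sub: "B \<union> H \<subseteq> E" using H B Lp_subset by blast
  show "{K\<in>Lp. cl (B \<union> H) \<subseteq> K} \<subseteq> {K\<in>Lp. B \<subseteq> K}" using cl_subset_iff[OF sub] by blast
  fix K assume K: "K \<in> {K\<in>Lp. B \<subseteq> K} - {K\<in>Lp. cl (B \<union> H) \<subseteq> K}"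
  then have "K \<in> Lp" "B \<subseteq> K" "\<not> H \<subseteq> K" using cl_subset_iff[OF sub] by auto
  moreover from this have "\<not> K \<subseteq> H" using nB by blast
  ultimately show "x H * x K \<in> J" using incomparable[OF H] by blast
qed

text \<open>By submodularity the join of \<open>B\<close> and \<open>H\<close> exceeds
  \<open>H\<close> in rank by at most \<open>rk B - rk A\<close>. Once \<open>x_S_join\<close> has
  replaced \<open>S B\<close> by \<open>S\<close> of the join, the relation between \<open>H\<close>
  and the join has a small enough exponent.\<close>

lemma tail_vanish:
  assumes H: "H \<in> Lp" and B: "B \<in> Lp" and A: "A \<subseteq> B" "A \<subseteq> H" and nB: "\<not> B \<subseteq> H"
    and n: "rk B - rk A \<le> n"
    and IH: "\<And>D. D \<in> Lp \<Longrightarrow> H \<subset> D \<Longrightarrow> rk D - rk H \<le> n \<Longrightarrow> x H * S D ^ (rk D - rk H) \<in> J"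
  shows "x H * S B ^ n \<in> J"
proof -
  let ?D = "cl (B \<union> H)"
  have sub: "B \<union> H \<subseteq> E" using H B Lp_subset by blast
  have D: "?D \<in> Lp" using cl_Lp[OF sub] H by blast
  have HD: "H \<subset> ?D" using subset_closure[OF sub] nB by blast
  have "rk (B \<union> H) + rk (B \<inter> H) \<le> rk B + rk H" by (rule mrank_submodular[OF M])
  moreover have "rk A \<le> rk (B \<inter> H)" using A by (intro mrank_mono[OF M]) blast
  ultimately have le: "rk ?D - rk H \<le> n" using rk_cl[OF sub] n by simp
  have "x H * S ?D ^ n \<in> J" using power_le_J[OF IH[OF D HD le] le] .
  moreover have "x H * S ?D ^ n - x H * S B ^ n \<in> J"
    using minus_J[OF power_cong_J[OF x_S_join[OF H B nB], of n]] by simp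
  ultimately show ?thesis using J_transfer by blast
qed

text \<open>Together with the products of incomparable variables, the following two families are the
  Groebner basis of Feichtner and Yuzvinsky.\<close>

lemma relation_above:
  assumes "A \<in> Lp" "B \<in> Lp" "A \<subset> B"
  shows "x A * S B ^ (rk B - rk A) \<in> J"
  using assms
proof (induction "rk B - rk A" arbitrary: A B rule: less_induct)
  case less
  note A = less.prems(1) and B = less.prems(2)
  obtain n where n: "rk B - rk A = Suc n" using rk_strict[OF less.prems] by (metis Suc_diff_Suc)
  obtain i where i: "i \<in> B - A" using less.prems by blast
  \<comment> \<open>One rank step from \<open>A\<close> towards \<open>B\<close>. The relation
    \<open>outside\<close> for \<open>i\<close> makes \<open>x A * S A'\<close> vanish, and in front
    of \<open>S B ^ n\<close> the factor \<open>S A'\<close> can be exchanged for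
    \<open>S B\<close>.\<close>
  define A' where "A' = cl (insert i A)"
  have iE: "i \<in> E - A" using i Lp_subset[OF B] by blast
  have sub: "insert i A \<subseteq> E" using iE Lp_subset[OF A] by blast
  have A': "A' \<in> Lp" using cl_Lp[OF sub] unfolding A'_def by blast
  have rkA': "rk A' = Suc (rk A)" using rk_cl_insert[of A i] A iE unfolding A'_def by blast
  have A'B: "A' \<subseteq> B" using cl_subset_iff[OF sub B] i less.prems(3) unfolding A'_def by blast
  have "x A * sum x {H\<in>Lp. i \<in> H} - x A * sum x {H\<in>Lp. A' \<subseteq> H} \<in> J"
  proof (rule sum_split_J[OF finite_up])
    show "{H\<in>Lp. A' \<subseteq> H} \<subseteq> {H\<in>Lp. i \<in> H}" using cl_subset_iff[OF sub] unfolding A'_def by blast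
    fix H assume "H \<in> {H\<in>Lp. i \<in> H} - {H\<in>Lp. A' \<subseteq> H}"
    then have "H \<in> Lp" "i \<in> H" "\<not> A \<subseteq> H" using cl_subset_iff[OF sub] unfolding A'_def by auto
    then show "x A * x H \<in> J" using incomparable[OF A] iE by blast
  qed
  then have 1: "x A * S A' \<in> J" unfolding S_def using J_transfer outside[OF A iE] by blast
  have "(x A * S B ^ n) * sum x {H\<in>Lp. A' \<subseteq> H} - (x A * S B ^ n) * sum x {H\<in>Lp. B \<subseteq> H} \<in> J"
  proof (rule sum_split_J[OF finite_up])
    show "{H\<in>Lp. B \<subseteq> H} \<subseteq> {H\<in>Lp. A' \<subseteq> H}" using A'B by blast
    fix H assume H: "H \<in> {H\<in>Lp. A' \<subseteq> H} - {H\<in>Lp. B \<subseteq> H}"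
    have "x H * S B ^ n \<in> J"
    proof (rule tail_vanish[OF _ B A'B])
      show "H \<in> Lp" "A' \<subseteq> H" "\<not> B \<subseteq> H" using H by auto
      show "rk B - rk A' \<le> n" using n rkA' by simp
      show "x H * S D ^ (rk D - rk H) \<in> J" if "D \<in> Lp" "H \<subset> D" "rk D - rk H \<le> n" for D
        using less.hyps[of D H] that n H by simp
    qed
    from mult_J[OF this, of "x A"] show "(x A * S B ^ n) * x H \<in> J" by (simp add: mult_ac)
  qed
  moreover have "(x A * S B ^ n) * S A' \<in> J" using mult_J_right[OF 1, of "S B ^ n"] by (simp add: mult_ac)
  ultimately have "(x A * S B ^ n) * S B \<in> J" unfolding S_def[of A'] S_def[of B] using J_transfer by blast
  then show ?case unfolding n by (simp add: mult_ac)
qed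

lemma relation_bottom:
  assumes B: "B \<in> Lp" shows "S B ^ (rk B + \<epsilon>) \<in> J"
proof -
  obtain n where n: "rk B = Suc n" using rk_pos[OF B] by (cases "rk B") auto
  obtain i where i: "i \<in> B" using B by blast
  have iE: "i \<in> E" using i Lp_subset[OF B] by blast
  define A where "A = cl {i}"
  have sub: "{i} \<subseteq> E" using iE by blast
  have A: "A \<in> Lp" using cl_Lp[OF sub] unfolding A_def by blast
  have rkA: "rk A = 1" using rk_cl_insert[OF empty_flat, of i] iE mrank_empty[OF M] unfolding A_def by simp
  have AB: "A \<subseteq> B" using cl_subset_iff[OF sub B] i unfolding A_def by blast
  have "{H\<in>Lp. i \<in> H} = {H\<in>Lp. A \<subseteq> H}" using cl_subset_iff[OF sub] unfolding A_def by blast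
  then have power: "S A ^ Suc \<epsilon> \<in> J" unfolding S_def using atom_power[OF iE] by simp
  have "S B ^ n * sum x {H\<in>Lp. A \<subseteq> H} - S B ^ n * sum x {H\<in>Lp. B \<subseteq> H} \<in> J"
  proof (rule sum_split_J[OF finite_up])
    show "{H\<in>Lp. B \<subseteq> H} \<subseteq> {H\<in>Lp. A \<subseteq> H}" using AB by blast
    fix H assume H: "H \<in> {H\<in>Lp. A \<subseteq> H} - {H\<in>Lp. B \<subseteq> H}"
    have "x H * S B ^ n \<in> J"
    proof (rule tail_vanish[OF _ B AB])
      show "H \<in> Lp" "A \<subseteq> H" "\<not> B \<subseteq> H" using H by auto
      show "rk B - rk A \<le> n" using n rkA by simp
    qed (use relation_above H in auto)
    then show "S B ^ n * x H \<in> J" by (simp add: mult_ac)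
  qed
  then have eq: "S B ^ n * S A - S B ^ n * S B \<in> J" unfolding S_def .
  \<comment> \<open>All \<open>Suc \<epsilon>\<close> factors \<open>S A\<close> turn into
    \<open>S B\<close>, which gives the exponent
    \<open>n + Suc \<epsilon> = rk B + \<epsilon>\<close>.\<close>
  have "S B ^ n * S A ^ Suc \<epsilon> - S B ^ n * S B ^ Suc \<epsilon> \<in> J" by (rule power_cong_J[OF eq])
  then have "S B ^ n * S B ^ Suc \<epsilon> \<in> J" using J_transfer mult_J[OF power] by blast
  then show ?thesis unfolding n by (simp add: power_add mult_ac)
qed

text \<open>The power \<open>x B ^ n\<close> occurs in \<open>m\<close> as the leading term of
  \<open>S B ^ n\<close>, and \<open>m\<close> also contains the further factor, if any, with which
  \<open>S B ^ n\<close> forms a relation.\<close>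

definition bad :: "nat set multiset \<Rightarrow> nat set \<Rightarrow> nat \<Rightarrow> bool" where
  "bad m B n \<longleftrightarrow> B \<in># m \<and> n \<le> count m B \<and>
     (n = rk B + \<epsilon> \<or> (\<exists>A\<in>#m. A \<subset> B \<and> n = rk B - rk A))"

lemma X_mult_S_power:
  assumes P: "P 0" "\<And>a b. P a \<Longrightarrow> P b \<Longrightarrow> P (a + b)" and B: "B \<in> Lp"
    and "\<And>w. size w = j \<Longrightarrow> set_mset w \<subseteq> {H\<in>Lp. B \<subseteq> H} \<Longrightarrow> P (X (p + w))"
  shows "P (X p * S B ^ j)"
  using assms(4)
proof (induction j arbitrary: p)
  case 0
  then show ?case using "0"[of "{#}"] by simp
next
  case (Suc j)
  have sum: "P (sum f I)" if "\<And>i. i \<in> I \<Longrightarrow> P (f i)" for f and I :: "nat set set"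
    using that by (induction I rule: infinite_finite_induct) (auto simp: P)
  have eq: "X p * S B ^ Suc j = (\<Sum>H\<in>{H\<in>Lp. B \<subseteq> H}. X (p + {#H#}) * S B ^ j)"
    unfolding S_def[of B] by (simp add: sum_distrib_left sum_distrib_right mult_ac)
  have "P (X (p + {#H#}) * S B ^ j)" if "H \<in> {H\<in>Lp. B \<subseteq> H}" for H
  proof (rule Suc.IH)
    fix w :: "nat set multiset" assume "size w = j" "set_mset w \<subseteq> {H\<in>Lp. B \<subseteq> H}"
    then show "P (X (p + {#H#} + w))" using Suc.prems[of "add_mset H w"] that by (simp add: mult_ac)
  qed
  then show ?case unfolding eq by (rule sum)
qed

text \<open>Next to the rest of \<open>m\<close> the power \<open>S B ^ n\<close> vanishes, so
  \<open>x B ^ n\<close> may be replaced by \<open>x B ^ n - S B ^ n\<close>. Factoring this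
  difference leaves a variable strictly above \<open>B\<close> in every term, so the weight drops.
  The predicate \<open>P\<close> covers both membership in \<open>J\<close> and congruence to a
  combination of standard monomials.\<close>

lemma reduction:
  assumes P: "\<And>a. a \<in> J \<Longrightarrow> P a" "\<And>a b. P a \<Longrightarrow> P b \<Longrightarrow> P (a - b)"
    and m: "set_mset m \<subseteq> Lp" and bad: "bad m B n"
    and less: "\<And>w. size w = n \<Longrightarrow> set_mset w \<subseteq> {H\<in>Lp. B \<subseteq> H} \<Longrightarrow>
       weight (m - replicate_mset n B + w) < weight m \<Longrightarrow> P (X (m - replicate_mset n B + w))"
  shows "P (X m)"
proof -
  define q where "q = m - replicate_mset n B"
  have B: "B \<in> Lp" and cnt: "n \<le> count m B" using m bad unfolding bad_def by auto
  have mq: "m = q + replicate_mset n B" unfolding q_def using cnt by (simp add: count_le_replicate_mset_subset_eq)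
  have P0: "P 0" using P(1) zero_J by blast
  have Pm: "P (- a)" if "P a" for a using P(2)[OF P0 that] by simp
  have Pa: "P (a + b)" if "P a" "P b" for a b using P(2)[OF that(1) Pm[OF that(2)]] by simp
  have Ps: "P (sum f I)" if "\<And>i. i \<in> I \<Longrightarrow> P (f i)" for f :: "'b \<Rightarrow> 'a" and I
    using that by (induction I rule: infinite_finite_induct) (auto simp: P0 Pa)
  have zero: "X q * S B ^ n \<in> J"
  proof -
    consider "n = rk B + \<epsilon>" | A where "A \<in># m" "A \<subset> B" "n = rk B - rk A" using bad unfolding bad_def by blast
    then show ?thesis
    proof cases
      case 1
      then show ?thesis using relation_bottom[OF B] mult_J by blast
    next
      case 2
      have "A \<in># q" using 2(1,2) mq by (metis in_replicate_mset psubset_eq union_iff)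
      then obtain q' where "q = add_mset A q'" by (metis insert_DiffM)
      then have "X q * S B ^ n = X q' * (x A * S B ^ n)" by (simp add: mult_ac)
      moreover have "x A * S B ^ n \<in> J" using relation_above[of A B] 2 m B by blast
      ultimately show ?thesis using mult_J by metis
    qed
  qed
  have SB: "S B - x B = (\<Sum>H\<in>{H\<in>Lp. B \<subset> H}. x H)"
  proof -
    have "{H\<in>Lp. B \<subseteq> H} = insert B {H\<in>Lp. B \<subset> H}" using B by auto
    then show ?thesis unfolding S_def using finite_up by simp
  qed
  have summand: "P (X q * ((S B - x B) * (x B ^ (n - Suc j) * S B ^ j)))" if j: "j < n" for j
  proof -
    have "P (X (q + {#H#} + replicate_mset (n - Suc j) B) * S B ^ j)" if H: "H \<in> {H\<in>Lp. B \<subset> H}" for H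
    proof (rule X_mult_S_power[OF P0 Pa B])
      fix w :: "nat set multiset" assume w: "size w = j" "set_mset w \<subseteq> {H\<in>Lp. B \<subseteq> H}"
      define v where "v = add_mset H (replicate_mset (n - Suc j) B + w)"
      have v: "size v = n" "set_mset v \<subseteq> {H\<in>Lp. B \<subseteq> H}" "H \<in># v" "H \<noteq> B"
        using w H j B unfolding v_def by (auto simp: in_replicate_mset)
      have "weight v < n * (card E - card B)" using weight_up(2)[OF B _ _ v(3,4)] v(1,2) by auto
      moreover have "weight m = weight q + n * (card E - card B)"
        unfolding weight_def mq by (simp add: image_replicate_mset)
      ultimately have "weight (q + v) < weight m" unfolding weight_def by simp
      then have "P (X (q + v))" using less[OF v(1,2)] unfolding q_def by blast
      then show "P (X (q + {#H#} + replicate_mset (n - Suc j) B + w))" unfolding v_def by (simp add: mult_ac)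
    qed
    then have "P (\<Sum>H\<in>{H\<in>Lp. B \<subset> H}. X (q + {#H#} + replicate_mset (n - Suc j) B) * S B ^ j)" by (rule Ps)
    also have "(\<Sum>H\<in>{H\<in>Lp. B \<subset> H}. X (q + {#H#} + replicate_mset (n - Suc j) B) * S B ^ j)
       = X q * ((S B - x B) * (x B ^ (n - Suc j) * S B ^ j))"
      unfolding SB by (simp add: sum_distrib_left sum_distrib_right mult_ac)
    finally show ?thesis .
  qed
  have "S B ^ n - x B ^ n = (S B - x B) * (\<Sum>j<n. x B ^ (n - Suc j) * S B ^ j)"
    by (rule power_diff_sumr2)
  moreover have "X m = X q * S B ^ n - X q * (S B ^ n - x B ^ n)" unfolding mq by (simp add: algebra_simps)
  ultimately have "X m = X q * S B ^ n - (\<Sum>j<n. X q * ((S B - x B) * (x B ^ (n - Suc j) * S B ^ j)))"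
    by (simp only: sum_distrib_left)
  moreover have "P (\<Sum>j<n. X q * ((S B - x B) * (x B ^ (n - Suc j) * S B ^ j)))" using summand by (intro Ps) simp
  ultimately show ?thesis using P(2) P(1)[OF zero] by metis
qed

lemma not_chain_J:
  assumes "F \<in># m" "G \<in># m" "F \<in> Lp" "G \<in> Lp" "\<not> F \<subseteq> G" "\<not> G \<subseteq> F"
  shows "X m \<in> J"
proof -
  have "F \<noteq> G" using assms by blast
  then obtain m' where "m = add_mset F (add_mset G m')" using assms by (metis insert_DiffM insert_noteq_member)
  then have "X m = X m' * (x F * x G)" by (simp add: mult_ac)
  then show ?thesis using mult_J incomparable[OF assms(3-6)] by metis
qed

text \<open>Products of incomparable variables vanish, and a chain that violates a bound of
  \<open>std\<close> contains a \<open>bad\<close> power; \<open>reduction\<close> then lowers the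
  weight and keeps the degree.\<close>

lemma straighten:
  assumes P: "\<And>a. a \<in> J \<Longrightarrow> P a" "\<And>a b. P a \<Longrightarrow> P b \<Longrightarrow> P (a - b)"
    and std: "\<And>m. std \<epsilon> m \<Longrightarrow> size m = d \<Longrightarrow> P (X m)"
    and m: "set_mset m \<subseteq> Lp" "size m = d"
  shows "P (X m)"
  using m
proof (induction "weight m" arbitrary: m rule: less_induct)
  case less
  show ?case
  proof (cases "chain_mset m")
    case False
    then show ?thesis using not_chain_J less.prems P(1) unfolding chain_mset_def by blast
  next
    case chain: True
    show ?thesis
    proof (cases "std \<epsilon> m")
      case True
      then show ?thesis using std less.prems by blast
    next
      case False
      then obtain B where B: "B \<in># m" and
        "rk B + \<epsilon> \<le> count m B \<or> (\<exists>A\<in>#m. A \<subset> B \<and> rk B \<le> count m B + rk A)"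
        using chain unfolding std_def by (meson leI)
      then obtain n where bad: "bad m B n" unfolding bad_def
        by (metis (no_types, lifting) add.commute le_diff_conv)
      have n: "n \<le> count m B" using bad unfolding bad_def by blast
      show ?thesis
      proof (rule reduction[where P = P, OF P less.prems(1) bad])
        fix w assume w: "size w = n" "set_mset w \<subseteq> {H\<in>Lp. B \<subseteq> H}"
          "weight (m - replicate_mset n B + w) < weight m"
        have "set_mset (m - replicate_mset n B) \<subseteq> set_mset m" by (meson in_diffD subsetI)
        then have "set_mset (m - replicate_mset n B + w) \<subseteq> Lp" using w less.prems(1) by auto
        moreover have "size (m - replicate_mset n B + w) = d"
        proof -
          have "m = (m - replicate_mset n B) + replicate_mset n B"
            using n by (simp add: count_le_replicate_mset_subset_eq)
          then have "size m = size (m - replicate_mset n B) + n" by (metis size_union size_replicate_mset)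
          then show ?thesis using w(1) less.prems(2) by simp
        qed
        ultimately show "P (X (m - replicate_mset n B + w))" using less.hyps[OF w(3)] by blast
      qed
    qed
  qed
qed

text \<open>Multiplication by \<open>x A\<close> lands in a copy of the Chow ring of the contraction of \<open>A\<close>, which
  vanishes in degree \<open>rk E - rk A\<close>.\<close>

lemma vanish_above:
  assumes m: "set_mset m \<subseteq> Lp" and A: "A \<in># m" "A \<noteq> E"
    and size: "rk E - rk A \<le> size (filter_mset (\<lambda>F. A \<subset> F) m)"
  shows "X m \<in> J"
  using m A(1) size
proof (induction "weight m" arbitrary: m rule: less_induct)
  case less
  show ?case
  proof (cases "chain_mset m")
    case False
    then show ?thesis using not_chain_J less.prems unfolding chain_mset_def by blast
  next
    case chain: True
    define U where "U = {F. F \<in># m \<and> A \<subset> F}"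
    have ALp: "A \<in> Lp" using less.prems by blast
    have ULp: "U \<subseteq> Lp" using less.prems unfolding U_def by blast
    have finU: "finite U" unfolding U_def by simp
    have "set_mset (filter_mset (\<lambda>F. A \<subset> F) m) = U" unfolding U_def by auto
    then have sz: "size (filter_mset (\<lambda>F. A \<subset> F) m) = (\<Sum>F\<in>U. count m F)"
      unfolding size_multiset_overloaded_eq by (auto simp: U_def intro!: sum.cong)
    have "A \<subset> E" using A(2) Lp_subset[OF ALp] by blast
    then have "0 < rk E - rk A" using rk_strict[OF ALp E_Lp] by simp
    then have Une: "U \<noteq> {}" using less.prems(3) unfolding sz by auto
    \<comment> \<open>If all exponents above \<open>A\<close> respected the rank gaps, they would
      add up to less than \<open>rk E - rk A\<close>, against the hypothesis.\<close>
    have "\<exists>B F. B \<in> U \<and> F \<in># m \<and> A \<subseteq> F \<and> F \<subset> B \<and> rk B \<le> count m B + rk F"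
    proof (rule ccontr)
      assume no: "\<not> ?thesis"
      have "\<exists>T\<in>U. (\<forall>G\<in>U. G \<subseteq> T) \<and> (\<Sum>F\<in>U. count m F) + rk A < rk T"
      proof (rule chain_sum_bound[OF finU Une])
        show "F \<subseteq> G \<or> G \<subseteq> F" if "F \<in> U" "G \<in> U" for F G
          using chain that unfolding chain_mset_def U_def by blast
        show "count m G + rk A < rk G" if "G \<in> U" for G
          using no that less.prems(2) unfolding U_def by (metis (mono_tags, lifting) leI mem_Collect_eq subset_refl)
        show "count m G + rk F < rk G" if "F \<in> U" "G \<in> U" "F \<subset> G" for F G
          using no that unfolding U_def by (metis (mono_tags, lifting) leI mem_Collect_eq psubset_imp_subset)
      qed
      then show False using less.prems(3) ULp rk_le_rk_E unfolding sz by force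
    qed
    then obtain B F where BF: "B \<in> U" "F \<in># m" "A \<subseteq> F" "F \<subset> B" "rk B \<le> count m B + rk F" by blast
    define n where "n = rk B - rk F"
    have B: "B \<in># m" "A \<subset> B" using BF(1) unfolding U_def by auto
    have bad: "bad m B n" unfolding bad_def n_def using BF B by auto
    have n: "n \<le> count m B" using bad unfolding bad_def by blast
    show ?thesis
    proof (rule reduction[where P = "\<lambda>a. a \<in> J", OF _ diff_J less.prems(1) bad])
      fix w assume w: "size w = n" "set_mset w \<subseteq> {H\<in>Lp. B \<subseteq> H}"
        "weight (m - replicate_mset n B + w) < weight m"
      have m: "m = (m - replicate_mset n B) + replicate_mset n B"
        using n by (simp add: count_le_replicate_mset_subset_eq)
      have "set_mset (m - replicate_mset n B) \<subseteq> set_mset m" by (meson in_diffD subsetI)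
      then have 1: "set_mset (m - replicate_mset n B + w) \<subseteq> Lp" using w less.prems(1) by auto
      \<comment> \<open>Only factors \<open>B\<close> are replaced, by flats containing
        \<open>B\<close>, and all of these are strictly above \<open>A\<close>. So the factor
        \<open>A\<close> and the number of factors above it survive.\<close>
      have "A \<in># m - replicate_mset n B" using m less.prems(2) B(2)
        by (metis in_replicate_mset psubset_eq union_iff)
      then have 2: "A \<in># m - replicate_mset n B + w" by simp
      have "filter_mset (\<lambda>F. A \<subset> F) w = w" "filter_mset (\<lambda>F. A \<subset> F) (replicate_mset n B) = replicate_mset n B"
        using w(2) B(2) by (auto simp: filter_mset_eq_conv in_replicate_mset)
      then have "size (filter_mset (\<lambda>F. A \<subset> F) (m - replicate_mset n B + w)) = size (filter_mset (\<lambda>F. A \<subset> F) m)"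
        using w(1) by (subst (2) m) (simp only: filter_union_mset size_union size_replicate_mset)
      then show "X (m - replicate_mset n B + w) \<in> J" using less.hyps[OF w(3) 1 2] less.prems(3) by simp
    qed simp
  qed
qed

end

section \<open>Complementary monomials\<close>

context loopless_matroid begin

text \<open>The rank increase over the next smaller member of \<open>U\<close>, where the bottom
  counts as having rank minus \<open>\<epsilon>\<close>.\<close>

definition gap :: "nat \<Rightarrow> nat set set \<Rightarrow> nat set \<Rightarrow> nat" where
  "gap \<epsilon> U G = (if {F\<in>U. F \<subset> G} = {} then rk G + \<epsilon> else rk G - Max (rk ` {F\<in>U. F \<subset> G}))"

text \<open>The power of \<open>E\<close> falls one short of the gap at \<open>E\<close>, so that
  the total degree is the top degree \<open>rk E + \<epsilon> - 1\<close>.\<close>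

definition full :: "nat \<Rightarrow> nat set set \<Rightarrow> nat set multiset" where
  "full \<epsilon> U = (\<Sum>G\<in>U. replicate_mset (gap \<epsilon> U G) G) + replicate_mset (gap \<epsilon> U E - 1) E"

text \<open>The monomial complementary to a standard monomial \<open>g\<close>: their product \<open>full\<close> has
  exactly \<open>rk G + \<epsilon>\<close> factors below each flat \<open>G\<close> of \<open>g\<close>.\<close>

definition dual :: "nat \<Rightarrow> nat set multiset \<Rightarrow> nat set multiset" where
  "dual \<epsilon> g = (\<Sum>G\<in>insert E (set_mset g).
     replicate_mset (gap \<epsilon> (set_mset g) G - count g G - of_bool (G = E)) G)"

definition pchain :: "nat set set \<Rightarrow> bool" where
  "pchain U \<longleftrightarrow> U \<subseteq> Lp - {E} \<and> (\<forall>F\<in>U. \<forall>G\<in>U. F \<subseteq> G \<or> G \<subseteq> F)"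

lemma pchain_finite: "pchain U \<Longrightarrow> finite U"
  by (rule finite_subset[OF _ finite_Lp]) (auto simp: pchain_def)

lemma count_sum_replicate:
  "finite V \<Longrightarrow> count (\<Sum>G\<in>V. replicate_mset (f G) G) F = (if F \<in> V then f F else 0)"
  by (induction V rule: finite_induct) auto

lemma chain_max:
  assumes "pchain U" "V \<subseteq> U" "V \<noteq> {}"
  obtains T where "T \<in> V" "\<And>G. G \<in> V \<Longrightarrow> G \<subseteq> T"
proof -
  have "finite V" using finite_subset[OF assms(2) pchain_finite[OF assms(1)]] .
  then obtain T where T: "T \<in> V" "\<And>X. X \<in> V \<Longrightarrow> T \<subseteq> X \<Longrightarrow> T = X"
    using finite_has_maximal assms(3) by metis
  have "G \<subseteq> T" if "G \<in> V" for G
  proof -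
    have "G \<subseteq> T \<or> T \<subseteq> G" using assms(1,2) T(1) that unfolding pchain_def by blast
    then show ?thesis using T(2)[OF that] by auto
  qed
  then show ?thesis using that T by blast
qed

lemma gap_max:
  assumes U: "pchain U" and T: "T \<in> U" "T \<subset> G" "\<And>F. F \<in> U \<Longrightarrow> F \<subset> G \<Longrightarrow> F \<subseteq> T"
  shows "gap \<epsilon> U G = rk G - rk T"
proof -
  have fin: "finite (rk ` {F\<in>U. F \<subset> G})" using pchain_finite[OF U] by simp
  have max: "Max (rk ` {F\<in>U. F \<subset> G}) = rk T"
  proof (rule Max_eqI[OF fin])
    fix y assume "y \<in> rk ` {F\<in>U. F \<subset> G}"
    then obtain F where "F \<in> U" "F \<subset> G" "y = rk F" by blast
    then show "y \<le> rk T" using mrank_mono[OF M T(3)] by blast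
  qed (use T in blast)
  have ne: "{F\<in>U. F \<subset> G} \<noteq> {}" using T by blast
  show ?thesis by (simp only: gap_def max ne if_False)
qed

lemma gap_empty: "(\<And>F. F \<in> U \<Longrightarrow> \<not> F \<subset> G) \<Longrightarrow> gap \<epsilon> U G = rk G + \<epsilon>"
  unfolding gap_def by auto

lemma gap_pos:
  assumes U: "pchain U" and G: "G \<in> Lp" shows "0 < gap \<epsilon> U G"
proof (cases "{F\<in>U. F \<subset> G} = {}")
  case True
  then show ?thesis using rk_pos[OF G] unfolding gap_def by simp
next
  case False
  then obtain T where T: "T \<in> {F\<in>U. F \<subset> G}" "\<And>F. F \<in> {F\<in>U. F \<subset> G} \<Longrightarrow> F \<subseteq> T"
    using chain_max[OF U, of "{F\<in>U. F \<subset> G}"] by blast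
  then have "gap \<epsilon> U G = rk G - rk T" by (intro gap_max[OF U]) auto
  moreover have "T \<in> Lp" using T U unfolding pchain_def by blast
  ultimately show ?thesis using rk_strict[of T G] T G by simp
qed

text \<open>Consecutive rank increases cancel, and the bottom contributes \<open>\<epsilon>\<close>.
  The case distinction separates the empty sum, which is zero and carries no
  \<open>\<epsilon>\<close>.\<close>

lemma telescope:
  assumes U: "pchain U"
  shows "{G\<in>U. G \<subseteq> A} = {} \<and> (\<Sum>G\<in>{G\<in>U. G \<subseteq> A}. gap \<epsilon> U G) = 0 \<or>
    (\<exists>T\<in>U. T \<subseteq> A \<and> (\<forall>G\<in>U. G \<subseteq> A \<longrightarrow> G \<subseteq> T) \<and> (\<Sum>G\<in>{G\<in>U. G \<subseteq> A}. gap \<epsilon> U G) = rk T + \<epsilon>)"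
proof (induction "card {G\<in>U. G \<subseteq> A}" arbitrary: A rule: less_induct)
  case less
  have fin: "finite U" by (rule pchain_finite[OF U])
  show ?case
  proof (cases "{G\<in>U. G \<subseteq> A} = {}")
    case True
    then show ?thesis by (metis sum.empty)
  next
    case False
    obtain T where T: "T \<in> {G\<in>U. G \<subseteq> A}" "\<And>G. G \<in> {G\<in>U. G \<subseteq> A} \<Longrightarrow> G \<subseteq> T"
      using chain_max[OF U _ False] by blast
    define V where "V = {G\<in>U. G \<subset> T}"
    have VT: "{G\<in>U. G \<subseteq> A} = insert T V" unfolding V_def using T by blast
    have s: "(\<Sum>G\<in>{G\<in>U. G \<subseteq> A}. gap \<epsilon> U G) = gap \<epsilon> U T + (\<Sum>G\<in>V. gap \<epsilon> U G)"
      unfolding VT using fin unfolding V_def by simp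
    have "(\<Sum>G\<in>{G\<in>U. G \<subseteq> A}. gap \<epsilon> U G) = rk T + \<epsilon>"
    proof (cases "V = {}")
      case True
      then have "gap \<epsilon> U T = rk T + \<epsilon>" unfolding V_def by (intro gap_empty) blast
      then show ?thesis using s True by simp
    next
      case Vne: False
      obtain T' where T': "T' \<in> V" "\<And>G. G \<in> V \<Longrightarrow> G \<subseteq> T'"
        using chain_max[OF U _ Vne] V_def by blast
      have V': "{G\<in>U. G \<subseteq> T'} = V" using T' unfolding V_def by blast
      have lt: "card {G\<in>U. G \<subseteq> T'} < card {G\<in>U. G \<subseteq> A}"
        unfolding V' VT using fin unfolding V_def by simp
      have "\<exists>T''\<in>U. T'' \<subseteq> T' \<and> (\<forall>G\<in>U. G \<subseteq> T' \<longrightarrow> G \<subseteq> T'') \<and> (\<Sum>G\<in>V. gap \<epsilon> U G) = rk T'' + \<epsilon>"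
        using less.hyps[OF lt, unfolded V'] Vne by (simp only: simp_thms)
      then obtain T'' where T'': "T'' \<in> U" "T'' \<subseteq> T'" "\<forall>G\<in>U. G \<subseteq> T' \<longrightarrow> G \<subseteq> T''"
        "(\<Sum>G\<in>V. gap \<epsilon> U G) = rk T'' + \<epsilon>" by blast
      have "T' \<in> U" using T'(1) unfolding V_def by simp
      then have "T'' = T'" using T''(2,3) by blast
      then have "(\<Sum>G\<in>V. gap \<epsilon> U G) = rk T' + \<epsilon>" using T''(4) by simp
      moreover have "gap \<epsilon> U T = rk T - rk T'" using T' unfolding V_def by (intro gap_max[OF U]) auto
      moreover have "rk T' \<le> rk T" using T' unfolding V_def by (intro mrank_mono[OF M]) auto
      ultimately show ?thesis using s by simp
    qed
    then show ?thesis using T by blast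
  qed
qed

lemma pchain_std:
  assumes "std \<epsilon> g" shows "pchain (set_mset g - {E})"
  using assms unfolding std_def chain_mset_def pchain_def by blast

lemma gap_remove_E:
  assumes "G \<subseteq> E" shows "gap \<epsilon> (V - {E}) G = gap \<epsilon> V G"
proof -
  have eq: "{F\<in>V - {E}. F \<subset> G} = {F\<in>V. F \<subset> G}" using assms by blast
  show ?thesis unfolding gap_def eq ..
qed

lemma count_full:
  assumes "pchain U"
  shows "count (full \<epsilon> U) F = (if F = E then gap \<epsilon> U E - 1 else if F \<in> U then gap \<epsilon> U F else 0)"
  using assms pchain_finite[OF assms] unfolding full_def pchain_def by (auto simp: count_sum_replicate)

text \<open>The bounds in \<open>std\<close> say that multiplicities stay below gaps. Hence the
  subtractions in \<open>dual\<close> are exact, and every flat of \<open>g\<close> other than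
  \<open>E\<close> also occurs in \<open>dual \<epsilon> g\<close>.\<close>

lemma std_count_gap:
  assumes g: "std \<epsilon> g" and G: "G \<in> insert E (set_mset g)"
  shows "count g G < gap \<epsilon> (set_mset g - {E}) G"
proof (cases "G \<in># g")
  case False
  then have "G = E" "count g G = 0" using G by (auto simp: count_eq_zero_iff)
  then show ?thesis using gap_pos[OF pchain_std[OF g] E_Lp] by simp
next
  case True
  let ?U = "set_mset g - {E}"
  have U: "pchain ?U" by (rule pchain_std[OF g])
  show ?thesis
  proof (cases "{F\<in>?U. F \<subset> G} = {}")
    case T: True
    then have "gap \<epsilon> ?U G = rk G + \<epsilon>" by (intro gap_empty) blast
    then show ?thesis using g True unfolding std_def by simp
  next
    case False
    obtain T where T: "T \<in> {F\<in>?U. F \<subset> G}" "\<And>F. F \<in> {F\<in>?U. F \<subset> G} \<Longrightarrow> F \<subseteq> T"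
      using chain_max[OF U _ False] by blast
    then have "gap \<epsilon> ?U G = rk G - rk T" by (intro gap_max[OF U]) auto
    moreover have "count g G + rk T < rk G" using g True T unfolding std_def by blast
    ultimately show ?thesis by simp
  qed
qed

lemma count_dual:
  assumes g: "std \<epsilon> g"
  shows "count (dual \<epsilon> g) G =
    (if G \<in> insert E (set_mset g) then gap \<epsilon> (set_mset g - {E}) G - count g G - of_bool (G = E) else 0)"
proof -
  have "gap \<epsilon> (set_mset g) G = gap \<epsilon> (set_mset g - {E}) G" if "G \<in> insert E (set_mset g)"
    using that g gap_remove_E Lp_subset E_Lp unfolding std_def chain_mset_def by (metis insert_iff subsetD)
  then show ?thesis unfolding dual_def by (subst count_sum_replicate) auto
qed

lemma dual_full:
  assumes g: "std \<epsilon> g" shows "g + dual \<epsilon> g = full \<epsilon> (set_mset g - {E})"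
proof (rule multiset_eqI)
  fix F
  show "count (g + dual \<epsilon> g) F = count (full \<epsilon> (set_mset g - {E})) F"
    using std_count_gap[OF g, of F] count_eq_zero_iff[of g F]
    unfolding count_union count_dual[OF g] count_full[OF pchain_std[OF g]] by auto
qed

lemma size_filter_Lp:
  assumes "set_mset m \<subseteq> Lp"
  shows "size (filter_mset P m) = (\<Sum>F\<in>{F\<in>Lp. P F}. count m F)"
proof -
  have "size (filter_mset P m) = (\<Sum>F\<in>set_mset (filter_mset P m). count (filter_mset P m) F)"
    by (simp add: size_multiset_overloaded_eq)
  also have "\<dots> = (\<Sum>F\<in>{F\<in>Lp. P F}. count m F)"
    using assms finite_Lp by (intro sum.mono_neutral_cong_left) (auto simp: not_in_iff)
  finally show ?thesis .
qed

lemma size_Lp: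
  assumes "set_mset m \<subseteq> Lp" shows "size m = (\<Sum>F\<in>Lp. count m F)"
proof -
  have "{F\<in>Lp. True} = Lp" by blast
  then show ?thesis using size_filter_Lp[OF assms, of "\<lambda>_. True"] by (simp only: filter_mset_True)
qed

lemma size_full:
  assumes U: "pchain U" shows "size (full \<epsilon> U) + 1 = rk E + \<epsilon>"
proof -
  have fin: "finite U" by (rule pchain_finite[OF U])
  have all: "{G\<in>U. G \<subseteq> E} = U" using U Lp_subset unfolding pchain_def by blast
  have sz: "size (full \<epsilon> U) = (\<Sum>G\<in>U. gap \<epsilon> U G) + (gap \<epsilon> U E - 1)" unfolding full_def
  proof -
    have "size (\<Sum>G\<in>U. replicate_mset (f G) G) = sum f U" for f using fin
      by (induction U rule: finite_induct) auto
    then show "size ((\<Sum>G\<in>U. replicate_mset (gap \<epsilon> U G) G) + replicate_mset (gap \<epsilon> U E - 1) E)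
       = (\<Sum>G\<in>U. gap \<epsilon> U G) + (gap \<epsilon> U E - 1)" by simp
  qed
  have pos: "0 < gap \<epsilon> U E" using gap_pos[OF U E_Lp] .
  from telescope[OF U, of E \<epsilon>, unfolded all] show ?thesis
  proof
    assume U0: "U = {} \<and> (\<Sum>G\<in>U. gap \<epsilon> U G) = 0"
    then have "gap \<epsilon> U E = rk E + \<epsilon>" by (intro gap_empty) auto
    then show ?thesis using sz pos U0 by simp
  next
    assume "\<exists>T\<in>U. T \<subseteq> E \<and> (\<forall>G\<in>U. G \<subseteq> E \<longrightarrow> G \<subseteq> T) \<and> (\<Sum>G\<in>U. gap \<epsilon> U G) = rk T + \<epsilon>"
    then obtain T where T: "T \<in> U" "\<forall>G\<in>U. G \<subseteq> E \<longrightarrow> G \<subseteq> T" "(\<Sum>G\<in>U. gap \<epsilon> U G) = rk T + \<epsilon>" by blast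
    have TE: "T \<subset> E" using T(1) U Lp_subset unfolding pchain_def by blast
    have "gap \<epsilon> U E = rk E - rk T" using T TE by (intro gap_max[OF U]) auto
    then show ?thesis using sz pos T(3) by simp
  qed
qed

end

section \<open>The pairing of complementary degrees\<close>

context chow_ring begin

text \<open>The largest flat \<open>T\<close> of the chain is merged into \<open>E\<close> at the
  cost of a sign. Next to \<open>x E ^ k\<close> the variables strictly between \<open>T\<close> and
  \<open>E\<close> vanish, and so does \<open>x T * x E\<close>; hence \<open>S T ^ n\<close> acts
  there as \<open>x T ^ n + x E ^ n\<close>. Next to the other flats of the chain
  \<open>S T ^ n\<close> vanishes, so \<open>x T ^ n\<close> becomes
  \<open>- x E ^ n\<close>.\<close>

lemma X_full_socle:
  assumes U: "pchain U"
  shows "\<exists>s. (s = 1 \<or> s = - 1) \<and> X (full \<epsilon> U) - s * x E ^ (rk E + \<epsilon> - 1) \<in> J"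
  using U
proof (induction "card U" arbitrary: U rule: less_induct)
  case less
  note U = less.prems
  have fin: "finite U" by (rule pchain_finite[OF U])
  show ?case
  proof (cases "U = {}")
    case True
    then have "gap \<epsilon> U E = rk E + \<epsilon>" by (intro gap_empty) auto
    then have "X (full \<epsilon> U) - 1 * x E ^ (rk E + \<epsilon> - 1) = 0" unfolding full_def True by simp
    then show ?thesis using zero_J by metis
  next
    case False
    obtain T where T: "T \<in> U" "\<And>G. G \<in> U \<Longrightarrow> G \<subseteq> T" using chain_max[OF U _ False] by blast
    have TLp: "T \<in> Lp" and TE: "T \<subset> E" using T(1) U Lp_subset unfolding pchain_def by auto
    have rkT: "rk T < rk E" using rk_strict[OF TLp E_Lp TE] .
    define U' where "U' = U - {T}"
    have U': "pchain U'" using U unfolding pchain_def U'_def by blast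
    define p where "p = (\<Sum>G\<in>U'. replicate_mset (gap \<epsilon> U G) G)"
    define n where "n = gap \<epsilon> U T"
    define k where "k = rk E - rk T - 1"
    have npos: "0 < n" unfolding n_def by (rule gap_pos[OF U TLp])
    have gE: "gap \<epsilon> U E = rk E - rk T" using T TE by (intro gap_max[OF U]) auto
    have full: "full \<epsilon> U = p + replicate_mset n T + replicate_mset k E"
    proof -
      have "(\<Sum>G\<in>U. replicate_mset (gap \<epsilon> U G) G) = replicate_mset n T + p"
        unfolding p_def U'_def n_def using fin T(1) by (simp add: sum.remove)
      then show ?thesis unfolding full_def gE k_def by (simp add: add.commute)
    qed
    have gap': "gap \<epsilon> U' G = gap \<epsilon> U G" if "G \<in> U'" for G
    proof -
      have eq: "{F\<in>U'. F \<subset> G} = {F\<in>U. F \<subset> G}" using T(2)[of G] that unfolding U'_def by blast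
      show ?thesis unfolding gap_def eq ..
    qed
    have sE: "F \<subset> E" if "F \<in> U'" for F
    proof -
      have "F \<in> Lp" "F \<noteq> E" using that U' unfolding pchain_def by blast+
      then show ?thesis using Lp_subset[of F] by blast
    qed
    have below: "{F\<in>U. F \<subset> T} = U'" unfolding U'_def using T by blast
    have belowE: "{F\<in>U'. F \<subset> E} = U'" using sE by blast
    \<comment> \<open>The exponent \<open>n\<close> is that of a relation for \<open>T\<close>: with
      the next smaller flat of the chain if there is one, from the bottom otherwise. The gaps add
      up, so the power of \<open>x E\<close> obtained is the one for the chain without
      \<open>T\<close>.\<close>
    have gE': "gap \<epsilon> U' E - 1 = n + k \<and> X p * S T ^ n \<in> J"
    proof (cases "U' = {}")
      case True
      then have "n = rk T + \<epsilon>" "gap \<epsilon> U' E = rk E + \<epsilon>" unfolding n_def gap_def below belowE by auto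
      then show ?thesis using rkT relation_bottom[OF TLp] mult_J unfolding k_def by simp
    next
      case False
      obtain T' where T': "T' \<in> U'" "\<And>G. G \<in> U' \<Longrightarrow> G \<subseteq> T'" using chain_max[OF U' _ False] by blast
      have T'T: "T' \<subset> T" "T' \<in> U" using T' below by blast+
      have T'Lp: "T' \<in> Lp" using T'T U unfolding pchain_def by blast
      have n: "n = rk T - rk T'" unfolding n_def
      proof (rule gap_max[OF U T'T(2,1)])
        fix F assume "F \<in> U" "F \<subset> T"
        then show "F \<subseteq> T'" using below T'(2) by blast
      qed
      have "gap \<epsilon> U' E = rk E - rk T'" using T' sE by (intro gap_max[OF U']) auto
      then have 1: "gap \<epsilon> U' E - 1 = n + k" unfolding n k_def using rkT rk_strict[OF T'Lp TLp T'T(1)] by simp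
      have "count p T' = gap \<epsilon> U T'" unfolding p_def using T' pchain_finite[OF U'] by (simp add: count_sum_replicate)
      then have "T' \<in># p" using gap_pos[OF U T'Lp] by (metis count_eq_zero_iff less_irrefl)
      then obtain q where "p = add_mset T' q" by (metis insert_DiffM)
      then have "X p * S T ^ n = X q * (x T' * S T ^ n)" by (simp add: mult_ac)
      then show ?thesis using 1 relation_above[OF T'Lp TLp T'T(1)] mult_J unfolding n by metis
    qed
    have full': "full \<epsilon> U' = p + replicate_mset (n + k) E"
    proof -
      have "(\<Sum>G\<in>U'. replicate_mset (gap \<epsilon> U' G) G) = p" unfolding p_def using gap' by (intro sum.cong) auto
      then show ?thesis unfolding full_def using gE' by simp
    qed
    have between: "x E ^ k * x H \<in> J" if H: "H \<in> Lp" "T \<subset> H" "H \<noteq> E" for H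
    proof -
      have HE: "H \<subset> E" using H Lp_subset by blast
      have "X ({#H#} + replicate_mset k E) \<in> J"
      proof (rule vanish_above[where A = H])
        have "k \<ge> rk E - rk H" using rk_strict[OF TLp H(1,2)] unfolding k_def by simp
        moreover have "filter_mset (\<lambda>F. H \<subset> F) ({#H#} + replicate_mset k E) = replicate_mset k E"
          using HE by (auto simp: filter_mset_eq_conv in_replicate_mset)
        ultimately show "rk E - rk H \<le> size (filter_mset (\<lambda>F. H \<subset> F) ({#H#} + replicate_mset k E))" by simp
      qed (use H E_Lp in \<open>auto simp: in_replicate_mset\<close>)
      then show ?thesis by (simp add: mult_ac)
    qed
    have TE0: "x E ^ k * (x T * x E) \<in> J"
    proof -
      have "X ({#T#} + replicate_mset (Suc k) E) \<in> J"
      proof (rule vanish_above[where A = T])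
        have "filter_mset (\<lambda>F. T \<subset> F) ({#T#} + replicate_mset (Suc k) E) = replicate_mset (Suc k) E"
          using TE by (auto simp: filter_mset_eq_conv in_replicate_mset)
        then show "rk E - rk T \<le> size (filter_mset (\<lambda>F. T \<subset> F) ({#T#} + replicate_mset (Suc k) E))"
          unfolding k_def by simp
      qed (use TLp TE E_Lp in \<open>auto simp: in_replicate_mset\<close>)
      then show ?thesis by (simp add: mult_ac)
    qed
    have "x E ^ k * sum x {H\<in>Lp. T \<subseteq> H} - x E ^ k * sum x {T, E} \<in> J"
      by (rule sum_split_J[OF finite_up]) (use TLp TE E_Lp between in \<open>auto simp: psubset_eq\<close>)
    then have "x E ^ k * S T - x E ^ k * (x T + x E) \<in> J" unfolding S_def using TE by (simp add: psubset_eq)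
    from power_cong_J[OF this, of n] have c1: "x E ^ k * S T ^ n - x E ^ k * (x T + x E) ^ n \<in> J" .
    \<comment> \<open>Mixed terms of the binomial contain \<open>x T * x E\<close> and are killed by
      \<open>x E ^ k\<close>.\<close>
    have c2: "x E ^ k * (x T + x E) ^ Suc j - x E ^ k * (x T ^ Suc j + x E ^ Suc j) \<in> J" for j
    proof (induction j)
      case (Suc j)
      have "x E ^ k * (x T + x E) ^ Suc (Suc j) - x E ^ k * (x T ^ Suc (Suc j) + x E ^ Suc (Suc j)) =
        (x T + x E) * (x E ^ k * (x T + x E) ^ Suc j - x E ^ k * (x T ^ Suc j + x E ^ Suc j))
        + (x T ^ j + x E ^ j) * (x E ^ k * (x T * x E))" by (simp add: algebra_simps)
      then show ?case using add_J[OF mult_J[OF Suc] mult_J[OF TE0]] by metis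
    qed (simp add: zero_J)
    obtain j where j: "n = Suc j" using npos by (cases n) auto
    have sum0: "X p * (x E ^ k * (x T ^ n + x E ^ n)) \<in> J"
    proof -
      have "x E ^ k * (x T + x E) ^ n - x E ^ k * (x T ^ n + x E ^ n) \<in> J" using c2[of j] j by simp
      from add_J[OF c1 this] have "x E ^ k * S T ^ n - x E ^ k * (x T ^ n + x E ^ n) \<in> J" by simp
      from mult_J[OF this, of "X p"]
      have "x E ^ k * (X p * S T ^ n) - X p * (x E ^ k * (x T ^ n + x E ^ n)) \<in> J" by (simp add: algebra_simps)
      then show ?thesis using J_transfer gE' mult_J by blast
    qed
    have "card U' < card U" unfolding U'_def using fin T(1) by (intro card_Diff1_less)
    from less.hyps[OF this U'] obtain s where s: "s = 1 \<or> s = -1"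
      "X (full \<epsilon> U') - s * x E ^ (rk E + \<epsilon> - 1) \<in> J" by blast
    have eq: "X (full \<epsilon> U) - (- s) * x E ^ (rk E + \<epsilon> - 1) =
      X p * (x E ^ k * (x T ^ n + x E ^ n)) - (X (full \<epsilon> U') - s * x E ^ (rk E + \<epsilon> - 1))"
      unfolding full full' by (simp add: algebra_simps power_add)
    have "X (full \<epsilon> U) - (- s) * x E ^ (rk E + \<epsilon> - 1) \<in> J"
      unfolding eq by (rule diff_J[OF sum0 s(2)])
    moreover have "- s = 1 \<or> - s = - 1" using s(1) by auto
    ultimately show ?thesis by blast
  qed
qed

text \<open>Let \<open>A\<close> be the smallest flat where the multiplicities differ. A nonzero
  product has few factors above \<open>A\<close>, hence at least \<open>rk A + \<epsilon>\<close>
  inside \<open>A\<close>. The product of \<open>g\<close> with its dual has exactly that many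
  inside a flat of \<open>g\<close>; if \<open>A\<close> occurred less often in \<open>e\<close>
  than in \<open>g\<close>, the product of \<open>e\<close> with that dual would have fewer.\<close>

lemma triangular:
  assumes e: "std \<epsilon> e" and g: "std \<epsilon> g" and sz: "size e = size g" and ne: "e \<noteq> g"
    and nJ: "X (e + dual \<epsilon> g) \<notin> J"
  shows "\<exists>A\<in>Lp. count g A < count e A \<and> (\<forall>F. count e F \<noteq> count g F \<longrightarrow> A \<subseteq> F)"
proof -
  define U where "U = set_mset g - {E}"
  have U: "pchain U" unfolding U_def by (rule pchain_std[OF g])
  define D where "D = {F. count e F \<noteq> count g F}"
  have eLp: "set_mset e \<subseteq> Lp" and gLp: "set_mset g \<subseteq> Lp" using e g unfolding std_def chain_mset_def by auto
  have "D \<subseteq> set_mset e \<union> set_mset g"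
  proof
    fix F assume "F \<in> D"
    then have "count e F \<noteq> count g F" unfolding D_def by simp
    then show "F \<in> set_mset e \<union> set_mset g" by (metis UnCI count_eq_zero_iff)
  qed
  then have finD: "finite D" by (rule finite_subset) simp
  have Dne: "D \<noteq> {}" using ne unfolding D_def by (auto intro: multiset_eqI)
  let ?m = "e + dual \<epsilon> g"
  have "set_mset (dual \<epsilon> g) \<subseteq> insert E (set_mset g)"
  proof
    fix F assume "F \<in># dual \<epsilon> g"
    then have "count (dual \<epsilon> g) F \<noteq> 0" by (simp add: count_eq_zero_iff)
    then show "F \<in> insert E (set_mset g)" unfolding count_dual[OF g] by (auto split: if_splits)
  qed
  then have mLp: "set_mset ?m \<subseteq> Lp" using eLp gLp E_Lp by auto
  have gm: "U \<subseteq> set_mset (dual \<epsilon> g)"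
  proof
    fix F assume F: "F \<in> U"
    then have "count (dual \<epsilon> g) F \<noteq> 0" using std_count_gap[OF g, of F]
      unfolding count_dual[OF g] U_def by auto
    then show "F \<in># dual \<epsilon> g" by (simp add: count_eq_zero_iff)
  qed
  have chain: "F \<subseteq> G \<or> G \<subseteq> F" if "F \<in># ?m" "G \<in># ?m" for F G
    using not_chain_J[of F ?m G] that mLp nJ by blast
  have sub: "set_mset e \<union> set_mset g \<subseteq> insert E (set_mset ?m)" using gm unfolding U_def by auto
  have chainD: "F \<subseteq> G \<or> G \<subseteq> F" if "F \<in> D" "G \<in> D" for F G
  proof -
    have "F \<in> insert E (set_mset ?m)" "G \<in> insert E (set_mset ?m)" "F \<in> Lp" "G \<in> Lp"
      using that \<open>D \<subseteq> _\<close> sub eLp gLp by blast+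
    then show ?thesis using chain Lp_subset by (metis insert_iff)
  qed
  obtain A where A: "A \<in> D" "\<And>F. F \<in> D \<Longrightarrow> F \<subseteq> A \<Longrightarrow> A = F"
    using finite_has_minimal[OF finD Dne] by metis
  have least: "A \<subseteq> F" if "F \<in> D" for F using chainD[OF A(1) that] A(2)[OF that] by auto
  have ALp: "A \<in> Lp" using A(1) \<open>D \<subseteq> _\<close> eLp gLp by blast
  \<comment> \<open>A difference at \<open>E\<close> alone is excluded by equality of the
    degrees.\<close>
  have AE: "A \<noteq> E"
  proof
    assume AE: "A = E"
    have "F = E" if "F \<in> D" for F
      using least[OF that] that \<open>D \<subseteq> _\<close> eLp gLp Lp_subset AE by blast
    then have eq: "count e F = count g F" if "F \<noteq> E" for F using that unfolding D_def by blast
    have "size e = (\<Sum>F\<in>Lp. count e F)" "size g = (\<Sum>F\<in>Lp. count g F)"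
      using size_Lp eLp gLp by blast+
    then have "count e E + (\<Sum>F\<in>Lp - {E}. count e F) = count g E + (\<Sum>F\<in>Lp - {E}. count g F)"
      using sz finite_Lp E_Lp by (simp add: sum.remove[symmetric])
    moreover have "(\<Sum>F\<in>Lp - {E}. count e F) = (\<Sum>F\<in>Lp - {E}. count g F)" using eq by (intro sum.cong) auto
    ultimately show False using A(1) AE unfolding D_def by simp
  qed
  have Am: "A \<in># ?m" using A(1) \<open>D \<subseteq> _\<close> sub AE by blast
  define N where "N f = (\<Sum>F\<in>{F\<in>Lp. F \<subseteq> A}. count f F)" for f
  have N: "size (filter_mset (\<lambda>F. F \<subseteq> A) f) = N f" if "set_mset f \<subseteq> Lp" for f
    unfolding N_def by (rule size_filter_Lp[OF that])
  \<comment> \<open>Otherwise at least \<open>rk E - rk A\<close> of the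
    \<open>rk E + \<epsilon> - 1\<close> factors lie strictly above \<open>A\<close>, and
    \<open>vanish_above\<close> applies.\<close>
  have big: "rk A + \<epsilon> \<le> N ?m"
  proof (rule ccontr)
    assume small: "\<not> rk A + \<epsilon> \<le> N ?m"
    have "filter_mset (\<lambda>F. \<not> F \<subseteq> A) ?m = filter_mset (\<lambda>F. A \<subset> F) ?m"
    proof (rule filter_mset_cong[OF refl])
      fix F assume "F \<in># ?m"
      then show "(\<not> F \<subseteq> A) = (A \<subset> F)" using chain[OF _ Am, of F] by blast
    qed
    then have "size ?m = size (filter_mset (\<lambda>F. F \<subseteq> A) ?m) + size (filter_mset (\<lambda>F. A \<subset> F) ?m)"
      by (metis multiset_partition size_union)
    then have "size ?m = N ?m + size (filter_mset (\<lambda>F. A \<subset> F) ?m)" using N[OF mLp] by simp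
    moreover have "size ?m + 1 = rk E + \<epsilon>"
      using size_full[OF U, of \<epsilon>] dual_full[OF g] sz unfolding U_def by (metis size_union)
    ultimately have "rk E - rk A \<le> size (filter_mset (\<lambda>F. A \<subset> F) ?m)" using small by simp
    then show False using vanish_above[OF mLp Am AE] nJ by blast
  qed
  have fA: "finite {F\<in>Lp. F \<subseteq> A}" using finite_Lp by simp
  have setA: "{F\<in>Lp. F \<subseteq> A} = insert A {F\<in>Lp. F \<subset> A}" using ALp by blast
  have split: "N f = count f A + (\<Sum>F\<in>{F\<in>Lp. F \<subset> A}. count f F)" for f
    unfolding N_def setA using finite_Lp by simp
  have agree: "(\<Sum>F\<in>{F\<in>Lp. F \<subset> A}. count e F) = (\<Sum>F\<in>{F\<in>Lp. F \<subset> A}. count g F)"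
    using least unfolding D_def by (intro sum.cong) auto
  have Nadd: "N (f + h) = N f + N h" for f h unfolding N_def by (simp add: sum.distrib)
  have Nfull: "N ?m + count g A = N (full \<epsilon> U) + count e A"
    using Nadd[of e "dual \<epsilon> g"] Nadd[of g "dual \<epsilon> g"] split[of e] split[of g] agree dual_full[OF g]
    unfolding U_def by simp
  have Nf: "N (full \<epsilon> U) = (\<Sum>G\<in>{G\<in>U. G \<subseteq> A}. gap \<epsilon> U G)"
  proof -
    have "A \<subset> E" using AE Lp_subset[OF ALp] by blast
    then show ?thesis unfolding N_def count_full[OF U] using U fA unfolding pchain_def
      by (intro sum.mono_neutral_cong_right) auto
  qed
  have lt: "count g A < count e A"
  proof (rule ccontr)
    assume "\<not> ?thesis"
    then have lt: "count e A < count g A" using A(1) unfolding D_def by simp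
    then have "A \<in># g" by (metis count_eq_zero_iff not_less0)
    then have AU: "A \<in> U" using AE unfolding U_def by simp
    from telescope[OF U, of A \<epsilon>] have "N (full \<epsilon> U) = rk A + \<epsilon>"
    proof
      assume "\<exists>T\<in>U. T \<subseteq> A \<and> (\<forall>G\<in>U. G \<subseteq> A \<longrightarrow> G \<subseteq> T) \<and> (\<Sum>G\<in>{G\<in>U. G \<subseteq> A}. gap \<epsilon> U G) = rk T + \<epsilon>"
      then obtain T where T: "T \<subseteq> A" "\<forall>G\<in>U. G \<subseteq> A \<longrightarrow> G \<subseteq> T" "N (full \<epsilon> U) = rk T + \<epsilon>" unfolding Nf by blast
      moreover have "T = A" using T AU by blast
      ultimately show ?thesis by simp
    qed (use AU in blast)
    then show False using Nfull lt big by simp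
  qed
  then show ?thesis using ALp least unfolding D_def by blast
qed

text \<open>Multiply the relation by the dual of a monomial \<open>g\<close> of largest weight
  \<open>W\<close> in its support. By \<open>triangular\<close> all other monomials are sent to
  zero, and \<open>g\<close> is sent to the nonzero top value up to sign.\<close>

lemma std_independent:
  fixes \<phi> :: "'a \<Rightarrow> 'k::field" and k :: "'k \<Rightarrow> 'a" and c :: "nat set multiset \<Rightarrow> 'k"
  assumes add: "\<And>a b. \<phi> (a + b) = \<phi> a + \<phi> b" and J0: "\<And>a. a \<in> J \<Longrightarrow> \<phi> a = 0"
    and scale: "\<And>r a. \<phi> (k r * a) = r * \<phi> a"
    and top: "\<phi> (x E ^ (rk E + \<epsilon> - 1)) \<noteq> 0"
    and T: "finite T" "\<And>e. e \<in> T \<Longrightarrow> std \<epsilon> e \<and> size e = d"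
    and rel: "\<And>b. \<phi> ((\<Sum>e\<in>T. k (c e) * X e) * b) = 0" and e: "e \<in> T"
  shows "c e = 0"
proof (rule ccontr)
  assume "c e \<noteq> 0"
  \<comment> \<open>Multiplicities act as digits in base \<open>d + 1\<close>, smaller flats in
    higher positions. As they add up to \<open>d\<close>, the flat \<open>A\<close> contained in all
    flats where two monomials differ decides the comparison.\<close>
  define W where "W f = (\<Sum>F\<in>Lp. count f F * Suc d ^ (card E - card F))" for f
  define V where "V = {f\<in>T. c f \<noteq> 0}"
  have V: "finite V" "V \<noteq> {}" using T e \<open>c e \<noteq> 0\<close> unfolding V_def by auto
  then have "Max (W ` V) \<in> W ` V" by (intro Max_in) auto
  then obtain g where g: "g \<in> V" "W g = Max (W ` V)" by auto
  have gmax: "W f \<le> W g" if "f \<in> V" for f unfolding g(2) using that V by (intro Max_ge) auto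
  have gT: "g \<in> T" "c g \<noteq> 0" using g(1) unfolding V_def by auto
  have zero: "\<phi> (X (f + dual \<epsilon> g)) = 0" if f: "f \<in> V" "f \<noteq> g" for f
  proof (rule ccontr)
    assume "\<phi> (X (f + dual \<epsilon> g)) \<noteq> 0"
    then have nJ: "X (f + dual \<epsilon> g) \<notin> J" using J0 by blast
    have fs: "std \<epsilon> f" "std \<epsilon> g" "size f = size g" "size g = d" using T(2) f gT unfolding V_def by auto
    from triangular[OF fs(1,2,3) f(2) nJ] obtain A where A: "A \<in> Lp" "count g A < count f A"
      "\<And>F. count f F \<noteq> count g F \<Longrightarrow> A \<subseteq> F" by blast
    have gLp: "set_mset g \<subseteq> Lp" using fs unfolding std_def chain_mset_def by blast
    define L1 where "L1 = {F\<in>Lp. \<not> A \<subseteq> F}"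
    define L2 where "L2 = {F\<in>Lp. A \<subset> F}"
    have L: "Lp = insert A (L1 \<union> L2)" "A \<notin> L1 \<union> L2" "L1 \<inter> L2 = {}" "finite L1" "finite L2"
      unfolding L1_def L2_def using A finite_Lp by auto
    let ?w = "\<lambda>F. Suc d ^ (card E - card F)"
    have W: "W h = count h A * ?w A + (\<Sum>F\<in>L1. count h F * ?w F) + (\<Sum>F\<in>L2. count h F * ?w F)" for h
      unfolding W_def by (subst L(1)) (use L(2-5) in \<open>simp add: sum.union_disjoint\<close>)
    have s1: "(\<Sum>F\<in>L1. count f F * ?w F) = (\<Sum>F\<in>L1. count g F * ?w F)"
      using A(3) unfolding L1_def by (intro sum.cong) auto
    have "Suc d * (\<Sum>F\<in>L2. count g F * ?w F) = (\<Sum>F\<in>L2. count g F * (Suc d * ?w F))"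
      by (simp only: sum_distrib_left mult_ac)
    also have "\<dots> \<le> (\<Sum>F\<in>L2. count g F * ?w A)"
    proof (intro sum_mono mult_left_mono)
      fix F assume F: "F \<in> L2"
      then have FLp: "F \<in> Lp" "A \<subset> F" unfolding L2_def by auto
      have "card A < card F" "card F \<le> card E"
        using FLp finite_in_Lp[OF FLp(1)] Lp_subset[OF FLp(1)] matroidD(1)[OF M] psubset_card_mono card_mono by blast+
      then have "Suc (card E - card F) \<le> card E - card A" by simp
      then have "Suc d ^ Suc (card E - card F) \<le> ?w A" by (intro power_increasing) auto
      then show "Suc d * ?w F \<le> ?w A" by simp
    qed simp
    also have "\<dots> = (\<Sum>F\<in>L2. count g F) * ?w A" by (simp only: sum_distrib_right)
    also have "(\<Sum>F\<in>L2. count g F) \<le> (\<Sum>F\<in>Lp. count g F)" using finite_Lp unfolding L2_def by (intro sum_mono2) auto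
    also have "(\<Sum>F\<in>Lp. count g F) = d" using size_Lp[OF gLp] fs(4) by simp
    finally have "Suc d * (\<Sum>F\<in>L2. count g F * ?w F) \<le> d * ?w A" by simp
    also have "\<dots> < Suc d * ?w A" by simp
    finally have "(\<Sum>F\<in>L2. count g F * ?w F) < ?w A" by (simp only: mult_less_cancel1)
    moreover have "count g A * ?w A + ?w A \<le> count f A * ?w A"
      using mult_right_mono[of "Suc (count g A)" "count f A" "?w A"] A(2) by simp
    ultimately have "W g < W f" unfolding W s1 by linarith
    then show False using gmax[OF f(1)] by simp
  qed
  have sum: "\<phi> (sum h I) = (\<Sum>i\<in>I. \<phi> (h i))" for h :: "nat set multiset \<Rightarrow> 'a" and I
    using J0[OF zero_J] by (induction I rule: infinite_finite_induct) (auto simp: add)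
  have "0 = \<phi> ((\<Sum>e\<in>T. k (c e) * X e) * X (dual \<epsilon> g))" using rel by simp
  also have "\<dots> = (\<Sum>e\<in>T. c e * \<phi> (X (e + dual \<epsilon> g)))"
    by (simp only: sum_distrib_right sum mult.assoc scale X_simps)
  also have "\<dots> = (\<Sum>e\<in>{g}. c e * \<phi> (X (e + dual \<epsilon> g)))"
    using T(1) gT zero unfolding V_def by (intro sum.mono_neutral_right) auto
  finally have 0: "\<phi> (X (g + dual \<epsilon> g)) = 0" using gT by simp
  have gs: "std \<epsilon> g" using T(2) gT by blast
  obtain s where s: "s = 1 \<or> s = -1" "X (full \<epsilon> (set_mset g - {E})) - s * x E ^ (rk E + \<epsilon> - 1) \<in> J"
    using X_full_socle[OF pchain_std[OF gs]] by blast
  have neg: "\<phi> (- a) = - \<phi> a" for a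
  proof -
    have "\<phi> a + \<phi> (- a) = 0" using add[of a "-a"] J0[OF zero_J] by simp
    then show ?thesis by (rule minus_unique[symmetric])
  qed
  have "\<phi> (X (full \<epsilon> (set_mset g - {E}))) = \<phi> (s * x E ^ (rk E + \<epsilon> - 1))"
    using J0[OF s(2)] add[of "X (full \<epsilon> (set_mset g - {E})) - s * x E ^ (rk E + \<epsilon> - 1)"
      "s * x E ^ (rk E + \<epsilon> - 1)"] by simp
  then have "\<phi> (s * x E ^ (rk E + \<epsilon> - 1)) = 0" using 0 dual_full[OF gs] by simp
  then show False using s(1) top neg by auto
qed

end

section \<open>Additive maps on polynomials\<close>

lemma poly_mapping_sum_singles:
  "p = (\<Sum>m\<in>Poly_Mapping.keys p. Poly_Mapping.single m (Poly_Mapping.lookup p m))"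
proof (rule poly_mapping_eqI)
  fix k
  have "(\<Sum>m\<in>Poly_Mapping.keys p. Poly_Mapping.lookup p m when m = k)
      = (\<Sum>m\<in>Poly_Mapping.keys p. if m = k then Poly_Mapping.lookup p m else 0)"
    by (rule sum.cong) auto
  then show "Poly_Mapping.lookup p k =
      Poly_Mapping.lookup (\<Sum>m\<in>Poly_Mapping.keys p. Poly_Mapping.single m (Poly_Mapping.lookup p m)) k"
    by (simp add: lookup_sum lookup_single in_keys_iff)
qed

lemma additive_sum:
  fixes F :: "'a::comm_monoid_add \<Rightarrow> 'b::cancel_comm_monoid_add"
  assumes "\<And>a b. F (a + b) = F a + F b"
  shows "F (sum f I) = (\<Sum>i\<in>I. F (f i))"
proof -
  have "F 0 + F 0 = F 0 + 0" using assms[of 0 0] by simp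
  then have "F 0 = 0" by (simp only: add_left_cancel)
  then show ?thesis by (induction I rule: infinite_finite_induct) (auto simp: assms)
qed

lemma additive_eqI:
  fixes F G :: "('a \<Rightarrow>\<^sub>0 'b::comm_monoid_add) \<Rightarrow> 'c::cancel_comm_monoid_add"
  assumes F: "\<And>a b. F (a + b) = F a + F b" and G: "\<And>a b. G (a + b) = G a + G b"
    and eq: "\<And>m c. F (Poly_Mapping.single m c) = G (Poly_Mapping.single m c)"
  shows "F p = G p"
  by (subst (1 2) poly_mapping_sum_singles[of p]) (simp add: additive_sum[of F, OF F] additive_sum[of G, OF G] eq)

text \<open>Linear extension from monomials, with \<open>k\<close> mapping coefficients to the
  target; it yields the functional \<open>deg\<close>, the projection \<open>trunc\<close> and the
  substitution \<open>eval_poly\<close>.\<close>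

definition extend :: "(rat \<Rightarrow> 'b::comm_ring_1) \<Rightarrow> (cmono \<Rightarrow> 'b) \<Rightarrow> cpoly \<Rightarrow> 'b" where
  "extend k f p = (\<Sum>m\<in>Poly_Mapping.keys p. k (Poly_Mapping.lookup p m) * f m)"

lemma extend_add:
  assumes "\<And>a b. k (a + b) = k a + k b" "k 0 = 0"
  shows "extend k f (p + q) = extend k f p + extend k f q"
  unfolding extend_def
  by (rule setsum_keys_plus_distrib) (simp_all add: assms distrib_right)

lemma extend_single:
  assumes "k 0 = 0" shows "extend k f (Poly_Mapping.single m c) = k c * f m"
  by (simp add: extend_def assms)

lemma single_eq_const_mono: "Poly_Mapping.single m c = Poly_Mapping.single 0 c * mono m"
  by (simp add: mono_def mult_single)

lemma mono_add: "mono (m + m') = mono m * mono m'" by (simp add: mono_def mult_single)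

lemma mono_0: "mono 0 = 1" by (simp add: mono_def)

text \<open>The value at a minimal set occurs in no other sum, so it can be solved for last. This
  recovers flat variables from simplicial generators.\<close>

lemma exists_moebius:
  fixes s :: "'a set \<Rightarrow> 'b::ab_group_add"
  assumes "finite L" shows "\<exists>x. \<forall>F\<in>L. s F = (\<Sum>H\<in>{H\<in>L. F \<subseteq> H}. x H)"
  using assms
proof (induction "card L" arbitrary: L rule: less_induct)
  case less
  show ?case
  proof (cases "L = {}")
    case False
    obtain A where A: "A \<in> L" "\<And>F. F \<in> L \<Longrightarrow> F \<subseteq> A \<Longrightarrow> A = F"
      using finite_has_minimal[OF less.prems False] by metis
    have "card (L - {A}) < card L" using A less.prems by (intro card_Diff1_less)
    then obtain x where x: "\<forall>F\<in>L - {A}. s F = (\<Sum>H\<in>{H\<in>L - {A}. F \<subseteq> H}. x H)"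
      using less.hyps[of "L - {A}"] less.prems by auto
    define y where "y = x(A := s A - (\<Sum>H\<in>{H\<in>L. A \<subset> H}. x H))"
    have "s F = (\<Sum>H\<in>{H\<in>L. F \<subseteq> H}. y H)" if F: "F \<in> L" for F
    proof (cases "F = A")
      case True
      have "{H\<in>L. A \<subseteq> H} = insert A {H\<in>L. A \<subset> H}" using A by blast
      moreover have "(\<Sum>H\<in>{H\<in>L. A \<subset> H}. y H) = (\<Sum>H\<in>{H\<in>L. A \<subset> H}. x H)"
        unfolding y_def by (rule sum.cong) auto
      ultimately show ?thesis using less.prems True by (simp add: y_def)
    next
      case False
      then have "\<not> F \<subseteq> A" using A(2)[OF F] by blast
      then have "{H\<in>L. F \<subseteq> H} = {H\<in>L - {A}. F \<subseteq> H}" by blast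
      moreover have "(\<Sum>H\<in>{H\<in>L - {A}. F \<subseteq> H}. y H) = (\<Sum>H\<in>{H\<in>L - {A}. F \<subseteq> H}. x H)"
        unfolding y_def by (rule sum.cong) auto
      ultimately show ?thesis using x F False by simp
    qed
    then show ?thesis by blast
  qed simp
qed

section \<open>The socle functional on the simplicial generators\<close>

context loopless_matroid begin

text \<open>All nonempty subsets are counted and \<open>H\<close> ranges over arbitrary sets, which
  makes the count supermodular under plain unions and intersections.\<close>

definition below :: "cmono \<Rightarrow> nat set \<Rightarrow> nat" where
  "below m H = (\<Sum>F\<in>Pow H - {{}}. Poly_Mapping.lookup m (XV F))"

text \<open>The dragon Hall--Rado condition, which decides whether the monomial \<open>m\<close> in the simplicial
  generators has degree 0 or 1.\<close>

definition hall_rado :: "nat \<Rightarrow> cmono \<Rightarrow> bool" where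
  "hall_rado \<epsilon> m \<longleftrightarrow> (\<forall>H\<in>Lp. below m H < rk H + \<epsilon>)"

text \<open>The condition consists of upper bounds only, so \<open>deg\<close> is one on monomials
  of lower degree too, for instance on \<open>1\<close>. What matters is which polynomials have all
  their multiples killed.\<close>

definition deg :: "nat \<Rightarrow> cpoly \<Rightarrow> rat" where
  "deg \<epsilon> = extend (\<lambda>c. c) (\<lambda>m. of_bool (hall_rado \<epsilon> m))"

text \<open>The radical of the pairing \<open>deg \<epsilon> (p * q)\<close>, that is, the largest
  ideal inside the kernel of \<open>deg\<close>.\<close>

definition Null :: "nat \<Rightarrow> cpoly set" where
  "Null \<epsilon> = {p. \<forall>q. deg \<epsilon> (p * q) = 0}"

abbreviation pt :: "nat set \<Rightarrow> cmono" where "pt F \<equiv> Poly_Mapping.single (XV F) 1"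

lemma deg_add: "deg \<epsilon> (p + q) = deg \<epsilon> p + deg \<epsilon> q"
  unfolding deg_def by (rule extend_add) auto

lemma deg_single: "deg \<epsilon> (Poly_Mapping.single m c) = c * of_bool (hall_rado \<epsilon> m)"
  unfolding deg_def by (rule extend_single) simp

lemma deg_mono: "deg \<epsilon> (mono m) = of_bool (hall_rado \<epsilon> m)"
  unfolding mono_def deg_single by simp

lemma deg_scale: "deg \<epsilon> (Poly_Mapping.single 0 r * p) = r * deg \<epsilon> p"
  by (rule additive_eqI[where F = "\<lambda>p. deg \<epsilon> (Poly_Mapping.single 0 r * p)" and G = "\<lambda>p. r * deg \<epsilon> p"])
    (simp_all add: distrib_left deg_add mult_single deg_single)

lemma deg_minus: "deg \<epsilon> (- p) = - deg \<epsilon> p"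
  using deg_add[of \<epsilon> p "-p"] deg_single[of \<epsilon> 0 0] by simp

lemma deg_diff: "deg \<epsilon> (p - q) = deg \<epsilon> p - deg \<epsilon> q"
  using deg_add[of \<epsilon> p "-q"] by (simp add: deg_minus)

lemma Null_I:
  assumes "\<And>m. deg \<epsilon> (p * mono m) = 0" shows "p \<in> Null \<epsilon>"
proof -
  have "deg \<epsilon> (p * q) = 0" for q
  proof -
    have "deg \<epsilon> (p * Poly_Mapping.single m c) = 0" for m c
    proof -
      have "p * Poly_Mapping.single m c = Poly_Mapping.single 0 c * (p * mono m)"
        by (subst single_eq_const_mono) (simp only: mult_ac)
      then show ?thesis using assms[of m] deg_scale[of \<epsilon> c "p * mono m"] by simp
    qed
    then show ?thesis
      by (rule additive_eqI[where F = "\<lambda>q. deg \<epsilon> (p * q)" and G = "\<lambda>_. 0", rotated 2])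
        (simp_all add: distrib_left deg_add)
  qed
  then show ?thesis unfolding Null_def by blast
qed

lemma below_add: "below (m + m') H = below m H + below m' H"
  unfolding below_def by (simp add: lookup_add sum.distrib)

lemma below_single:
  assumes H: "H \<in> Lp" and F: "F \<noteq> {}"
  shows "below (Poly_Mapping.single (XV F) n) H = n * of_bool (F \<subseteq> H)"
proof -
  have "below (Poly_Mapping.single (XV F) n) H = (\<Sum>G\<in>Pow H - {{}}. if F = G then n else 0)"
    unfolding below_def by (rule sum.cong) (auto simp: lookup_single)
  then show ?thesis using finite_in_Lp[OF H] F by simp
qed

lemma below_mono: "H \<subseteq> K \<Longrightarrow> finite K \<Longrightarrow> below m H \<le> below m K"
  unfolding below_def by (rule sum_mono2) auto

lemma below_supermodular:
  assumes "finite H" "finite K"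
  shows "below m H + below m K \<le> below m (H \<union> K) + below m (H \<inter> K)"
proof -
  let ?f = "\<lambda>F. Poly_Mapping.lookup m (XV F)"
  have "below m H + below m K = sum ?f ((Pow H - {{}}) \<union> (Pow K - {{}})) + sum ?f ((Pow H - {{}}) \<inter> (Pow K - {{}}))"
    unfolding below_def using assms by (intro sum.union_inter[symmetric]) auto
  moreover have "sum ?f ((Pow H - {{}}) \<union> (Pow K - {{}})) \<le> below m (H \<union> K)"
    unfolding below_def using assms by (intro sum_mono2) auto
  moreover have "(Pow H - {{}}) \<inter> (Pow K - {{}}) = Pow (H \<inter> K) - {{}}" by blast
  ultimately show ?thesis unfolding below_def by simp
qed

text \<open>The slack \<open>rk H + \<epsilon> - below m H\<close> is submodular, equals one at
  \<open>H1\<close> and \<open>H2\<close>, and is nonnegative at their intersection; so it is at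
  most two at the join.\<close>

lemma tight_join:
  assumes H: "H1 \<in> Lp" "H2 \<in> Lp" and hr: "hall_rado \<epsilon> m"
    and tight: "below m H1 + 1 = rk H1 + \<epsilon>" "below m H2 + 1 = rk H2 + \<epsilon>"
  shows "rk (cl (H1 \<union> H2)) + \<epsilon> \<le> below m (cl (H1 \<union> H2)) + 2"
proof -
  have sub: "H1 \<union> H2 \<subseteq> E" using H Lp_subset by blast
  have fin: "finite (cl (H1 \<union> H2))" using finite_in_Lp cl_Lp[OF sub] H by blast
  have "below m (H1 \<union> H2) \<le> below m (cl (H1 \<union> H2))" by (rule below_mono[OF subset_closure[OF sub] fin])
  moreover have "below m H1 + below m H2 \<le> below m (H1 \<union> H2) + below m (H1 \<inter> H2)"
    using finite_in_Lp H by (intro below_supermodular) auto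
  moreover have "rk (H1 \<union> H2) + rk (H1 \<inter> H2) \<le> rk H1 + rk H2" by (rule mrank_submodular[OF M])
  moreover have "below m (H1 \<inter> H2) \<le> rk (H1 \<inter> H2) + \<epsilon>"
  proof (cases "H1 \<inter> H2 = {}")
    case True
    then show ?thesis by (simp add: below_def)
  next
    case False
    then have "H1 \<inter> H2 \<in> Lp" using flats_Int[OF M] H by blast
    then show ?thesis using hr unfolding hall_rado_def by (simp add: less_imp_le)
  qed
  ultimately show ?thesis using tight rk_cl[OF sub] by simp
qed

text \<open>Tight flats above \<open>F\<close> and above \<open>G\<close> have a join with slack at
  most two by \<open>tight_join\<close>, which leaves no room for two factors
  \<open>K\<close>.\<close>

lemma four_term:
  assumes F: "F \<in> Lp" and G: "G \<in> Lp"
  defines "K \<equiv> cl (F \<union> G)"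
  shows "(var (XV F) - var (XV K)) * (var (XV G) - var (XV K)) \<in> Null \<epsilon>"
proof (rule Null_I)
  fix t
  have sub: "F \<union> G \<subseteq> E" using F G Lp_subset by blast
  have K: "K \<in> Lp" unfolding K_def using cl_Lp[OF sub] F by blast
  have Kiff: "K \<subseteq> H \<longleftrightarrow> F \<subseteq> H \<and> G \<subseteq> H" if "H \<in> Lp" for H
    unfolding K_def using cl_subset_iff[OF sub that] by blast
  have hr: "hall_rado \<epsilon> (t + pt A + pt B) \<longleftrightarrow>
      (\<forall>H\<in>Lp. below t H + of_bool (A \<subseteq> H) + of_bool (B \<subseteq> H) < rk H + \<epsilon>)" if "A \<in> Lp" "B \<in> Lp" for A B
    unfolding hall_rado_def using that by (simp add: below_add below_single)
  \<comment> \<open>\<open>a\<close> and \<open>b\<close> say that no flat above \<open>F\<close>,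
    respectively \<open>G\<close>, is tight, and \<open>k\<close> admits two factors
    \<open>K\<close> next to \<open>t\<close>. The four products have values
    \<open>a \<and> b \<and> k\<close>, \<open>a \<and> k\<close>, \<open>b \<and> k\<close> and
    \<open>k\<close>, so their alternating sum is nonzero only if \<open>k\<close> holds while both
    \<open>a\<close> and \<open>b\<close> fail.\<close>
  define a where "a \<longleftrightarrow> (\<forall>H\<in>Lp. F \<subseteq> H \<longrightarrow> below t H + 1 < rk H + \<epsilon>)"
  define b where "b \<longleftrightarrow> (\<forall>H\<in>Lp. G \<subseteq> H \<longrightarrow> below t H + 1 < rk H + \<epsilon>)"
  define k where "k \<longleftrightarrow> (\<forall>H\<in>Lp. below t H + 2 * of_bool (K \<subseteq> H) < rk H + \<epsilon>)"
  have KK: "hall_rado \<epsilon> (t + pt K + pt K) \<longleftrightarrow> k" unfolding hr[OF K K] k_def by (simp add: algebra_simps)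
  have kD: "below t H < rk H + \<epsilon>" "K \<subseteq> H \<Longrightarrow> below t H + 2 < rk H + \<epsilon>" if "k" "H \<in> Lp" for H
  proof -
    have *: "below t H + 2 * of_bool (K \<subseteq> H) < rk H + \<epsilon>" using that unfolding k_def by blast
    show "below t H < rk H + \<epsilon>" using * by linarith
    show "below t H + 2 < rk H + \<epsilon>" if "K \<subseteq> H" using * that by simp
  qed
  have FK: "hall_rado \<epsilon> (t + pt F + pt K) \<longleftrightarrow> a \<and> k" unfolding hr[OF F K]
  proof (intro iffI conjI ballI)
    assume L: "\<forall>H\<in>Lp. below t H + of_bool (F \<subseteq> H) + of_bool (K \<subseteq> H) < rk H + \<epsilon>"
    show a unfolding a_def
    proof (intro ballI impI)
      fix H assume "H \<in> Lp" "F \<subseteq> H"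
      then show "below t H + 1 < rk H + \<epsilon>" using L[rule_format, of H] by simp
    qed
    show k unfolding k_def
    proof
      fix H assume H: "H \<in> Lp"
      show "below t H + 2 * of_bool (K \<subseteq> H) < rk H + \<epsilon>"
        using L[rule_format, OF H] Kiff[OF H] by (cases "K \<subseteq> H") auto
    qed
  next
    fix H assume "a \<and> k" "H \<in> Lp"
    then show "below t H + of_bool (F \<subseteq> H) + of_bool (K \<subseteq> H) < rk H + \<epsilon>"
      using kD[of H] Kiff[of H] unfolding a_def by (cases "F \<subseteq> H"; cases "K \<subseteq> H") auto
  qed
  have GK: "hall_rado \<epsilon> (t + pt G + pt K) \<longleftrightarrow> b \<and> k" unfolding hr[OF G K]
  proof (intro iffI conjI ballI)
    assume L: "\<forall>H\<in>Lp. below t H + of_bool (G \<subseteq> H) + of_bool (K \<subseteq> H) < rk H + \<epsilon>"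
    show b unfolding b_def
    proof (intro ballI impI)
      fix H assume "H \<in> Lp" "G \<subseteq> H"
      then show "below t H + 1 < rk H + \<epsilon>" using L[rule_format, of H] by simp
    qed
    show k unfolding k_def
    proof
      fix H assume H: "H \<in> Lp"
      show "below t H + 2 * of_bool (K \<subseteq> H) < rk H + \<epsilon>"
        using L[rule_format, OF H] Kiff[OF H] by (cases "K \<subseteq> H") auto
    qed
  next
    fix H assume "b \<and> k" "H \<in> Lp"
    then show "below t H + of_bool (G \<subseteq> H) + of_bool (K \<subseteq> H) < rk H + \<epsilon>"
      using kD[of H] Kiff[of H] unfolding b_def by (cases "G \<subseteq> H"; cases "K \<subseteq> H") auto
  qed
  have FG: "hall_rado \<epsilon> (t + pt F + pt G) \<longleftrightarrow> a \<and> b \<and> k" unfolding hr[OF F G]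
  proof (intro iffI conjI ballI)
    assume L: "\<forall>H\<in>Lp. below t H + of_bool (F \<subseteq> H) + of_bool (G \<subseteq> H) < rk H + \<epsilon>"
    show a unfolding a_def
    proof (intro ballI impI)
      fix H assume "H \<in> Lp" "F \<subseteq> H"
      then show "below t H + 1 < rk H + \<epsilon>" using L[rule_format, of H] by simp
    qed
    show b unfolding b_def
    proof (intro ballI impI)
      fix H assume "H \<in> Lp" "G \<subseteq> H"
      then show "below t H + 1 < rk H + \<epsilon>" using L[rule_format, of H] by simp
    qed
    show k unfolding k_def
    proof
      fix H assume H: "H \<in> Lp"
      show "below t H + 2 * of_bool (K \<subseteq> H) < rk H + \<epsilon>"
        using L[rule_format, OF H] Kiff[OF H] by (cases "K \<subseteq> H") auto
    qed
  next
    fix H assume "a \<and> b \<and> k" "H \<in> Lp"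
    then show "below t H + of_bool (F \<subseteq> H) + of_bool (G \<subseteq> H) < rk H + \<epsilon>"
      using kD[of H] Kiff[of H] unfolding a_def b_def by (cases "F \<subseteq> H"; cases "G \<subseteq> H") auto
  qed
  have ab: "a \<or> b" if k
  proof (rule ccontr)
    assume "\<not> (a \<or> b)"
    then obtain H1 H2 where H: "H1 \<in> Lp" "F \<subseteq> H1" "\<not> below t H1 + 1 < rk H1 + \<epsilon>"
      "H2 \<in> Lp" "G \<subseteq> H2" "\<not> below t H2 + 1 < rk H2 + \<epsilon>" unfolding a_def b_def by blast
    have hrt: "hall_rado \<epsilon> t" unfolding hall_rado_def using kD(1)[OF that] by blast
    have tight: "below t H1 + 1 = rk H1 + \<epsilon>" "below t H2 + 1 = rk H2 + \<epsilon>"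
      using H kD(1)[OF that] by (metis Suc_eq_plus1 Suc_lessI)+
    have sub': "H1 \<union> H2 \<subseteq> E" using H Lp_subset by blast
    have "H1 \<union> H2 \<noteq> {}" using H(1) by blast
    then have L: "cl (H1 \<union> H2) \<in> Lp" using cl_Lp[OF sub'] by blast
    have "K \<subseteq> cl (H1 \<union> H2)" using Kiff[OF L] H(2,5) subset_closure[OF sub'] by blast
    then show False using kD(2)[OF that L] tight_join[OF H(1,4) hrt tight] by simp
  qed
  have eq: "(var (XV F) - var (XV K)) * (var (XV G) - var (XV K)) * mono t
     = mono (t + pt F + pt G) - mono (t + pt F + pt K) - mono (t + pt G + pt K) + mono (t + pt K + pt K)"
    unfolding var_def by (simp add: mono_add algebra_simps)
  show "deg \<epsilon> ((var (XV F) - var (XV K)) * (var (XV G) - var (XV K)) * mono t) = 0"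
    unfolding eq deg_add deg_diff deg_mono KK FK GK FG using ab by auto
qed

text \<open>At a flat \<open>H\<close> containing \<open>F\<close> but not \<open>i\<close>, the
  bound for \<open>F\<close> follows from the bound for the join at the closure of
  \<open>insert i H\<close>: the rank grows by one, and the atom of \<open>i\<close> uses up this
  one.\<close>

lemma atom_absorb:
  assumes F: "F \<in> Lp" and i: "i \<in> E - F"
  shows "var (XV (cl {i})) * (var (XV F) - var (XV (cl (insert i F)))) \<in> Null \<epsilon>"
proof (rule Null_I)
  fix t
  define A where "A = cl {i}"
  define K where "K = cl (insert i F)"
  have sub: "{i} \<subseteq> E" "insert i F \<subseteq> E" using i Lp_subset[OF F] by auto
  have A: "A \<in> Lp" and K: "K \<in> Lp" unfolding A_def K_def using cl_Lp sub by blast+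
  have Aiff: "A \<subseteq> H \<longleftrightarrow> i \<in> H" and Kiff: "K \<subseteq> H \<longleftrightarrow> i \<in> H \<and> F \<subseteq> H" if "H \<in> Lp" for H
    unfolding A_def K_def using cl_subset_iff[OF sub(1) that] cl_subset_iff[OF sub(2) that] by auto
  have hr: "hall_rado \<epsilon> (t + pt A + pt B) \<longleftrightarrow>
      (\<forall>H\<in>Lp. below t H + of_bool (i \<in> H) + of_bool (B \<subseteq> H) < rk H + \<epsilon>)" if "B \<in> Lp" for B
    unfolding hall_rado_def using that A by (simp add: below_add below_single Aiff)
  have "hall_rado \<epsilon> (t + pt A + pt F) \<longleftrightarrow> hall_rado \<epsilon> (t + pt A + pt K)"
    unfolding hr[OF F] hr[OF K]
  proof (intro iffI ballI)
    fix H assume "\<forall>H\<in>Lp. below t H + of_bool (i \<in> H) + of_bool (F \<subseteq> H) < rk H + \<epsilon>" and H: "H \<in> Lp"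
    then have "below t H + of_bool (i \<in> H) + of_bool (F \<subseteq> H) < rk H + \<epsilon>" by blast
    then show "below t H + of_bool (i \<in> H) + of_bool (K \<subseteq> H) < rk H + \<epsilon>"
      using Kiff[OF H] by (cases "F \<subseteq> H"; cases "i \<in> H") auto
  next
    fix H assume L: "\<forall>H\<in>Lp. below t H + of_bool (i \<in> H) + of_bool (K \<subseteq> H) < rk H + \<epsilon>" and H: "H \<in> Lp"
    have LH: "below t H + of_bool (i \<in> H) + of_bool (K \<subseteq> H) < rk H + \<epsilon>" using L H by blast
    show "below t H + of_bool (i \<in> H) + of_bool (F \<subseteq> H) < rk H + \<epsilon>"
    proof (cases "F \<subseteq> H \<and> i \<notin> H")
      case True
      let ?K = "cl (insert i H)"
      have iH: "i \<in> E - H" and sub': "insert i H \<subseteq> E" using True i Lp_subset[OF H] by auto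
      have K': "?K \<in> Lp" using cl_Lp[OF sub'] by blast
      have rkK': "rk ?K = Suc (rk H)" using rk_cl_insert[of H i] H iH by blast
      have le: "insert i H \<subseteq> ?K" by (rule subset_closure[OF sub'])
      have "below t H \<le> below t ?K" using le finite_in_Lp[OF K'] by (intro below_mono) auto
      moreover have "i \<in> ?K" "K \<subseteq> ?K" using le True Kiff[OF K'] by auto
      moreover have "below t ?K + of_bool (i \<in> ?K) + of_bool (K \<subseteq> ?K) < rk ?K + \<epsilon>" using L K' by blast
      ultimately show ?thesis using rkK' True by simp
    qed (use LH Kiff[OF H] in auto)
  qed
  moreover have "var (XV A) * (var (XV F) - var (XV K)) * mono t = mono (t + pt A + pt F) - mono (t + pt A + pt K)"
    unfolding var_def by (simp add: mono_add algebra_simps)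
  ultimately show "deg \<epsilon> (var (XV (cl {i})) * (var (XV F) - var (XV (cl (insert i F)))) * mono t) = 0"
    unfolding A_def[symmetric] K_def[symmetric] by (simp add: deg_diff deg_mono)
qed

lemma var_power: "var v ^ n = mono (Poly_Mapping.single v n)"
  unfolding var_def by (induction n) (simp_all add: mono_0 mono_add[symmetric] single_add[symmetric])

lemma atom_power_Null:
  assumes i: "i \<in> E" shows "var (XV (cl {i})) ^ Suc \<epsilon> \<in> Null \<epsilon>"
proof (rule Null_I)
  fix t
  have A: "cl {i} \<in> Lp" using i cl_Lp by blast
  have "rk (cl {i}) = 1" using rk_cl_insert[OF empty_flat, of i] i mrank_empty[OF M] by simp
  then have "\<not> below (Poly_Mapping.single (XV (cl {i})) (Suc \<epsilon>) + t) (cl {i}) < rk (cl {i}) + \<epsilon>"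
    using A by (simp add: below_add below_single)
  then have "\<not> hall_rado \<epsilon> (Poly_Mapping.single (XV (cl {i})) (Suc \<epsilon>) + t)"
    unfolding hall_rado_def using A by blast
  then show "deg \<epsilon> (var (XV (cl {i})) ^ Suc \<epsilon> * mono t) = 0"
    unfolding var_power mono_add[symmetric] deg_mono by simp
qed

lemma deg_socle: "deg \<epsilon> (var (XV E) ^ (rk E + \<epsilon> - 1)) = 1"
proof -
  have "hall_rado \<epsilon> (Poly_Mapping.single (XV E) (rk E + \<epsilon> - 1))" unfolding hall_rado_def
  proof
    fix H assume H: "H \<in> Lp"
    have "rk H = rk E" if "E \<subseteq> H" using that Lp_subset[OF H] by (metis subset_antisym)
    then show "below (Poly_Mapping.single (XV E) (rk E + \<epsilon> - 1)) H < rk H + \<epsilon>"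
      using H nonempty rk_pos[OF H] rk_E_pos by (simp add: below_single)
  qed
  then show ?thesis unfolding var_power deg_mono by simp
qed

text \<open>The flat variables come from the simplicial generators by Moebius inversion. The
  products in \<open>four_term\<close> and \<open>atom_absorb\<close> then expand into products of
  flat variables, of which only the wanted one is not settled by induction from larger to smaller
  flats.\<close>

lemma target_ring:
  assumes eps: "\<epsilon> \<le> 1"
  shows "\<exists>x. chow_ring E Bs \<epsilon> (Null \<epsilon>) x \<and> x E = var (XV E)"
proof -
  obtain x where x: "\<And>F. F \<in> Lp \<Longrightarrow> var (XV F) = (\<Sum>H\<in>{H\<in>Lp. F \<subseteq> H}. x H)"
    using exists_moebius[OF finite_Lp, of "\<lambda>F. var (XV F)"] by metis
  have up: "finite {H\<in>Lp. P H}" for P using finite_Lp by simp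
  have zero: "0 \<in> Null \<epsilon>" unfolding Null_def using deg_single[of \<epsilon> 0 0] by simp
  have add: "a + b \<in> Null \<epsilon>" if "a \<in> Null \<epsilon>" "b \<in> Null \<epsilon>" for a b
    using that unfolding Null_def by (simp add: distrib_right deg_add)
  have mult: "r * a \<in> Null \<epsilon>" if a: "a \<in> Null \<epsilon>" for a r
  proof -
    have "deg \<epsilon> (r * a * q) = 0" for q
    proof -
      have eq: "r * a * q = a * (r * q)" by (simp only: mult_ac)
      show ?thesis unfolding eq using a unfolding Null_def by blast
    qed
    then show ?thesis unfolding Null_def by blast
  qed
  have sum: "sum f I \<in> Null \<epsilon>" if "\<And>i. i \<in> I \<Longrightarrow> f i \<in> Null \<epsilon>" for f and I :: "'i set"
    using that by (induction I rule: infinite_finite_induct) (auto simp: zero add)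
  have transfer: "a \<in> Null \<epsilon>" if "a + b \<in> Null \<epsilon>" "b \<in> Null \<epsilon>" for a b
    using add[OF that(1) mult[OF that(2), of "-1"]] by simp
  have diff: "var (XV F) - var (XV (cl (F \<union> G))) = (\<Sum>H\<in>{H\<in>Lp. F \<subseteq> H \<and> \<not> G \<subseteq> H}. x H)"
    if F: "F \<in> Lp" and G: "G \<subseteq> E" for F G
  proof -
    have sub: "F \<union> G \<subseteq> E" using F G Lp_subset by blast
    have K: "cl (F \<union> G) \<in> Lp" using cl_Lp[OF sub] F by blast
    have "{H\<in>Lp. F \<subseteq> H} = {H\<in>Lp. cl (F \<union> G) \<subseteq> H} \<union> {H\<in>Lp. F \<subseteq> H \<and> \<not> G \<subseteq> H}"
      using cl_subset_iff[OF sub] by blast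
    moreover have "{H\<in>Lp. cl (F \<union> G) \<subseteq> H} \<inter> {H\<in>Lp. F \<subseteq> H \<and> \<not> G \<subseteq> H} = {}"
      using cl_subset_iff[OF sub] by blast
    ultimately show ?thesis unfolding x[OF F] x[OF K] using up by (simp add: sum.union_disjoint)
  qed
  have atom: "(\<Sum>H\<in>{H\<in>Lp. i \<in> H}. x H) = var (XV (cl {i}))" if i: "i \<in> E" for i
  proof -
    have sub: "{i} \<subseteq> E" using i by blast
    have "{H\<in>Lp. i \<in> H} = {H\<in>Lp. cl {i} \<subseteq> H}" using cl_subset_iff[OF sub] by blast
    then show ?thesis using x[of "cl {i}"] cl_Lp[OF sub] by simp
  qed
  have incomp: "x F * x G \<in> Null \<epsilon>" if "F \<in> Lp" "G \<in> Lp" "\<not> F \<subseteq> G" "\<not> G \<subseteq> F" for F G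
    using that
  proof (induction "(card E - card F) + (card E - card G)" arbitrary: F G rule: less_induct)
    case less
    define U where "U = {H\<in>Lp. F \<subseteq> H \<and> \<not> G \<subseteq> H}"
    define V where "V = {H\<in>Lp. G \<subseteq> H \<and> \<not> F \<subseteq> H}"
    have U: "F \<in> U" "finite U" and V: "G \<in> V" "finite V" unfolding U_def V_def using less.prems up by auto
    have smaller: "card E - card H \<le> card E - card K" "H \<noteq> K \<Longrightarrow> card E - card H < card E - card K"
      if "K \<in> Lp" "H \<in> Lp" "K \<subseteq> H" for K H
    proof -
      have c: "card K \<le> card H" "card H \<le> card E" "H \<noteq> K \<Longrightarrow> card K < card H"
        using that finite_in_Lp[OF that(2)] Lp_subset[OF that(2)] matroidD(1)[OF M]
        by (auto intro!: card_mono psubset_card_mono)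
      show "card E - card H \<le> card E - card K" "H \<noteq> K \<Longrightarrow> card E - card H < card E - card K"
        using c by auto
    qed
    have rest: "x H * x K \<in> Null \<epsilon>" if H: "H \<in> U" "K \<in> V" "(H, K) \<noteq> (F, G)" for H K
    proof (rule less.hyps)
      have HL: "H \<in> Lp" "F \<subseteq> H" "\<not> G \<subseteq> H" "K \<in> Lp" "G \<subseteq> K" "\<not> F \<subseteq> K"
        using H(1,2) unfolding U_def V_def by auto
      then show "H \<in> Lp" "K \<in> Lp" "\<not> H \<subseteq> K" "\<not> K \<subseteq> H" by blast+
      show "card E - card H + (card E - card K) < card E - card F + (card E - card G)"
        using smaller[OF less.prems(1) HL(1,2)] smaller[OF less.prems(2) HL(4,5)] H(3)
        by (cases "H = F") (auto intro: add_le_less_mono add_less_le_mono)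
    qed
    have FG: "F \<union> G = G \<union> F" by blast
    have "sum x U = var (XV F) - var (XV (cl (F \<union> G)))" "sum x V = var (XV G) - var (XV (cl (F \<union> G)))"
      unfolding U_def V_def
      using diff[OF less.prems(1) Lp_subset[OF less.prems(2)]]
        diff[OF less.prems(2) Lp_subset[OF less.prems(1)]] FG by simp_all
    then have "sum x U * sum x V \<in> Null \<epsilon>" using four_term[OF less.prems(1,2)] by simp
    also have "sum x U * sum x V = x F * x G + (x F * sum x (V - {G}) + sum x (U - {F}) * sum x V)"
      using sum.remove[OF U(2,1), of x] sum.remove[OF V(2,1), of x] by (simp add: algebra_simps)
    finally have tot: "x F * x G + (x F * sum x (V - {G}) + sum x (U - {F}) * sum x V) \<in> Null \<epsilon>" .
    moreover have "x F * sum x (V - {G}) \<in> Null \<epsilon>"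
      unfolding sum_distrib_left using U rest by (intro sum) auto
    moreover have "sum x (U - {F}) * sum x V \<in> Null \<epsilon>"
      unfolding sum_product using rest by (intro sum) auto
    ultimately show ?case using transfer add by blast
  qed
  have out: "x G * (\<Sum>H\<in>{H\<in>Lp. i \<in> H}. x H) \<in> Null \<epsilon>" if "G \<in> Lp" "i \<in> E - G" for G i
    using that
  proof (induction "card E - card G" arbitrary: G rule: less_induct)
    case less
    define U where "U = {H\<in>Lp. G \<subseteq> H \<and> \<not> {i} \<subseteq> H}"
    have U: "G \<in> U" "finite U" unfolding U_def using less.prems up by auto
    have iE: "i \<in> E" "{i} \<subseteq> E" using less.prems by auto
    have "sum x U = var (XV G) - var (XV (cl (insert i G)))"
      unfolding U_def using diff[OF less.prems(1) iE(2)] by simp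
    then have tot: "sum x U * var (XV (cl {i})) \<in> Null \<epsilon>"
      using atom_absorb[OF less.prems] by (simp only: mult.commute)
    have "x H * var (XV (cl {i})) \<in> Null \<epsilon>" if H: "H \<in> U - {G}" for H
    proof -
      have HL: "H \<in> Lp" "G \<subset> H" "i \<in> E - H" using H iE unfolding U_def by auto
      have "card G < card H" "card H \<le> card E"
        using HL finite_in_Lp[OF HL(1)] Lp_subset[OF HL(1)] matroidD(1)[OF M] by (auto intro!: card_mono psubset_card_mono)
      then have "card E - card H < card E - card G" by simp
      from less.hyps[OF this HL(1,3)] show ?thesis unfolding atom[OF iE(1)] .
    qed
    then have "sum x (U - {G}) * var (XV (cl {i})) \<in> Null \<epsilon>" unfolding sum_distrib_right by (rule sum)
    moreover have "sum x U * var (XV (cl {i})) = x G * var (XV (cl {i})) + sum x (U - {G}) * var (XV (cl {i}))"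
      using sum.remove[OF U(2,1), of x] by (simp add: algebra_simps)
    ultimately show ?case using transfer tot unfolding atom[OF iE(1)] by metis
  qed
  have "chow_ring E Bs \<epsilon> (Null \<epsilon>) x"
  proof (unfold_locales)
    show "(\<Sum>H\<in>{H\<in>Lp. i \<in> H}. x H) ^ Suc \<epsilon> \<in> Null \<epsilon>" if "i \<in> E" for i
      unfolding atom[OF that] by (rule atom_power_Null[OF that])
  qed (use zero add mult incomp out eps in auto)
  moreover have "{H\<in>Lp. E \<subseteq> H} = {E}" using E_Lp Lp_subset by blast
  then have "x E = var (XV E)" using x[OF E_Lp] by simp
  ultimately show ?thesis by blast
qed

end

section \<open>Graded quotients\<close>

lemma lookup_qscale: "Poly_Mapping.lookup (qscale c p) m = c * Poly_Mapping.lookup p m"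
  unfolding qscale_def by (simp add: Poly_Mapping.map.rep_eq when_def)

lemma qscale_eq: "qscale c p = Poly_Mapping.single 0 c * p"
  unfolding qscale_def by (rule mult_map_scale_conv_mult)

interpretation qv: vector_space qscale
  by unfold_locales (auto intro!: poly_mapping_eqI simp: lookup_qscale lookup_add algebra_simps)

lemma keys_plus_nat:
  fixes m m' :: cmono shows "Poly_Mapping.keys (m + m') = Poly_Mapping.keys m \<union> Poly_Mapping.keys m'"
  by (auto simp: in_keys_iff lookup_add)

lemma mono_deg_add: "mono_deg (m + m') = mono_deg m + mono_deg m'"
proof -
  have *: "mono_deg n = (\<Sum>v\<in>Poly_Mapping.keys m \<union> Poly_Mapping.keys m'. Poly_Mapping.lookup n v)"
    if "Poly_Mapping.keys n \<subseteq> Poly_Mapping.keys m \<union> Poly_Mapping.keys m'" for n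
    unfolding mono_deg_def using that by (intro sum.mono_neutral_left) (auto simp: in_keys_iff)
  show ?thesis using *[of m] *[of m'] *[of "m + m'"] by (simp add: keys_plus_nat lookup_add sum.distrib)
qed

lemma monos_deg_add_iff:
  "m' + m \<in> monos_deg V d \<longleftrightarrow> Poly_Mapping.keys m' \<subseteq> V \<and> mono_deg m' \<le> d \<and> m \<in> monos_deg V (d - mono_deg m')"
  unfolding monos_deg_def by (auto simp: keys_plus_nat mono_deg_add)

lemma mono_deg_single [simp]: "mono_deg (Poly_Mapping.single v n) = n"
  unfolding mono_deg_def by simp

definition homog :: "cvar set \<Rightarrow> nat \<Rightarrow> cpoly set" where
  "homog V d = {p. Poly_Mapping.keys p \<subseteq> monos_deg V d}"

lemma homog_iff: "p \<in> homog V d \<longleftrightarrow> (\<forall>m. m \<notin> monos_deg V d \<longrightarrow> Poly_Mapping.lookup p m = 0)"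
  unfolding homog_def by (auto simp: in_keys_iff)

lemma subspace_homog: "qv.subspace (homog V d)"
  unfolding qv.subspace_def by (auto simp: homog_iff lookup_qscale lookup_add)

lemma homog_mult:
  assumes "p \<in> homog V d" "q \<in> homog V d'" shows "p * q \<in> homog V (d + d')"
proof -
  have "Poly_Mapping.keys (p * q) \<subseteq> {a + b | a b. a \<in> Poly_Mapping.keys p \<and> b \<in> Poly_Mapping.keys q}"
    by (rule keys_mult)
  also have "\<dots> \<subseteq> monos_deg V (d + d')"
  proof clarify
    fix a b assume "a \<in> Poly_Mapping.keys p" "b \<in> Poly_Mapping.keys q"
    then have "a \<in> monos_deg V d" "b \<in> monos_deg V d'" using assms unfolding homog_def by blast+
    then show "a + b \<in> monos_deg V (d + d')" unfolding monos_deg_def by (simp add: keys_plus_nat mono_deg_add)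
  qed
  finally show ?thesis unfolding homog_def by simp
qed

lemma homog_mono: "m \<in> monos_deg V d \<Longrightarrow> mono m \<in> homog V d"
  unfolding homog_def mono_def by simp

lemma homog_var: "v \<in> V \<Longrightarrow> var v \<in> homog V 1"
  unfolding var_def by (rule homog_mono) (simp add: monos_deg_def)

lemma homog_one: "1 \<in> homog V 0"
  unfolding homog_def monos_deg_def by (simp add: mono_deg_def)

lemma homog_diff: "p \<in> homog V d \<Longrightarrow> q \<in> homog V d \<Longrightarrow> p - q \<in> homog V d"
  by (rule qv.subspace_diff[OF subspace_homog])

lemma homog_sum: "(\<And>i. i \<in> I \<Longrightarrow> f i \<in> homog V d) \<Longrightarrow> sum f I \<in> homog V d"
  by (rule qv.subspace_sum[OF subspace_homog])

lemma homog_uminus: "p \<in> homog V d \<Longrightarrow> - p \<in> homog V d"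
  by (rule qv.subspace_neg[OF subspace_homog])

lemma homog_span: "homog V d = qv.span (mono ` monos_deg V d)"
proof
  show "qv.span (mono ` monos_deg V d) \<subseteq> homog V d"
    by (rule qv.span_minimal[OF _ subspace_homog]) (auto intro: homog_mono)
  show "homog V d \<subseteq> qv.span (mono ` monos_deg V d)"
  proof
    fix p assume p: "p \<in> homog V d"
    have eq: "p = (\<Sum>m\<in>Poly_Mapping.keys p. qscale (Poly_Mapping.lookup p m) (mono m))"
      unfolding qscale_eq single_eq_const_mono[symmetric] by (rule poly_mapping_sum_singles)
    have "(\<Sum>m\<in>Poly_Mapping.keys p. qscale (Poly_Mapping.lookup p m) (mono m)) \<in> qv.span (mono ` monos_deg V d)"
      using p unfolding homog_def by (intro qv.span_sum qv.span_scale qv.span_base) auto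
    then show "p \<in> qv.span (mono ` monos_deg V d)" using eq by simp
  qed
qed

lemma finite_monos_deg:
  assumes "finite V" shows "finite (monos_deg V d)"
proof (rule finite_subset)
  show "monos_deg V d \<subseteq> (\<lambda>f. Abs_poly_mapping (\<lambda>v. if v \<in> V then f v else 0)) ` (V \<rightarrow>\<^sub>E {..d})"
  proof
    fix m assume m: "m \<in> monos_deg V d"
    let ?f = "\<lambda>v. if v \<in> V then Poly_Mapping.lookup m v else undefined"
    have "Poly_Mapping.lookup m v \<le> d" for v
    proof (cases "v \<in> Poly_Mapping.keys m")
      case True
      then have "Poly_Mapping.lookup m v \<le> mono_deg m" unfolding mono_deg_def by (intro member_le_sum) auto
      then show ?thesis using m unfolding monos_deg_def by simp
    qed (simp add: in_keys_iff)
    then have f: "?f \<in> V \<rightarrow>\<^sub>E {..d}" by auto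
    have "(\<lambda>v. if v \<in> V then ?f v else 0) = Poly_Mapping.lookup m"
    proof
      fix v
      have "v \<notin> V \<Longrightarrow> v \<notin> Poly_Mapping.keys m" using m unfolding monos_deg_def by blast
      then show "(if v \<in> V then ?f v else 0) = Poly_Mapping.lookup m v" by (simp add: in_keys_iff)
    qed
    then have "m = Abs_poly_mapping (\<lambda>v. if v \<in> V then ?f v else 0)" by (simp only: lookup_inverse)
    then show "m \<in> (\<lambda>f. Abs_poly_mapping (\<lambda>v. if v \<in> V then f v else 0)) ` (V \<rightarrow>\<^sub>E {..d})"
      using f by (rule image_eqI)
  qed
  show "finite ((\<lambda>f. Abs_poly_mapping (\<lambda>v. if v \<in> V then f v else 0 :: nat)) ` (V \<rightarrow>\<^sub>E {..d}))"
    using assms by (intro finite_imageI finite_PiE) auto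
qed

section \<open>The ideal of homogeneous relations\<close>

definition rels :: "cvar set \<Rightarrow> (cpoly \<times> nat) set \<Rightarrow> nat \<Rightarrow> cpoly set" where
  "rels V G d = {mono m * g | m g e. (g, e) \<in> G \<and> e \<le> d \<and> m \<in> monos_deg V (d - e)}"

definition trunc :: "cvar set \<Rightarrow> nat \<Rightarrow> cpoly \<Rightarrow> cpoly" where
  "trunc V d = extend (Poly_Mapping.single 0) (\<lambda>m. if m \<in> monos_deg V d then mono m else 0)"

text \<open>The ideal generated by the relations \<open>G\<close> and by all variables outside \<open>V\<close>, described by its
  homogeneous components in the variables \<open>V\<close>.\<close>

definition rel_ideal :: "cvar set \<Rightarrow> (cpoly \<times> nat) set \<Rightarrow> cpoly set" where
  "rel_ideal V G = {p. \<forall>d. trunc V d p \<in> qv.span (rels V G d)}"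

lemma trunc_add: "trunc V d (p + q) = trunc V d p + trunc V d q"
  unfolding trunc_def by (rule extend_add) (simp_all add: single_add)

lemma trunc_single:
  "trunc V d (Poly_Mapping.single m c) = (if m \<in> monos_deg V d then Poly_Mapping.single m c else 0)"
  unfolding trunc_def by (subst extend_single) (auto simp: mono_def mult_single)

lemma trunc_zero: "trunc V d 0 = 0" unfolding trunc_def extend_def by simp

lemma trunc_homog:
  assumes "p \<in> homog V e" shows "trunc V d p = (if d = e then p else 0)"
proof -
  have "trunc V d p = (\<Sum>m\<in>Poly_Mapping.keys p. trunc V d (Poly_Mapping.single m (Poly_Mapping.lookup p m)))"
    by (subst poly_mapping_sum_singles) (rule additive_sum, rule trunc_add)
  also have "\<dots> = (\<Sum>m\<in>Poly_Mapping.keys p. if d = e then Poly_Mapping.single m (Poly_Mapping.lookup p m) else 0)"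
    using assms unfolding homog_def monos_deg_def by (intro sum.cong) (auto simp: trunc_single monos_deg_def)
  also have "\<dots> = (if d = e then p else 0)" using poly_mapping_sum_singles[of p] by simp
  finally show ?thesis .
qed

lemma trunc_single_mult:
  "trunc V d (Poly_Mapping.single m' c * p) =
    (if Poly_Mapping.keys m' \<subseteq> V \<and> mono_deg m' \<le> d
     then Poly_Mapping.single m' c * trunc V (d - mono_deg m') p else 0)" (is "_ = ?R p")
  by (rule additive_eqI[where F = "\<lambda>p. trunc V d (Poly_Mapping.single m' c * p)" and G = ?R])
    (auto simp: distrib_left trunc_add mult_single trunc_single monos_deg_add_iff)

lemma rels_mult:
  assumes "p \<in> qv.span (rels V G k)" "Poly_Mapping.keys m' \<subseteq> V" "k + mono_deg m' = d"
  shows "Poly_Mapping.single m' c * p \<in> qv.span (rels V G d)"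
  using assms(1)
proof (induction p rule: qv.span_induct_alt)
  case (step b p q)
  obtain m g e where p: "p = mono m * g" "(g, e) \<in> G" "e \<le> k" "m \<in> monos_deg V (k - e)"
    using step(1) unfolding rels_def by auto
  have "m' + m \<in> monos_deg V (d - e)" using p assms(2,3) unfolding monos_deg_def
    by (auto simp: keys_plus_nat mono_deg_add)
  then have "mono (m' + m) * g \<in> rels V G d" using p assms(3) unfolding rels_def
    by (auto intro!: exI[of _ "m' + m"] exI[of _ g] exI[of _ e])
  then have "qscale (b * c) (mono (m' + m) * g) \<in> qv.span (rels V G d)" by (intro qv.span_scale qv.span_base)
  also have "qscale (b * c) (mono (m' + m) * g) = Poly_Mapping.single m' c * qscale b p"
  proof -
    have eq: "Poly_Mapping.single 0 (b * c) = Poly_Mapping.single 0 b * (Poly_Mapping.single 0 c :: cpoly)"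
      by (simp add: mult_single)
    show ?thesis unfolding qscale_eq p(1) mono_add single_eq_const_mono[of m' c] eq by (simp only: mult_ac)
  qed
  finally show ?case using step(2) by (simp add: distrib_left qv.span_add)
qed (simp add: qv.span_zero)

lemma rel_ideal_zero: "0 \<in> rel_ideal V G"
  unfolding rel_ideal_def by (simp add: trunc_zero qv.span_zero)

lemma rel_ideal_add: "a \<in> rel_ideal V G \<Longrightarrow> b \<in> rel_ideal V G \<Longrightarrow> a + b \<in> rel_ideal V G"
  unfolding rel_ideal_def by (simp add: trunc_add qv.span_add)

lemma rel_ideal_mult:
  assumes a: "a \<in> rel_ideal V G" shows "r * a \<in> rel_ideal V G"
proof -
  have s: "Poly_Mapping.single m c * a \<in> rel_ideal V G" for m c
    using a unfolding rel_ideal_def by (auto simp: trunc_single_mult qv.span_zero intro!: rels_mult)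
  have "(\<Sum>m\<in>K. Poly_Mapping.single m (Poly_Mapping.lookup r m) * a) \<in> rel_ideal V G" for K
    by (induction K rule: infinite_finite_induct) (auto simp: rel_ideal_zero intro!: rel_ideal_add s)
  then have "(\<Sum>m\<in>Poly_Mapping.keys r. Poly_Mapping.single m (Poly_Mapping.lookup r m)) * a \<in> rel_ideal V G"
    by (simp only: sum_distrib_right)
  then show ?thesis by (simp only: poly_mapping_sum_singles[symmetric])
qed

lemma rel_ideal_gen:
  assumes "(g, e) \<in> G" "g \<in> homog V e" shows "g \<in> rel_ideal V G"
proof -
  have "mono 0 * g \<in> rels V G e" unfolding rels_def using assms(1)
    by (auto simp: monos_deg_def mono_deg_def intro!: exI[of _ "0::cmono"] exI[of _ g] exI[of _ e])
  then show ?thesis unfolding rel_ideal_def using trunc_homog[OF assms(2)]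
    by (simp add: mono_0 qv.span_zero qv.span_base)
qed

lemma rel_ideal_homog:
  assumes "p \<in> rel_ideal V G" "p \<in> homog V d" shows "p \<in> qv.span (rels V G d)"
  using assms trunc_homog[OF assms(2), of d] unfolding rel_ideal_def by (metis (mono_tags) mem_Collect_eq)

text \<open>A basis of the relation space is enlarged by the \<open>b i\<close> one at a time.
  Independence modulo relations keeps it independent, spanning modulo the ideal makes it a basis of
  all polynomials of degree \<open>d\<close>, and counting gives the difference.\<close>

lemma quot_dim_eq_card:
  fixes b :: "'i \<Rightarrow> cpoly"
  assumes V: "finite V" and G: "\<And>g e. (g, e) \<in> G \<Longrightarrow> g \<in> homog V e" and B: "finite B"
    and b: "\<And>i. i \<in> B \<Longrightarrow> b i \<in> homog V d"
    and span: "\<And>m. m \<in> monos_deg V d \<Longrightarrow> \<exists>s\<in>qv.span (b ` B). mono m - s \<in> rel_ideal V G"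
    and indep: "\<And>c. (\<Sum>i\<in>B. qscale (c i) (b i)) \<in> qv.span (rels V G d) \<Longrightarrow> \<forall>i\<in>B. c i = 0"
  shows "quot_dim V G d = card B"
proof -
  have R: "rels V G d \<subseteq> homog V d"
  proof
    fix p assume "p \<in> rels V G d"
    then obtain m g e where p: "p = mono m * g" "(g, e) \<in> G" "e \<le> d" "m \<in> monos_deg V (d - e)"
      unfolding rels_def by auto
    then show "p \<in> homog V d" using homog_mult[OF homog_mono[OF p(4)] G[OF p(2)]] by simp
  qed
  obtain C0 where C0: "C0 \<subseteq> rels V G d" "qv.independent C0" "rels V G d \<subseteq> qv.span C0" "card C0 = qv.dim (rels V G d)"
    using qv.basis_exists by blast
  have "C0 \<subseteq> qv.span (mono ` monos_deg V d)" using C0(1) R homog_span by blast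
  then have finC0: "finite C0"
    using qv.independent_span_bound[OF finite_imageI[OF finite_monos_deg[OF V]] C0(2)] by blast
  have spanC0: "qv.span C0 = qv.span (rels V G d)"
    using C0(1,3) qv.span_mono qv.span_minimal[OF C0(3) qv.subspace_span] by blast
  have "\<exists>C. finite C \<and> qv.independent C \<and> qv.span C = qv.span (rels V G d \<union> b ` B') \<and> card C = card C0 + card B'"
    if "B' \<subseteq> B" for B'
  proof -
    have "finite B'" using that B finite_subset by blast
    then show ?thesis using that
    proof (induction B' rule: finite_induct)
      case empty
      then show ?case using finC0 C0(2) spanC0 by (intro exI[of _ C0]) simp
    next
      case (insert i B')
      then obtain C where C: "finite C" "qv.independent C" "qv.span C = qv.span (rels V G d \<union> b ` B')"
        "card C = card C0 + card B'" by auto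
      have "b i \<notin> qv.span C"
      proof
        assume "b i \<in> qv.span C"
        then obtain r t where rt: "b i = r + t" "r \<in> qv.span (rels V G d)" "t \<in> qv.span (b ` B')"
          unfolding C(3) qv.span_Un by blast
        obtain u where u: "t = (\<Sum>j\<in>B'. qscale (u j) (b j))"
        proof -
          have "t \<in> {\<Sum>j\<in>B'. qscale (u j) (b j) | u. True}"
            using rt(3)
          proof (induction t rule: qv.span_induct_alt)
            case base
            show ?case by (auto intro!: exI[of _ "\<lambda>_. 0"])
          next
            case (step c x y)
            then obtain j u where ju: "j \<in> B'" "x = b j" "y = (\<Sum>j\<in>B'. qscale (u j) (b j))" by auto
            have "(\<Sum>k\<in>B'. qscale (u k + (if k = j then c else 0)) (b k)) =
                (\<Sum>k\<in>B'. qscale (u k) (b k)) + (\<Sum>k\<in>B'. if k = j then qscale c (b k) else 0)"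
              unfolding sum.distrib[symmetric] by (rule sum.cong) (auto simp: qv.scale_left_distrib)
            then have "qscale c x + y = (\<Sum>k\<in>B'. qscale (u k + (if k = j then c else 0)) (b k))"
              using ju insert.hyps(1) by simp
            then show ?case by (auto intro!: exI[of _ "\<lambda>k. u k + (if k = j then c else 0)"])
          qed
          then show ?thesis using that by blast
        qed
        \<comment> \<open>The dependence with coefficient one at \<open>i\<close>: its sum is a
          relation, against \<open>indep\<close>.\<close>
        define c where "c j = (if j = i then 1 else if j \<in> B' then - u j else 0)" for j
        have "(\<Sum>j\<in>B. qscale (c j) (b j)) = (\<Sum>j\<in>insert i B'. qscale (c j) (b j))"
          using insert.prems B by (intro sum.mono_neutral_right) (auto simp: c_def)
        also have "\<dots> = b i + (\<Sum>j\<in>B'. qscale (c j) (b j))" using insert.hyps by (simp add: c_def)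
        also have "(\<Sum>j\<in>B'. qscale (c j) (b j)) = (\<Sum>j\<in>B'. - qscale (u j) (b j))"
          using insert.hyps by (intro sum.cong) (auto simp: c_def)
        also have "b i + \<dots> = r" using rt(1) u by (simp add: sum_negf)
        finally have "\<forall>j\<in>B. c j = 0" using indep rt(2) by simp
        then show False using insert.prems by (auto simp: c_def)
      qed
      then have "qv.independent (insert (b i) C)" using C(2) by (simp add: qv.independent_insert)
      moreover have "b i \<notin> C" using \<open>b i \<notin> qv.span C\<close> qv.span_base by blast
      then have "card (insert (b i) C) = card C0 + card (insert i B')" using C insert.hyps by simp
      moreover have "qv.span (insert (b i) C) = qv.span (rels V G d \<union> b ` insert i B')"
      proof -
        have "qv.span (insert (b i) C) = qv.span (insert (b i) (rels V G d \<union> b ` B'))"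
          unfolding qv.span_insert C(3) ..
        then show ?thesis by simp
      qed
      ultimately show ?case using C(1) by blast
    qed
  qed
  from this[OF subset_refl] obtain C where C: "qv.independent C"
    "qv.span C = qv.span (rels V G d \<union> b ` B)" "card C = card C0 + card B" by blast
  have "qv.span (rels V G d \<union> b ` B) = qv.span (mono ` monos_deg V d)"
  proof
    show "qv.span (rels V G d \<union> b ` B) \<subseteq> qv.span (mono ` monos_deg V d)"
      unfolding homog_span[symmetric] using R b by (intro qv.span_minimal[OF _ subspace_homog]) auto
    show "qv.span (mono ` monos_deg V d) \<subseteq> qv.span (rels V G d \<union> b ` B)"
    proof (rule qv.span_minimal[OF _ qv.subspace_span], safe)
      fix m assume m: "m \<in> monos_deg V d"
      obtain s where s: "s \<in> qv.span (b ` B)" "mono m - s \<in> rel_ideal V G" using span[OF m] by blast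
      have "qv.span (b ` B) \<subseteq> homog V d" using b by (intro qv.span_minimal[OF _ subspace_homog]) auto
      then have "mono m - s \<in> homog V d" using s m homog_mono homog_diff by blast
      then have "mono m - s \<in> qv.span (rels V G d)" using s rel_ideal_homog by blast
      then have "mono m - s \<in> qv.span (rels V G d \<union> b ` B)" "s \<in> qv.span (rels V G d \<union> b ` B)"
        using s(1) qv.span_mono by blast+
      from qv.span_add[OF this] show "mono m \<in> qv.span (rels V G d \<union> b ` B)" by simp
    qed
  qed
  then have "qv.dim (mono ` monos_deg V d) = card C" using C qv.dim_eq_card by metis
  moreover have "qv.dim (rels V G d) = card C0" using C0(4) by simp
  ultimately show ?thesis using C(3) unfolding quot_dim_def qdim_def rels_def by simp
qed

section \<open>Evaluation homomorphisms\<close>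

definition eval_mono :: "(cvar \<Rightarrow> cpoly) \<Rightarrow> cmono \<Rightarrow> cpoly" where
  "eval_mono a m = (\<Prod>v\<in>Poly_Mapping.keys m. a v ^ Poly_Mapping.lookup m v)"

definition eval_poly :: "(cvar \<Rightarrow> cpoly) \<Rightarrow> cpoly \<Rightarrow> cpoly" where
  "eval_poly a = extend (Poly_Mapping.single 0) (eval_mono a)"

lemma eval_mono_add: "eval_mono a (m + m') = eval_mono a m * eval_mono a m'"
proof -
  have *: "eval_mono a n = (\<Prod>v\<in>Poly_Mapping.keys m \<union> Poly_Mapping.keys m'. a v ^ Poly_Mapping.lookup n v)"
    if "Poly_Mapping.keys n \<subseteq> Poly_Mapping.keys m \<union> Poly_Mapping.keys m'" for n
    unfolding eval_mono_def using that by (intro prod.mono_neutral_left) (auto simp: in_keys_iff)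
  show ?thesis using *[of m] *[of m'] *[of "m + m'"]
    by (simp add: keys_plus_nat lookup_add power_add prod.distrib)
qed

lemma eval_poly_add: "eval_poly a (p + q) = eval_poly a p + eval_poly a q"
  unfolding eval_poly_def by (rule extend_add) (simp_all add: single_add)

lemma eval_poly_single: "eval_poly a (Poly_Mapping.single m c) = Poly_Mapping.single 0 c * eval_mono a m"
  unfolding eval_poly_def by (rule extend_single) simp

lemma eval_poly_mult: "eval_poly a (p * q) = eval_poly a p * eval_poly a q"
proof -
  have "eval_poly a (Poly_Mapping.single m c * q) = eval_poly a (Poly_Mapping.single m c) * eval_poly a q" for m c
  proof (rule additive_eqI[where F = "\<lambda>q. eval_poly a (Poly_Mapping.single m c * q)"
        and G = "\<lambda>q. eval_poly a (Poly_Mapping.single m c) * eval_poly a q"])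
    fix m' c'
    have k: "Poly_Mapping.single 0 (c * c') = Poly_Mapping.single 0 c * (Poly_Mapping.single 0 c' :: cpoly)"
      by (simp add: mult_single)
    show "eval_poly a (Poly_Mapping.single m c * Poly_Mapping.single m' c') =
        eval_poly a (Poly_Mapping.single m c) * eval_poly a (Poly_Mapping.single m' c')"
      unfolding mult_single[of m c m' c'] eval_poly_single eval_mono_add k by (simp only: mult_ac)
  qed (simp_all add: distrib_left eval_poly_add)
  then show ?thesis
    by (rule additive_eqI[where F = "\<lambda>p. eval_poly a (p * q)" and G = "\<lambda>p. eval_poly a p * eval_poly a q", rotated 2])
      (simp_all add: distrib_right eval_poly_add)
qed

lemma eval_poly_one: "eval_poly a 1 = 1"
  using eval_poly_single[of a 0 1] by (simp add: eval_mono_def)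

lemma eval_poly_const: "eval_poly a (Poly_Mapping.single 0 c) = Poly_Mapping.single 0 c"
  unfolding eval_poly_single by (simp add: eval_mono_def)

lemma eval_poly_zero: "eval_poly a 0 = 0" unfolding eval_poly_def extend_def by simp

lemma eval_poly_var: "eval_poly a (var v) = a v"
  unfolding var_def mono_def eval_poly_single by (simp add: eval_mono_def)

lemma eval_poly_uminus: "eval_poly a (- p) = - eval_poly a p"
  using eval_poly_add[of a p "-p"] by (metis add.right_inverse eval_poly_zero minus_unique)

lemma eval_poly_diff: "eval_poly a (p - q) = eval_poly a p - eval_poly a q"
  using eval_poly_add[of a p "-q"] by (simp add: eval_poly_uminus)

lemma eval_poly_sum: "eval_poly a (sum f I) = (\<Sum>i\<in>I. eval_poly a (f i))"
  by (rule additive_sum) (rule eval_poly_add)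

section \<open>Hilbert functions of the Chow rings\<close>

context loopless_matroid begin

definition stds :: "nat \<Rightarrow> nat \<Rightarrow> nat set multiset set" where
  "stds \<epsilon> d = {m. std \<epsilon> m \<and> size m = d}"

end

lemma finite_multisets_of_size:
  assumes "finite A" shows "finite {m. set_mset m \<subseteq> A \<and> size m = d}"
proof (rule finite_subset)
  show "{m. set_mset m \<subseteq> A \<and> size m = d} \<subseteq> mset ` {xs. set xs \<subseteq> A \<and> length xs = d}"
  proof
    fix m assume m: "m \<in> {m. set_mset m \<subseteq> A \<and> size m = d}"
    obtain xs where "mset xs = m" using ex_mset by blast
    then show "m \<in> mset ` {xs. set xs \<subseteq> A \<and> length xs = d}" using m by (intro image_eqI[of _ _ xs]) auto
  qed
qed (use finite_lists_length_eq[OF assms] in auto)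

context loopless_matroid begin

lemma finite_stds: "finite (stds \<epsilon> d)"
  by (rule finite_subset[OF _ finite_multisets_of_size[OF finite_Lp, of d]])
    (auto simp: stds_def std_def chain_mset_def)

text \<open>Spanning is shown in the ring of the relations \<open>G\<close>, where
  \<open>vars\<close> expresses every variable through the flat variables \<open>x\<close>.
  Independence is shown modulo \<open>Null\<close>: the substitution \<open>a\<close> carries
  relations into \<open>Null\<close> and monomials in \<open>x\<close> to the same monomials in
  \<open>y\<close>.\<close>

lemma quot_dim_stds:
  assumes eps: "\<epsilon> \<le> 1" and V: "finite V" and G: "\<And>g e. (g, e) \<in> G \<Longrightarrow> g \<in> homog V e"
    and x: "chow_ring E Bs \<epsilon> (rel_ideal V G) x" and xh: "\<And>F. F \<in> Lp \<Longrightarrow> x F \<in> homog V 1"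
    and vars: "\<And>v. v \<in> V \<Longrightarrow> \<exists>A\<subseteq>Lp. var v - sum x A \<in> rel_ideal V G \<or> var v + sum x A \<in> rel_ideal V G"
    and y: "chow_ring E Bs \<epsilon> (Null \<epsilon>) y" "y E = var (XV E)"
    and rel: "\<And>g e. (g, e) \<in> G \<Longrightarrow> eval_poly a g \<in> Null \<epsilon>"
    and ax: "\<And>F. F \<in> Lp \<Longrightarrow> eval_poly a (x F) - y F \<in> Null \<epsilon>"
  shows "quot_dim V G d = card (stds \<epsilon> d)"
proof -
  interpret C: chow_ring E Bs \<epsilon> "rel_ideal V G" x by (rule x)
  interpret T: chow_ring E Bs \<epsilon> "Null \<epsilon>" y by (rule y(1))
  let ?J = "rel_ideal V G"
  show ?thesis
  proof (rule quot_dim_eq_card[where b = C.X])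
    show "C.X m \<in> homog V d" if "m \<in> stds \<epsilon> d" for m
    proof -
      have "set_mset m \<subseteq> Lp" "size m = d" using that unfolding stds_def std_def chain_mset_def by auto
      then show ?thesis
      proof (induction m arbitrary: d)
        case (add F m)
        then show ?case using homog_mult[OF xh[of F], of "C.X m" "size m"] by auto
      qed (simp add: homog_one)
    qed
    fix m assume "m \<in> monos_deg V d"
    define P where "P p \<longleftrightarrow> (\<exists>s\<in>qv.span (C.X ` stds \<epsilon> d). p - s \<in> ?J)" for p
    have PJ: "P p" if "p \<in> ?J" for p using that unfolding P_def by (intro bexI[of _ 0]) (auto simp: qv.span_zero)
    have Pd: "P (p - q)" if Pp: "P p" and Pq: "P q" for p q
    proof -
      obtain s t where s: "s \<in> qv.span (C.X ` stds \<epsilon> d)" "p - s \<in> ?J" and t: "t \<in> qv.span (C.X ` stds \<epsilon> d)" "q - t \<in> ?J"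
        using Pp Pq unfolding P_def by blast
      have "(p - q) - (s - t) \<in> ?J" using C.diff_J[OF s(2) t(2)] by (simp add: algebra_simps)
      then show ?thesis unfolding P_def using qv.span_diff[OF s(1) t(1)] by blast
    qed
    have P0: "P 0" using PJ C.zero_J by blast
    have Pn: "P (- p)" if "P p" for p using Pd[OF P0 that] by simp
    have Pa: "P (p + q)" if "P p" "P q" for p q using Pd[OF that(1) Pn[OF that(2)]] by simp
    have Ps: "P (sum f I)" if "\<And>i. i \<in> I \<Longrightarrow> P (f i)" for f and I :: "nat set set"
      using that by (induction I rule: infinite_finite_induct) (auto simp: P0 Pa)
    have PX: "P (C.X w)" if "set_mset w \<subseteq> Lp" "size w = d" for w
    proof (rule C.straighten[where P = P, OF PJ Pd _ that])
      fix m assume "std \<epsilon> m" "size m = d"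
      then have "m \<in> stds \<epsilon> d" by (simp add: stds_def)
      then show "P (C.X m)" unfolding P_def using C.zero_J by (intro bexI[of _ "C.X m"]) (auto intro: qv.span_base)
    qed
    \<comment> \<open>Variables of \<open>m\<close> are converted one at a time; \<open>w\<close>
      collects the flat variables produced so far.\<close>
    have "P (mono m * C.X w)" if "Poly_Mapping.keys m \<subseteq> V" "set_mset w \<subseteq> Lp" "mono_deg m + size w = d" for w
      using that
    proof (induction "mono_deg m" arbitrary: m w)
      case 0
      then have "m = 0" unfolding mono_deg_def by (auto intro!: poly_mapping_eqI simp: in_keys_iff)
      then show ?case using PX 0 by (simp add: mono_0 mono_deg_def)
    next
      case (Suc n)
      have "Poly_Mapping.keys m \<noteq> {}" using Suc(2) unfolding mono_deg_def by auto
      then obtain v where v: "v \<in> Poly_Mapping.keys m" by blast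
      define m' where "m' = m - Poly_Mapping.single v 1"
      have mm: "m = m' + Poly_Mapping.single v 1"
        using v unfolding m'_def
        by (intro poly_mapping_eqI) (auto simp: lookup_add lookup_minus lookup_single in_keys_iff when_def)
      have n: "mono_deg m' = n" using Suc(2) mono_deg_add[of m' "Poly_Mapping.single v 1"] mm by simp
      have km: "Poly_Mapping.keys m' \<subseteq> V" "v \<in> V" using Suc.prems(1) v mm keys_plus_nat[of m' "Poly_Mapping.single v 1"] by auto
      obtain A where A: "A \<subseteq> Lp" "var v - sum x A \<in> ?J \<or> var v + sum x A \<in> ?J" using vars[OF km(2)] by blast
      have eq: "mono m * C.X w = var v * (mono m' * C.X w)" unfolding mm mono_add var_def by (simp only: mult_ac)
      have "P (mono m' * C.X (w + {#F#}))" if "F \<in> A" for F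
        using Suc.hyps(1)[of m' "w + {#F#}"] n km Suc.prems Suc.hyps(2) that A(1) by auto
      then have "P (\<Sum>F\<in>A. mono m' * C.X (w + {#F#}))" by (rule Ps)
      also have "(\<Sum>F\<in>A. mono m' * C.X (w + {#F#})) = sum x A * (mono m' * C.X w)"
        by (simp add: sum_distrib_right sum_distrib_left mult_ac)
      finally have PA: "P (sum x A * (mono m' * C.X w))" .
      from A(2) show ?case
      proof
        assume "var v - sum x A \<in> ?J"
        then have "P ((var v - sum x A) * (mono m' * C.X w))" using PJ C.mult_J_right by blast
        from Pa[OF this PA] show ?thesis unfolding eq by (simp add: algebra_simps)
      next
        assume "var v + sum x A \<in> ?J"
        then have "P ((var v + sum x A) * (mono m' * C.X w))" using PJ C.mult_J_right by blast
        from Pd[OF this PA] show ?thesis unfolding eq by (simp add: algebra_simps)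
      qed
    qed
    from this[of "{#}"] show "\<exists>s\<in>qv.span (C.X ` stds \<epsilon> d). mono m - s \<in> ?J"
      using \<open>m \<in> monos_deg V d\<close> unfolding P_def monos_deg_def by simp
  next
    fix c assume c: "(\<Sum>m\<in>stds \<epsilon> d. qscale (c m) (C.X m)) \<in> qv.span (rels V G d)"
    have eX: "eval_poly a (C.X m) - T.X m \<in> Null \<epsilon>" if "set_mset m \<subseteq> Lp" for m
      using that
    proof (induction m)
      case (add F m)
      then have "eval_poly a (x F) - y F \<in> Null \<epsilon>" "eval_poly a (C.X m) - T.X m \<in> Null \<epsilon>" using ax by auto
      from T.add_J[OF T.mult_J_right[OF this(1), of "eval_poly a (C.X m)"] T.mult_J[OF this(2), of "y F"]]
      show ?case by (simp add: eval_poly_mult algebra_simps)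
    qed (simp add: eval_poly_one T.zero_J)
    have eR: "eval_poly a p \<in> Null \<epsilon>" if "p \<in> qv.span (rels V G d)" for p
      using that
    proof (induction p rule: qv.span_induct_alt)
      case (step b p q)
      obtain m g e where "p = mono m * g" "(g, e) \<in> G" using step(1) unfolding rels_def by auto
      then have "eval_poly a (qscale b p) \<in> Null \<epsilon>" using rel T.mult_J by (simp add: qscale_eq eval_poly_mult)
      then show ?case using step(2) T.add_J by (simp add: eval_poly_add)
    qed (simp add: eval_poly_zero T.zero_J)
    let ?k = "\<lambda>r. Poly_Mapping.single 0 r :: cpoly"
    have "eval_poly a (\<Sum>m\<in>stds \<epsilon> d. qscale (c m) (C.X m)) - (\<Sum>m\<in>stds \<epsilon> d. ?k (c m) * T.X m)
       = (\<Sum>m\<in>stds \<epsilon> d. ?k (c m) * (eval_poly a (C.X m) - T.X m))"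
      by (simp add: eval_poly_sum qscale_eq eval_poly_mult eval_poly_const sum_subtractf algebra_simps)
    also have "\<dots> \<in> Null \<epsilon>"
      by (intro T.sum_J T.mult_J eX) (auto simp: stds_def std_def chain_mset_def)
    finally have N: "(\<Sum>m\<in>stds \<epsilon> d. ?k (c m) * T.X m) \<in> Null \<epsilon>" using T.J_transfer eR[OF c] by blast
    show "\<forall>m\<in>stds \<epsilon> d. c m = 0"
    proof
      fix m assume m: "m \<in> stds \<epsilon> d"
      show "c m = 0"
      proof (rule T.std_independent[where \<phi> = "deg \<epsilon>" and k = ?k and T = "stds \<epsilon> d" and d = d])
        show "deg \<epsilon> p = 0" if "p \<in> Null \<epsilon>" for p
          using that unfolding Null_def by (metis (mono_tags, lifting) mem_Collect_eq mult.right_neutral)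
        show "deg \<epsilon> (y E ^ (rk E + \<epsilon> - 1)) \<noteq> 0" unfolding y(2) deg_socle by simp
        show "deg \<epsilon> ((\<Sum>e\<in>stds \<epsilon> d. ?k (c e) * T.X e) * b) = 0" for b using N unfolding Null_def by blast
      qed (use m finite_stds in \<open>auto simp: deg_add deg_scale stds_def\<close>)
    qed
  qed (use V G finite_stds in auto)
qed

lemma homog_mult_linear: "p \<in> homog V 1 \<Longrightarrow> q \<in> homog V 1 \<Longrightarrow> p * q \<in> homog V 2"
  using homog_mult[of p V 1 q 1] by (simp only: one_add_one)

text \<open>For \<open>\<epsilon> = 0\<close> the sum of all \<open>x H\<close> with
  \<open>i \<in> H\<close> is itself a relation, which gives both \<open>outside\<close> and
  \<open>atom_power\<close>.\<close>

lemma quot_dim_red: "quot_dim (red_chow_vars E Bs) (red_chow_rels E Bs) d = card (stds 0 d)"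
proof -
  let ?V = "red_chow_vars E Bs" and ?G = "red_chow_rels E Bs"
  have R: "red_flats E Bs = Lp - {E}" unfolding red_flats_def by auto
  obtain i0 where i0: "i0 \<in> E" using nonempty by blast
  \<comment> \<open>Another choice of \<open>i0\<close> changes \<open>x E\<close> by a linear
    relation of the ring.\<close>
  define x where "x F = (if F = E then - (\<Sum>F\<in>{F\<in>Lp - {E}. i0 \<in> F}. var (XV F)) else var (XV F))" for F
  define y where "y = (SOME y. chow_ring E Bs 0 (Null 0) y \<and> y E = var (XV E))"
  have y: "chow_ring E Bs 0 (Null 0) y" "y E = var (XV E)"
    using someI_ex[OF target_ring[of 0]] unfolding y_def by auto
  interpret T: chow_ring E Bs 0 "Null 0" y by (rule y(1))
  define a where "a v = (case v of XV F \<Rightarrow> y F | YV i \<Rightarrow> 0)" for v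
  have homv: "var (XV F) \<in> homog ?V 1" if "F \<in> Lp - {E}" for F
    using that R by (intro homog_var) (auto simp: red_chow_vars_def)
  have relsE: "(\<exists>F1 F2. g = var (XV F1) * var (XV F2) \<and> e = 2 \<and> F1 \<in> Lp - {E} \<and> F2 \<in> Lp - {E}
        \<and> \<not> F1 \<subseteq> F2 \<and> \<not> F2 \<subseteq> F1) \<or>
      (\<exists>i j. i \<in> E \<and> j \<in> E \<and> e = 1 \<and>
        g = (\<Sum>F\<in>{F\<in>Lp - {E}. i \<in> F}. var (XV F)) - (\<Sum>F\<in>{F\<in>Lp - {E}. j \<in> F}. var (XV F)))"
    if "(g, e) \<in> ?G" for g e using that unfolding red_chow_rels_def R by blast
  have G: "g \<in> homog ?V e" if "(g, e) \<in> ?G" for g e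
    using relsE[OF that]
  proof (elim disjE exE conjE)
    fix F1 F2 assume "g = var (XV F1) * var (XV F2)" "e = 2" "F1 \<in> Lp - {E}" "F2 \<in> Lp - {E}"
    then show ?thesis using homog_mult_linear homv by (simp only:)
  next
    fix i j assume e: "e = 1" and g: "g = (\<Sum>F\<in>{F\<in>Lp - {E}. i \<in> F}. var (XV F)) - (\<Sum>F\<in>{F\<in>Lp - {E}. j \<in> F}. var (XV F))"
    show ?thesis unfolding e g by (intro homog_diff homog_sum homv) blast+
  qed
  have gen: "g \<in> rel_ideal ?V ?G" if "(g, e) \<in> ?G" for g e using rel_ideal_gen[OF that G[OF that]] .
  have split: "sum f {H\<in>Lp. i \<in> H} = f E + sum f {F\<in>Lp - {E}. i \<in> F}" if "i \<in> E" for f :: "nat set \<Rightarrow> cpoly" and i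
  proof -
    have "{H\<in>Lp. i \<in> H} = insert E {F\<in>Lp - {E}. i \<in> F}" using E_Lp that by auto
    then show ?thesis using finite_Lp by simp
  qed
  have atom: "sum x {H\<in>Lp. i \<in> H} \<in> rel_ideal ?V ?G" if i: "i \<in> E" for i
  proof -
    have "sum x {F\<in>Lp - {E}. i \<in> F} = (\<Sum>F\<in>{F\<in>Lp - {E}. i \<in> F}. var (XV F))"
      by (rule sum.cong) (auto simp: x_def)
    then have "sum x {H\<in>Lp. i \<in> H} = (\<Sum>F\<in>{F\<in>Lp - {E}. i \<in> F}. var (XV F)) - (\<Sum>F\<in>{F\<in>Lp - {E}. i0 \<in> F}. var (XV F))"
      unfolding split[OF i] by (simp add: x_def)
    moreover have "((\<Sum>F\<in>{F\<in>Lp - {E}. i \<in> F}. var (XV F)) - (\<Sum>F\<in>{F\<in>Lp - {E}. i0 \<in> F}. var (XV F)), 1) \<in> ?G"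
      unfolding red_chow_rels_def R using i i0 by blast
    ultimately show ?thesis using gen by simp
  qed
  have x: "chow_ring E Bs 0 (rel_ideal ?V ?G) x"
  proof unfold_locales
    show "x F * x G \<in> rel_ideal ?V ?G" if "F \<in> Lp" "G \<in> Lp" "\<not> F \<subseteq> G" "\<not> G \<subseteq> F" for F G
    proof -
      have ne: "F \<noteq> E" "G \<noteq> E" using that Lp_subset by auto
      then have "(var (XV F) * var (XV G), 2) \<in> ?G" unfolding red_chow_rels_def R using that by auto
      then show ?thesis using gen ne by (simp add: x_def)
    qed
    show "sum x {H\<in>Lp. i \<in> H} ^ Suc 0 \<in> rel_ideal ?V ?G" if "i \<in> E" for i using atom[OF that] by simp
    show "x G * sum x {H\<in>Lp. i \<in> H} \<in> rel_ideal ?V ?G" if "G \<in> Lp" "i \<in> E - G" for G i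
      using rel_ideal_mult atom that by blast
  qed (auto simp: rel_ideal_zero rel_ideal_add rel_ideal_mult)
  show ?thesis
  proof (rule quot_dim_stds[OF _ _ G x _ _ y])
    show "finite ?V" unfolding red_chow_vars_def R using finite_Lp by simp
    show "x F \<in> homog ?V 1" if "F \<in> Lp" for F
      using that homv unfolding x_def by (auto intro!: homog_uminus homog_sum)
    show "\<exists>A\<subseteq>Lp. var v - sum x A \<in> rel_ideal ?V ?G \<or> var v + sum x A \<in> rel_ideal ?V ?G" if v: "v \<in> ?V" for v
    proof -
      obtain F where F: "v = XV F" "F \<in> Lp - {E}" using v unfolding red_chow_vars_def R by blast
      then have "var v - sum x {F} = 0" by (simp add: x_def)
      then show ?thesis using F rel_ideal_zero by (intro exI[of _ "{F}"]) (metis Diff_iff empty_subsetI insert_subset)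
    qed
    have ysum: "eval_poly a (\<Sum>F\<in>{F\<in>Lp - {E}. i \<in> F}. var (XV F)) = sum y {F\<in>Lp - {E}. i \<in> F}" for i
      by (simp add: eval_poly_sum eval_poly_var a_def)
    have yatom: "y E + sum y {F\<in>Lp - {E}. i \<in> F} \<in> Null 0" if "i \<in> E" for i
      using T.atom_power[OF that] unfolding split[OF that] by simp
    show "eval_poly a g \<in> Null 0" if ge: "(g, e) \<in> ?G" for g e
    proof -
      consider F1 F2 where "g = var (XV F1) * var (XV F2)" "F1 \<in> Lp" "F2 \<in> Lp" "\<not> F1 \<subseteq> F2" "\<not> F2 \<subseteq> F1"
        | i j where "i \<in> E" "j \<in> E"
          "g = (\<Sum>F\<in>{F\<in>Lp - {E}. i \<in> F}. var (XV F)) - (\<Sum>F\<in>{F\<in>Lp - {E}. j \<in> F}. var (XV F))"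
        using relsE[OF ge] by blast
      then show ?thesis
      proof cases
        case 1
        then show ?thesis using T.incomparable by (simp add: eval_poly_mult eval_poly_var a_def)
      next
        case 2
        have "eval_poly a g = (y E + sum y {F\<in>Lp - {E}. i \<in> F}) - (y E + sum y {F\<in>Lp - {E}. j \<in> F})"
          unfolding 2(3) eval_poly_diff ysum by simp
        then show ?thesis using T.diff_J[OF yatom[OF 2(1)] yatom[OF 2(2)]] by simp
      qed
    qed
    show "eval_poly a (x F) - y F \<in> Null 0" if "F \<in> Lp" for F
    proof (cases "F = E")
      case True
      then have "eval_poly a (x F) - y F = - (y E + sum y {F\<in>Lp - {E}. i0 \<in> F})"
        unfolding x_def by (simp only: simp_thms if_True eval_poly_uminus ysum minus_add_distrib) (simp only: diff_conv_add_uminus add.commute)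
      then show ?thesis using T.minus_J[OF yatom[OF i0]] by simp
    qed (simp add: x_def eval_poly_var a_def T.zero_J)
  qed simp
qed

lemma quot_dim_aug: "quot_dim (aug_chow_vars E Bs) (aug_chow_rels E Bs) d = card (stds 1 d)"
proof -
  let ?V = "aug_chow_vars E Bs" and ?G = "aug_chow_rels E Bs"
  have R: "aug_flats E Bs = insert {} (Lp - {E})" unfolding aug_flats_def using empty_flat nonempty by auto
  define x where "x F = (if F = E then - (\<Sum>F\<in>insert {} (Lp - {E}). var (XV F)) else var (XV F))" for F
  define y where "y = (SOME y. chow_ring E Bs 1 (Null 1) y \<and> y E = var (XV E))"
  have y: "chow_ring E Bs 1 (Null 1) y" "y E = var (XV E)"
    using someI_ex[OF target_ring[of 1]] unfolding y_def by auto
  interpret T: chow_ring E Bs 1 "Null 1" y by (rule y(1))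
  \<comment> \<open>The variables of the empty flat and of the elements take the values forced by
    the linear relations.\<close>
  define a where "a v = (case v of XV F \<Rightarrow> if F = {} then - sum y Lp else y F
    | YV i \<Rightarrow> - sum y {H\<in>Lp. i \<in> H})" for v
  have homv: "var (XV F) \<in> homog ?V 1" if "F \<in> insert {} (Lp - {E})" for F
    using that R by (intro homog_var) (auto simp: aug_chow_vars_def)
  have homy: "var (YV i) \<in> homog ?V 1" if "i \<in> E" for i
    using that by (intro homog_var) (auto simp: aug_chow_vars_def)
  have relsE: "(\<exists>i. i \<in> E \<and> e = 1 \<and> g = var (YV i) - (\<Sum>F\<in>{F\<in>insert {} (Lp - {E}). i \<notin> F}. var (XV F))) \<or>
      (\<exists>i F. i \<in> E \<and> F \<in> insert {} (Lp - {E}) \<and> i \<notin> F \<and> e = 2 \<and> g = var (YV i) * var (XV F)) \<or>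
      (\<exists>F1 F2. g = var (XV F1) * var (XV F2) \<and> e = 2 \<and> F1 \<in> insert {} (Lp - {E}) \<and> F2 \<in> insert {} (Lp - {E})
        \<and> \<not> F1 \<subseteq> F2 \<and> \<not> F2 \<subseteq> F1)"
    if "(g, e) \<in> ?G" for g e using that unfolding aug_chow_rels_def R by blast
  have G: "g \<in> homog ?V e" if "(g, e) \<in> ?G" for g e
    using relsE[OF that]
  proof (elim disjE exE conjE)
    fix i assume i: "i \<in> E" and e: "e = 1" and g: "g = var (YV i) - (\<Sum>F\<in>{F\<in>insert {} (Lp - {E}). i \<notin> F}. var (XV F))"
    show ?thesis unfolding e g by (intro homog_diff homog_sum homv homy i) blast
  next
    fix i F assume "i \<in> E" "F \<in> insert {} (Lp - {E})" "e = 2" "g = var (YV i) * var (XV F)"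
    then show ?thesis using homog_mult_linear homv homy by (simp only:)
  next
    fix F1 F2 assume "g = var (XV F1) * var (XV F2)" "e = 2" "F1 \<in> insert {} (Lp - {E})" "F2 \<in> insert {} (Lp - {E})"
    then show ?thesis using homog_mult_linear homv by (simp only:)
  qed
  have gen: "g \<in> rel_ideal ?V ?G" if "(g, e) \<in> ?G" for g e using rel_ideal_gen[OF that G[OF that]] .
  have G1: "var (YV i) - (\<Sum>F\<in>{F\<in>insert {} (Lp - {E}). i \<notin> F}. var (XV F)) \<in> rel_ideal ?V ?G" if "i \<in> E" for i
    by (rule gen[where e = 1]) (use that in \<open>auto simp: aug_chow_rels_def R\<close>)
  have G3: "var (YV i) * var (XV F) \<in> rel_ideal ?V ?G" if "i \<in> E" "F \<in> insert {} (Lp - {E})" "i \<notin> F" for i F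
    by (rule gen[where e = 2]) (use that in \<open>auto simp: aug_chow_rels_def R\<close>)
  have split: "sum f (insert {} (Lp - {E})) = f {} + sum f (Lp - {E})" for f :: "nat set \<Rightarrow> cpoly"
    using finite_Lp by simp
  have splitE: "sum f Lp = f E + sum f (Lp - {E})" for f :: "nat set \<Rightarrow> cpoly"
    using finite_Lp E_Lp by (simp add: sum.remove)
  have atom: "sum x {H\<in>Lp. i \<in> H} + var (YV i) \<in> rel_ideal ?V ?G" if i: "i \<in> E" for i
  proof -
    let ?A = "{F\<in>insert {} (Lp - {E}). i \<notin> F}" and ?B = "{F\<in>Lp - {E}. i \<in> F}"
    have "{H\<in>Lp. i \<in> H} = insert E ?B" using E_Lp i by auto
    then have "sum x {H\<in>Lp. i \<in> H} = x E + sum x ?B" using finite_Lp by simp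
    also have "sum x ?B = (\<Sum>F\<in>?B. var (XV F))" by (rule sum.cong) (auto simp: x_def)
    also have "x E = - ((\<Sum>F\<in>?A. var (XV F)) + (\<Sum>F\<in>?B. var (XV F)))"
    proof -
      have "insert {} (Lp - {E}) = ?A \<union> ?B" "?A \<inter> ?B = {}" by auto
      then have "(\<Sum>F\<in>insert {} (Lp - {E}). var (XV F)) = (\<Sum>F\<in>?A. var (XV F)) + (\<Sum>F\<in>?B. var (XV F))"
        using finite_Lp by (metis (no_types, lifting) finite_Diff finite_Un finite_insert sum.union_disjoint)
      then show ?thesis by (simp add: x_def)
    qed
    finally have "sum x {H\<in>Lp. i \<in> H} + var (YV i) = var (YV i) - (\<Sum>F\<in>?A. var (XV F))" by simp
    then show ?thesis using G1[OF i] by simp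
  qed
  have transfer: "p \<in> rel_ideal ?V ?G" if "p + q \<in> rel_ideal ?V ?G" "q \<in> rel_ideal ?V ?G" for p q
    using rel_ideal_add[OF that(1) rel_ideal_mult[OF that(2), of "-1"]] by simp
  have x: "chow_ring E Bs 1 (rel_ideal ?V ?G) x"
  proof unfold_locales
    show "x F * x G \<in> rel_ideal ?V ?G" if "F \<in> Lp" "G \<in> Lp" "\<not> F \<subseteq> G" "\<not> G \<subseteq> F" for F G
    proof -
      have ne: "F \<noteq> E" "G \<noteq> E" using that Lp_subset by auto
      then have "(var (XV F) * var (XV G), 2) \<in> ?G" unfolding aug_chow_rels_def R using that by blast
      then show ?thesis using gen ne by (simp add: x_def)
    qed
    show "sum x {H\<in>Lp. i \<in> H} ^ Suc 1 \<in> rel_ideal ?V ?G" if i: "i \<in> E" for i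
    proof -
      let ?S = "sum x {H\<in>Lp. i \<in> H}" and ?s = "\<Sum>F\<in>{F\<in>insert {} (Lp - {E}). i \<notin> F}. var (XV F)"
      have "(\<Sum>F\<in>K. var (YV i) * var (XV F)) \<in> rel_ideal ?V ?G" if "K \<subseteq> {F\<in>insert {} (Lp - {E}). i \<notin> F}" for K
        using that by (induction K rule: infinite_finite_induct)
          (auto simp: rel_ideal_zero intro!: rel_ideal_add G3 i)
      then have "(\<Sum>F\<in>{F\<in>insert {} (Lp - {E}). i \<notin> F}. var (YV i) * var (XV F)) \<in> rel_ideal ?V ?G" by blast
      then have 1: "var (YV i) * ?s \<in> rel_ideal ?V ?G" by (simp only: sum_distrib_left)
      \<comment> \<open>Multiplying the linear relation for \<open>i\<close> by
        \<open>var (YV i)\<close> removes the flats avoiding \<open>i\<close>, so the square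
        vanishes; a difference of squares transfers this to \<open>?S\<close>.\<close>
      have "var (YV i) * (var (YV i) - ?s) \<in> rel_ideal ?V ?G" using rel_ideal_mult G1[OF i] by blast
      from rel_ideal_add[OF this 1] have 2: "var (YV i) * var (YV i) \<in> rel_ideal ?V ?G" by (simp add: algebra_simps)
      have "(?S - var (YV i)) * (?S + var (YV i)) \<in> rel_ideal ?V ?G" using rel_ideal_mult atom[OF i] by blast
      from rel_ideal_add[OF this 2] show ?thesis by (simp add: algebra_simps)
    qed
    show "x G * sum x {H\<in>Lp. i \<in> H} \<in> rel_ideal ?V ?G" if G: "G \<in> Lp" "i \<in> E - G" for G i
    proof -
      have "x G * (sum x {H\<in>Lp. i \<in> H} + var (YV i)) \<in> rel_ideal ?V ?G" using rel_ideal_mult atom G by blast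
      then have s: "x G * sum x {H\<in>Lp. i \<in> H} + x G * var (YV i) \<in> rel_ideal ?V ?G" by (simp only: distrib_left)
      have "x G = var (XV G)" using G by (auto simp: x_def)
      then have "x G * var (YV i) \<in> rel_ideal ?V ?G" using G3[of i G] G by (auto simp: mult.commute)
      then show ?thesis using transfer s by blast
    qed
  qed (auto simp: rel_ideal_zero rel_ideal_add rel_ideal_mult)
  show ?thesis
  proof (rule quot_dim_stds[OF _ _ G x _ _ y])
    show "finite ?V" unfolding aug_chow_vars_def R using finite_Lp matroidD(1)[OF M] by simp
    show "x F \<in> homog ?V 1" if "F \<in> Lp" for F
    proof (cases "F = E")
      case True
      then show ?thesis unfolding x_def using homv by (simp only: True simp_thms if_True) (intro homog_uminus homog_sum)
    next
      case False
      then show ?thesis unfolding x_def using homv that by simp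
    qed
    show "\<exists>A\<subseteq>Lp. var v - sum x A \<in> rel_ideal ?V ?G \<or> var v + sum x A \<in> rel_ideal ?V ?G" if v: "v \<in> ?V" for v
    proof -
      consider F where "v = XV F" "F \<in> Lp - {E}" | "v = XV {}" | i where "v = YV i" "i \<in> E"
        using v unfolding aug_chow_vars_def R by blast
      then show ?thesis
      proof cases
        case 1
        then have "var v - sum x {F} = 0" by (simp add: x_def)
        then show ?thesis using 1 rel_ideal_zero by (intro exI[of _ "{F}"]) (metis Diff_iff empty_subsetI insert_subset)
      next
        case 2
        have "sum x (Lp - {E}) = (\<Sum>F\<in>Lp - {E}. var (XV F))" by (rule sum.cong) (auto simp: x_def)
        then have "var v + sum x Lp = 0" unfolding splitE 2 by (simp add: x_def split)
        then show ?thesis using rel_ideal_zero by (metis subset_refl)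
      next
        case 3
        then show ?thesis using atom[OF 3(2)]
          by (intro exI[of _ "{H\<in>Lp. i \<in> H}"]) (auto simp: add.commute)
      qed
    qed
    have aF: "a (XV F) = y F" if "F \<in> Lp" for F using that by (simp add: a_def)
    have a0: "a (XV {}) = - sum y Lp" by (simp add: a_def)
    have aY: "a (YV i) = - sum y {H\<in>Lp. i \<in> H}" for i by (simp add: a_def)
    have neg: "sum y Lp = sum y {H\<in>Lp. i \<in> H} + sum y {H\<in>Lp. i \<notin> H}" for i
    proof -
      have "Lp = {H\<in>Lp. i \<in> H} \<union> {H\<in>Lp. i \<notin> H}" "{H\<in>Lp. i \<in> H} \<inter> {H\<in>Lp. i \<notin> H} = {}" by auto
      then show ?thesis using finite_Lp by (metis (no_types, lifting) finite_Un sum.union_disjoint)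
    qed
    have sq: "sum y {H\<in>Lp. i \<in> H} * sum y {H\<in>Lp. i \<in> H} \<in> Null 1" if "i \<in> E" for i
      using T.atom_power[OF that] by simp
    have out: "sum y {H\<in>Lp. i \<in> H} * y F \<in> Null 1" if "i \<in> E" "F \<in> Lp" "i \<notin> F" for i F
      using T.outside[of F i] that by (simp add: mult.commute)
    show "eval_poly a g \<in> Null 1" if ge: "(g, e) \<in> ?G" for g e
    proof -
      consider (y) i where "i \<in> E" "g = var (YV i) - (\<Sum>F\<in>{F\<in>insert {} (Lp - {E}). i \<notin> F}. var (XV F))"
        | (yx) i F where "i \<in> E" "F \<in> insert {} (Lp - {E})" "i \<notin> F" "g = var (YV i) * var (XV F)"
        | (xx) F1 F2 where "g = var (XV F1) * var (XV F2)" "F1 \<in> insert {} (Lp - {E})" "F2 \<in> insert {} (Lp - {E})"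
           "\<not> F1 \<subseteq> F2" "\<not> F2 \<subseteq> F1"
        using relsE[OF ge] by blast
      then show ?thesis
      proof cases
        case y
        have "{F\<in>insert {} (Lp - {E}). i \<notin> F} = insert {} {H\<in>Lp. i \<notin> H}" using y(1) by auto
        then have "eval_poly a g = a (YV i) - (a (XV {}) + (\<Sum>F\<in>{H\<in>Lp. i \<notin> H}. a (XV F)))"
          unfolding y(2) using finite_Lp by (simp add: eval_poly_diff eval_poly_sum eval_poly_add eval_poly_var)
        also have "(\<Sum>F\<in>{H\<in>Lp. i \<notin> H}. a (XV F)) = sum y {H\<in>Lp. i \<notin> H}" by (rule sum.cong) (auto simp: aF)
        also have "a (YV i) - (a (XV {}) + sum y {H\<in>Lp. i \<notin> H}) = 0" unfolding aY a0 neg[of i] by simp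
        finally show ?thesis using T.zero_J by simp
      next
        case yx
        show ?thesis
        proof (cases "F = {}")
          case True
          \<comment> \<open>The value splits into the square for \<open>i\<close> and products of
            its atom sum with flats avoiding \<open>i\<close>, all of them zero.\<close>
          have "sum y {H\<in>Lp. i \<in> H} * sum y {H\<in>Lp. i \<notin> H} \<in> Null 1"
            unfolding sum_distrib_left using out yx(1) by (intro T.sum_J) auto
          from T.add_J[OF sq[OF yx(1)] this] show ?thesis
            unfolding yx(4) True eval_poly_mult eval_poly_var aY a0 neg[of i] by (simp add: algebra_simps)
        next
          case False
          then have FL: "F \<in> Lp" using yx(2) by blast
          show ?thesis using T.minus_J[OF out[OF yx(1) FL yx(3)]]
            unfolding yx(4) eval_poly_mult eval_poly_var aY aF[OF FL] by simp
        qed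
      next
        case xx
        then have FL: "F1 \<in> Lp" "F2 \<in> Lp" by auto
        show ?thesis using T.incomparable[OF FL xx(4,5)]
          unfolding xx(1) eval_poly_mult eval_poly_var aF[OF FL(1)] aF[OF FL(2)] .
      qed
    qed
    show "eval_poly a (x F) - y F \<in> Null 1" if F: "F \<in> Lp" for F
    proof (cases "F = E")
      case True
      have "eval_poly a (x F) = - (a (XV {}) + (\<Sum>F\<in>Lp - {E}. a (XV F)))"
        unfolding True x_def by (simp only: simp_thms if_True eval_poly_uminus split eval_poly_add eval_poly_sum eval_poly_var)
      also have "(\<Sum>F\<in>Lp - {E}. a (XV F)) = sum y (Lp - {E})" by (rule sum.cong) (auto simp: aF)
      also have "- (a (XV {}) + sum y (Lp - {E})) = y E" unfolding a0 splitE[of y] by simp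
      finally show ?thesis using True T.zero_J by simp
    next
      case False
      then have "eval_poly a (x F) = y F" using aF[OF F] by (simp add: x_def eval_poly_var)
      then show ?thesis using T.zero_J by simp
    qed
  qed simp
qed

end

section \<open>Valuativity of the Hilbert series\<close>

lemma loopless_matroid_I:
  assumes "matroid E X" "loops E X = {}" "E \<noteq> {}" shows "loopless_matroid E X"
  using assms empty_flat_iff[OF assms(1)] by unfold_locales auto

lemma matroid_delete_loops:
  assumes M: "matroid E X" and L: "loops E X = L"
  shows "matroid (E - L) X" "loops (E - L) X = {}"
proof -
  have "\<forall>B\<in>X. B \<subseteq> E - L" using matroidD(4)[OF M] L unfolding loops_def by blast
  then show "matroid (E - L) X" using M unfolding matroid_def by auto
  show "loops (E - L) X = {}" using L unfolding loops_def by blast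
qed

text \<open>The count becomes a sum over multisets \<open>m\<close> and rank assignments
  \<open>\<rho>\<close> from sets independent of \<open>X\<close>. For each \<open>m\<close> only
  the true rank function contributes, so \<open>m\<close> is counted once if standard and not at all
  otherwise.\<close>

lemma balanced_stds:
  assumes M: "matroid E Bs" and S: "matroid_subdivision E Bs S" and L: "loops E Bs = {}" and E: "E \<noteq> {}"
  shows "balanced E Bs S (\<lambda>X. int (card (loopless_matroid.stds E X \<epsilon> d)))"
proof -
  define Z where "Z = {m. set_mset m \<subseteq> Pow E - {{}} \<and> size m = d \<and> (\<forall>F\<in>#m. \<forall>G\<in>#m. F \<subseteq> G \<or> G \<subseteq> F)}"
  \<comment> \<open>Ranks never exceed \<open>card E\<close>, which makes the set finite;
    extensionality prevents an assignment from being counted again with other values off the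
    chain.\<close>
  define R where "R m = {\<rho> \<in> set_mset m \<rightarrow>\<^sub>E {..card E}. \<forall>G\<in>#m. count m G < \<rho> G + \<epsilon> \<and>
    (\<forall>F\<in>#m. F \<subset> G \<longrightarrow> count m G + \<rho> F < \<rho> G)}" for m :: "nat set multiset"
  have finE: "finite E" by (rule matroidD(1)[OF M])
  have finZ: "finite Z"
    by (rule finite_subset[OF _ finite_multisets_of_size[of "Pow E" d]]) (use finE in \<open>auto simp: Z_def\<close>)
  have finR: "finite (R m)" for m unfolding R_def
    by (rule finite_subset[OF _ finite_PiE[of "set_mset m" "\<lambda>_. {..card E}"]]) auto
  let ?c = "\<lambda>m \<rho> X. of_bool (\<forall>F\<in>set_mset m. F \<in> flats E X \<and> mrank X F = \<rho> F) :: int"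
  have one: "balanced E Bs S (?c m \<rho>)" if m: "m \<in> Z" for m \<rho>
  proof (rule balanced_chain_of_flats[OF M S])
    show "F \<subseteq> G \<or> G \<subseteq> F" if "F \<in># m" "G \<in># m" for F G using m that unfolding Z_def by blast
    show "F \<subseteq> E" if "F \<in># m" for F using m that unfolding Z_def by blast
  qed simp
  have two: "balanced E Bs S (\<lambda>X. \<Sum>\<rho>\<in>R m. ?c m \<rho> X)" if "m \<in> Z" for m
    by (rule balanced_sum[where f = "?c m"]) (rule one[OF that])
  have "balanced E Bs S (\<lambda>X. \<Sum>m\<in>Z. \<Sum>\<rho>\<in>R m. ?c m \<rho> X)"
    by (rule balanced_sum[where f = "\<lambda>m X. \<Sum>\<rho>\<in>R m. ?c m \<rho> X"]) (rule two)
  then show ?thesis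
  proof (rule balanced_cong[OF M S])
    fix X assume X: "matroid E X" "loops E X = loops E Bs"
    interpret loopless_matroid E X using loopless_matroid_I X L E by simp
    have sub: "stds \<epsilon> d \<subseteq> Z"
    proof
      fix m assume "m \<in> stds \<epsilon> d"
      then have m: "set_mset m \<subseteq> Lp" "size m = d" "\<forall>F\<in>#m. \<forall>G\<in>#m. F \<subseteq> G \<or> G \<subseteq> F"
        unfolding stds_def std_def chain_mset_def by auto
      have "set_mset m \<subseteq> Pow E - {{}}" using m(1) Lp_subset by auto
      then show "m \<in> Z" using m(2,3) unfolding Z_def by simp
    qed
    have "(\<Sum>\<rho>\<in>R m. of_bool (\<forall>F\<in>set_mset m. F \<in> flats E X \<and> mrank X F = \<rho> F)) = (of_bool (m \<in> stds \<epsilon> d) :: int)"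
      if m: "m \<in> Z" for m
    proof -
      let ?\<rho> = "restrict (mrank X) (set_mset m)"
      have "(\<forall>F\<in>set_mset m. F \<in> flats E X \<and> mrank X F = \<rho> F) \<longleftrightarrow> set_mset m \<subseteq> flats E X \<and> \<rho> = ?\<rho>"
        if "\<rho> \<in> R m" for \<rho>
      proof -
        have "\<rho> \<in> extensional (set_mset m)" using that unfolding R_def by (simp add: PiE_def)
        then have "\<rho> = ?\<rho> \<longleftrightarrow> (\<forall>F\<in>set_mset m. mrank X F = \<rho> F)"
          by (auto intro!: extensionalityI[where A = "set_mset m"] simp: extensional_def)
        then show ?thesis by auto
      qed
      then have "(\<Sum>\<rho>\<in>R m. of_bool (\<forall>F\<in>set_mset m. F \<in> flats E X \<and> mrank X F = \<rho> F) :: int) =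
        (\<Sum>\<rho>\<in>R m. if \<rho> = ?\<rho> then of_bool (set_mset m \<subseteq> flats E X) else 0)"
        by (intro sum.cong) auto
      also have "\<dots> = of_bool (set_mset m \<subseteq> flats E X \<and> ?\<rho> \<in> R m)" using finR by simp
      also have "set_mset m \<subseteq> flats E X \<and> ?\<rho> \<in> R m \<longleftrightarrow> m \<in> stds \<epsilon> d"
      proof -
        have mZ: "set_mset m \<subseteq> Pow E - {{}}" "size m = d" "\<forall>F\<in>#m. \<forall>G\<in>#m. F \<subseteq> G \<or> G \<subseteq> F"
          using m unfolding Z_def by auto
        have le: "mrank X F \<le> card E" if "F \<in># m" for F
        proof -
          have F: "F \<subseteq> E" using mZ(1) that by blast
          have "mrank X F \<le> card F" using mrank_le_card[OF X(1) finite_subset[OF F finE]] .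
          also have "\<dots> \<le> card E" using F finE by (rule card_mono[rotated])
          finally show ?thesis .
        qed
        have c: "?\<rho> \<in> R m \<longleftrightarrow> (\<forall>G\<in>#m. count m G < mrank X G + \<epsilon> \<and>
            (\<forall>F\<in>#m. F \<subset> G \<longrightarrow> count m G + mrank X F < mrank X G))"
          unfolding R_def using le by simp
        have Lp: "set_mset m \<subseteq> flats E X \<longleftrightarrow> set_mset m \<subseteq> Lp" using mZ(1) by auto
        show ?thesis
        proof
          assume "set_mset m \<subseteq> flats E X \<and> ?\<rho> \<in> R m"
          then show "m \<in> stds \<epsilon> d" unfolding stds_def std_def chain_mset_def Lp c using mZ(2,3)
            by (intro CollectI conjI) simp_all
        next
          assume "m \<in> stds \<epsilon> d"
          then show "set_mset m \<subseteq> flats E X \<and> ?\<rho> \<in> R m"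
            unfolding stds_def std_def chain_mset_def Lp c mem_Collect_eq by (elim conjE) (intro conjI)
        qed
      qed
      finally show ?thesis .
    qed
    then have "(\<Sum>m\<in>Z. \<Sum>\<rho>\<in>R m. of_bool (\<forall>F\<in>set_mset m. F \<in> flats E X \<and> mrank X F = \<rho> F)) =
        (\<Sum>m\<in>Z. of_bool (m \<in> stds \<epsilon> d) :: int)" by (rule sum.cong[OF refl])
    also have "\<dots> = int (card (stds \<epsilon> d))" using finZ sub by (simp add: Int_absorb1 Int_commute)
    finally show "(\<Sum>m\<in>Z. \<Sum>\<rho>\<in>R m. of_bool (\<forall>F\<in>set_mset m. F \<in> flats E X \<and> mrank X F = \<rho> F)) =
        int (card (stds \<epsilon> d))" .
  qed
qed

text \<open>The empty family of rank conditions always holds, so the constant one is an indicator of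
  the kind already treated.\<close>

lemma balanced_const:
  assumes M: "matroid E Bs" and S: "matroid_subdivision E Bs S"
  shows "balanced E Bs S (\<lambda>X. c)"
  using balanced_scale[OF balanced_rank_ge[OF M S, of "{}"], of c] by simp

lemma subdivision_delete_loops:
  assumes M: "matroid E Bs" and S: "matroid_subdivision E Bs S"
  defines "L \<equiv> loops E Bs"
  shows "matroid_subdivision (E - L) Bs S" "P \<in> S \<Longrightarrow> bases_of (E - L) P = bases_of E P"
proof -
  have BL: "B \<subseteq> E - L" if "B \<in> Bs" for B
    using that matroidD(4)[OF M] unfolding L_def loops_def by blast
  have sub: "B \<subseteq> E - L" if "B \<in> bases_of E P" "P \<in> S" for B P
    using BL bases_of_cell_subset[OF M S] that by blast
  have "\<exists>Bs'. matroid (E - L) Bs' \<and> P = base_polytope Bs'" if P: "P \<in> S" for P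
  proof -
    have "matroid (E - L) (bases_of E P)"
      using bases_of_subdivision(1)[OF S P] sub[OF _ P] unfolding matroid_def by auto
    then show ?thesis using bases_of_subdivision(2)[OF S P] by metis
  qed
  then have cells: "\<forall>P\<in>S. \<exists>Bs'. matroid (E - L) Bs' \<and> P = base_polytope Bs'" by (rule ballI)
  show "matroid_subdivision (E - L) Bs S"
    using S cells unfolding matroid_subdivision_def by - (elim conjE, intro conjI; assumption)
  show "bases_of (E - L) P = bases_of E P" if "P \<in> S"
    using sub[OF _ that] unfolding bases_of_def by blast
qed

text \<open>Both Hilbert series only involve the loopless matroid on \<open>E - loops E Bs\<close>, and deleting the
  loops does not change the base polytopes.\<close>

lemma valuative_from_loopless:
  fixes h :: "nat set \<Rightarrow> nat set set \<Rightarrow> int fps"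
  assumes h: "\<And>E X d. loopless_matroid E X \<Longrightarrow>
      fps_nth (h E X) d = int (card (loopless_matroid.stds E X \<epsilon> d))"
    and h0: "\<And>X. h {} X = h0"
    and M: "matroid E Bs" and S: "matroid_subdivision E Bs S"
  defines "L \<equiv> loops E Bs"
  shows "h (E - L) Bs = (\<Sum>P\<in>interior_faces Bs S.
     sign_pow (pdim (base_polytope Bs) - pdim P) (h (E - L) (bases_of E P)))"
proof (rule fps_ext)
  fix d
  note M' = matroid_delete_loops[OF M refl, folded L_def] and S' = subdivision_delete_loops[OF M S, folded L_def]
  have nth: "fps_nth (sign_pow k v) d = sign_pow k (fps_nth v d)" for k and v :: "int fps"
    by (simp add: sign_pow_def)
  have "balanced (E - L) Bs S (\<lambda>X. fps_nth (h (E - L) X) d)"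
  proof (cases "E - L = {}")
    case True
    \<comment> \<open>If every element is a loop, the function is the constant given by
      \<open>h0\<close>.\<close>
    show ?thesis using balanced_const[OF M'(1) S'(1)] unfolding True h0 by simp
  next
    case False
    from balanced_stds[OF M'(1) S'(1) M'(2) False, of \<epsilon> d] show ?thesis
    proof (rule balanced_cong[OF M'(1) S'(1)])
      fix X assume "matroid (E - L) X" "loops (E - L) X = loops (E - L) Bs"
      then have "loopless_matroid (E - L) X" using M'(2) False by (intro loopless_matroid_I) auto
      then show "int (card (loopless_matroid.stds (E - L) X \<epsilon> d)) = fps_nth (h (E - L) X) d" using h by simp
    qed
  qed
  then have "fps_nth (h (E - L) Bs) d = (\<Sum>P\<in>interior_faces Bs S.
      sign_pow (pdim (base_polytope Bs) - pdim P) (fps_nth (h (E - L) (bases_of (E - L) P)) d))"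
    unfolding balanced_def .
  also have "\<dots> = (\<Sum>P\<in>interior_faces Bs S.
      sign_pow (pdim (base_polytope Bs) - pdim P) (fps_nth (h (E - L) (bases_of E P)) d))"
    using S'(2) unfolding interior_faces_def by (intro sum.cong) auto
  finally show "fps_nth (h (E - L) Bs) d = fps_nth (\<Sum>P\<in>interior_faces Bs S.
      sign_pow (pdim (base_polytope Bs) - pdim P) (h (E - L) (bases_of E P))) d"
    by (simp add: fps_sum_nth nth)
qed

section \<open>Invariance under isomorphism\<close>

lemma mrank_image:
  assumes s: "inj_on \<sigma> E" and A: "A \<subseteq> E" and Bs: "\<And>B. B \<in> Bs \<Longrightarrow> B \<subseteq> E"
  shows "mrank ((`) \<sigma> ` Bs) (\<sigma> ` A) = mrank Bs A"
proof -
  have "card (\<sigma> ` A \<inter> \<sigma> ` B) = card (A \<inter> B)" if "B \<in> Bs" for B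
  proof -
    have "\<sigma> ` A \<inter> \<sigma> ` B = \<sigma> ` (A \<inter> B)" using inj_on_image_Int[OF s A Bs[OF that]] by simp
    moreover have "inj_on \<sigma> (A \<inter> B)" using s A by (meson inj_on_subset inf.coboundedI1)
    ultimately show ?thesis by (simp add: card_image)
  qed
  then have "(\<lambda>B. card (\<sigma> ` A \<inter> B)) ` ((`) \<sigma> ` Bs) = (\<lambda>B. card (A \<inter> B)) ` Bs"
    unfolding image_image by (intro image_cong) auto
  then show ?thesis unfolding mrank_def by simp
qed

text \<open>Images under \<open>\<sigma>\<close> carry flats to flats of the same rank. Taking
  images is injective on subsets of \<open>E\<close>, so multiplicities are preserved and distinct
  multisets stay distinct.\<close>

lemma card_stds_iso_le:
  assumes M: "loopless_matroid E Bs" and M': "loopless_matroid E' ((`) \<sigma> ` Bs)" and s: "bij_betw \<sigma> E E'"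
  shows "card (loopless_matroid.stds E Bs \<epsilon> d) \<le> card (loopless_matroid.stds E' ((`) \<sigma> ` Bs) \<epsilon> d)"
proof -
  interpret A: loopless_matroid E Bs by (rule M)
  interpret B: loopless_matroid E' "(`) \<sigma> ` Bs" by (rule M')
  have inj: "inj_on \<sigma> E" and im: "\<sigma> ` E = E'" using s by (auto simp: bij_betw_def)
  have rk: "B.rk (\<sigma> ` F) = A.rk F" if "F \<subseteq> E" for F
    using mrank_image[OF inj that] matroidD(4)[OF A.M] by blast
  have flat: "\<sigma> ` F \<in> B.Lp" if F: "F \<in> A.Lp" for F
  proof -
    have FE: "F \<subseteq> E" using A.Lp_subset[OF F] .
    have "B.rk (\<sigma> ` F) < B.rk (insert y (\<sigma> ` F))" if y: "y \<in> E' - \<sigma> ` F" for y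
    proof -
      obtain x where x: "x \<in> E - F" "y = \<sigma> x" using y im by blast
      then have "A.rk F < A.rk (insert x F)" using F unfolding flats_def by blast
      then show ?thesis using rk[OF FE] rk[of "insert x F"] x FE by simp
    qed
    then show ?thesis using F FE im unfolding flats_def by auto
  qed
  have injP: "inj_on ((`) \<sigma>) (Pow E)" using inj by (rule inj_on_image_Pow)
  have sub2: "set_mset m \<subseteq> A.Lp" if "m \<in> A.stds \<epsilon> d" for m
    using that unfolding A.stds_def A.std_def A.chain_mset_def by simp
  have sub1: "set_mset m \<subseteq> Pow E" if "m \<in> A.stds \<epsilon> d" for m
    using sub2[OF that] A.Lp_subset by auto
  have cnt: "count (image_mset ((`) \<sigma>) m) (\<sigma> ` G) = count m G" if m: "set_mset m \<subseteq> Pow E" and G: "G \<in># m" for m G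
  proof -
    have "(`) \<sigma> -` {\<sigma> ` G} \<inter> set_mset m = {G}" using injP m G unfolding inj_on_def by blast
    then show ?thesis by (simp add: count_image_mset)
  qed
  have "image_mset ((`) \<sigma>) m \<in> B.stds \<epsilon> d" if m: "m \<in> A.stds \<epsilon> d" for m
  proof -
    have mE: "F \<subseteq> E" if "F \<in># m" for F using sub1[OF m] that by blast
    have st: "\<forall>F\<in>#m. \<forall>G\<in>#m. F \<subseteq> G \<or> G \<subseteq> F" "size m = d" "\<forall>G\<in>#m. count m G < A.rk G + \<epsilon>"
      "\<forall>G\<in>#m. \<forall>F\<in>#m. F \<subset> G \<longrightarrow> count m G + A.rk F < A.rk G"
      using m unfolding A.stds_def A.std_def A.chain_mset_def by simp_all
    have psub: "F \<subset> G" if "F \<in># m" "G \<in># m" "\<sigma> ` F \<subset> \<sigma> ` G" for F G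
      using st(1) that by blast
    have "set_mset (image_mset ((`) \<sigma>) m) \<subseteq> B.Lp" using flat sub2[OF m] by auto
    moreover have "\<forall>F\<in>#image_mset ((`) \<sigma>) m. \<forall>G\<in>#image_mset ((`) \<sigma>) m. F \<subseteq> G \<or> G \<subseteq> F"
    proof (intro ballI)
      fix F' G' assume "F' \<in># image_mset ((`) \<sigma>) m" "G' \<in># image_mset ((`) \<sigma>) m"
      then obtain F G where FG: "F \<in># m" "G \<in># m" "F' = \<sigma> ` F" "G' = \<sigma> ` G" by auto
      have "F \<subseteq> G \<or> G \<subseteq> F" using st(1) FG(1,2) by simp
      then show "F' \<subseteq> G' \<or> G' \<subseteq> F'" unfolding FG(3,4) by (metis image_mono)
    qed
    moreover have "\<forall>G\<in>#image_mset ((`) \<sigma>) m. count (image_mset ((`) \<sigma>) m) G < B.rk G + \<epsilon>"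
      using st(3) cnt[OF sub1[OF m]] rk mE by simp
    moreover have "\<forall>G\<in>#image_mset ((`) \<sigma>) m. \<forall>F\<in>#image_mset ((`) \<sigma>) m. F \<subset> G \<longrightarrow>
        count (image_mset ((`) \<sigma>) m) G + B.rk F < B.rk G"
      using st(4) cnt[OF sub1[OF m]] rk mE psub by simp
    ultimately show ?thesis using st(2) unfolding B.stds_def B.std_def B.chain_mset_def
      by (simp only: mem_Collect_eq size_image_mset) simp
  qed
  then have "image_mset ((`) \<sigma>) ` A.stds \<epsilon> d \<subseteq> B.stds \<epsilon> d" by blast
  moreover have "inj_on (image_mset ((`) \<sigma>)) (A.stds \<epsilon> d)"
  proof (rule inj_on_inverseI)
    fix m assume m: "m \<in> A.stds \<epsilon> d"
    have "image_mset (inv_into (Pow E) ((`) \<sigma>)) (image_mset ((`) \<sigma>) m) = image_mset (\<lambda>F. F) m"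
      unfolding multiset.map_comp using sub1[OF m] inv_into_f_f[OF injP]
      by (intro image_mset_cong) auto
    then show "image_mset (inv_into (Pow E) ((`) \<sigma>)) (image_mset ((`) \<sigma>) m) = m" by simp
  qed
  ultimately show ?thesis using B.finite_stds by (metis card_image card_mono)
qed

text \<open>The inverse bijection carries the image family back to \<open>Bs\<close>, which supplies
  the opposite inequality.\<close>

lemma card_stds_iso:
  assumes M: "loopless_matroid E Bs" and M': "loopless_matroid E' ((`) \<sigma> ` Bs)" and s: "bij_betw \<sigma> E E'"
  shows "card (loopless_matroid.stds E Bs \<epsilon> d) = card (loopless_matroid.stds E' ((`) \<sigma> ` Bs) \<epsilon> d)"
proof (rule antisym)
  let ?\<tau> = "inv_into E \<sigma>"
  have "?\<tau> ` \<sigma> ` B = B" if "B \<in> Bs" for B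
    using matroidD(4)[OF loopless_matroid.M[OF M] that] s by (simp add: bij_betw_def)
  then have "(`) ?\<tau> ` (`) \<sigma> ` Bs = (\<lambda>B. B) ` Bs" unfolding image_image by (intro image_cong) auto
  then show "card (loopless_matroid.stds E' ((`) \<sigma> ` Bs) \<epsilon> d) \<le> card (loopless_matroid.stds E Bs \<epsilon> d)"
    using card_stds_iso_le[OF M', of E ?\<tau>] M bij_betw_inv_into[OF s] by simp
qed (rule card_stds_iso_le[OF assms])

lemma iso_from_loopless:
  fixes h :: "nat set \<Rightarrow> nat set set \<Rightarrow> int fps"
  assumes h: "\<And>E X d. loopless_matroid E X \<Longrightarrow>
      fps_nth (h E X) d = int (card (loopless_matroid.stds E X \<epsilon> d))"
    and h0: "\<And>X. h {} X = h0"
    and M: "matroid E Bs" and M': "matroid E' Bs'" and iso: "matroid_iso E Bs E' Bs'"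
  shows "h (E - loops E Bs) Bs = h (E' - loops E' Bs') Bs'" "loops E Bs = {} \<longleftrightarrow> loops E' Bs' = {}"
proof -
  obtain \<sigma> where s: "bij_betw \<sigma> E E'" and Bs': "Bs' = (`) \<sigma> ` Bs" using iso unfolding matroid_iso_def by blast
  have inj: "inj_on \<sigma> E" and im: "\<sigma> ` E = E'" using s by (auto simp: bij_betw_def)
  have union: "\<Union>Bs \<subseteq> E" using matroidD(4)[OF M] by blast
  have "\<sigma> ` (E - \<Union>Bs) = E' - \<Union>Bs'"
    using inj_on_image_set_diff[OF inj, of E "\<Union>Bs"] union im Bs' by auto
  then have l: "\<sigma> ` loops E Bs = loops E' Bs'" unfolding loops_def .
  then show "loops E Bs = {} \<longleftrightarrow> loops E' Bs' = {}" by auto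
  have le: "loops E Bs \<subseteq> E" unfolding loops_def by blast
  have im': "\<sigma> ` (E - loops E Bs) = E' - loops E' Bs'"
    using inj_on_image_set_diff[OF inj _ le, of E] im l by simp
  then have s': "bij_betw \<sigma> (E - loops E Bs) (E' - loops E' Bs')"
    using inj unfolding bij_betw_def by (metis Diff_subset inj_on_subset)
  show "h (E - loops E Bs) Bs = h (E' - loops E' Bs') Bs'"
  proof (cases "E - loops E Bs = {}")
    case True
    have empty': "E' - loops E' Bs' = {}" using im'[symmetric] unfolding True image_empty .
    show ?thesis unfolding True empty' h0 ..
  next
    case False
    then have "E' - loops E' Bs' \<noteq> {}" using im' by blast
    then have "loopless_matroid (E - loops E Bs) Bs" "loopless_matroid (E' - loops E' Bs') ((`) \<sigma> ` Bs)"
      using False matroid_delete_loops[OF M refl] matroid_delete_loops[OF M' refl] unfolding Bs'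
      by (auto intro!: loopless_matroid_I)
    from h[OF this(1)] h[OF this(2)] card_stds_iso[OF this s'] show ?thesis
      unfolding Bs' by (intro fps_ext) simp
  qed
qed

lemma flats_empty: "flats {} X = {{}}" by (auto simp: flats_def)

theorem theorem1p11:
  shows "valuative_invariant red_hilb \<and> valuative_invariant aug_hilb"
proof
  let ?h = "\<lambda>E X. hilbert_series (red_chow_vars E X) (red_chow_rels E X)"
  have h: "fps_nth (?h E X) d = int (card (loopless_matroid.stds E X 0 d))" if "loopless_matroid E X" for E X d
    using loopless_matroid.quot_dim_red[OF that] by (simp add: hilbert_series_def)
  have h0: "?h {} X = hilbert_series {} {}" for X
    by (simp add: red_chow_vars_def red_chow_rels_def red_flats_def flats_empty)
  show "valuative_invariant red_hilb" unfolding valuative_invariant_def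
  proof (intro conjI allI impI)
    fix E Bs E' Bs' assume "matroid E Bs \<and> matroid E' Bs' \<and> matroid_iso E Bs E' Bs'"
    then have a: "matroid E Bs" "matroid E' Bs'" "matroid_iso E Bs E' Bs'" by auto
    show "red_hilb E Bs = red_hilb E' Bs'"
      using iso_from_loopless[of ?h, OF h h0 a] by (auto simp: red_hilb_def)
  next
    fix E Bs S assume "matroid E Bs \<and> matroid_subdivision E Bs S"
    then have M: "matroid E Bs" and S: "matroid_subdivision E Bs S" by auto
    have lp: "loops E (bases_of E P) = loops E Bs" if "P \<in> interior_faces Bs S" for P
      by (rule loops_interior_face[OF M S that])
    show "red_hilb E Bs = (\<Sum>P\<in>interior_faces Bs S.
        sign_pow (pdim (base_polytope Bs) - pdim P) (red_hilb E (bases_of E P)))"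
    proof (cases "loops E Bs = {}")
      case True
      then show ?thesis using valuative_from_loopless[of ?h, OF h h0 M S] lp by (simp add: red_hilb_def)
    next
      \<comment> \<open>All interior faces have the loops of \<open>Bs\<close>, so both sides vanish
        by convention.\<close>
      case False
      moreover have "sign_pow k 0 = (0 :: int fps)" for k by (simp add: sign_pow_def)
      ultimately show ?thesis using lp by (simp add: red_hilb_def)
    qed
  qed
next
  let ?h = "\<lambda>E X. hilbert_series (aug_chow_vars E X) (aug_chow_rels E X)"
  have h: "fps_nth (?h E X) d = int (card (loopless_matroid.stds E X 1 d))" if "loopless_matroid E X" for E X d
    using loopless_matroid.quot_dim_aug[OF that] by (simp add: hilbert_series_def)
  have h0: "?h {} X = hilbert_series {} {}" for X
    by (simp add: aug_chow_vars_def aug_chow_rels_def aug_flats_def flats_empty)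
  show "valuative_invariant aug_hilb" unfolding valuative_invariant_def
  proof (intro conjI allI impI)
    fix E Bs E' Bs' assume "matroid E Bs \<and> matroid E' Bs' \<and> matroid_iso E Bs E' Bs'"
    then have a: "matroid E Bs" "matroid E' Bs'" "matroid_iso E Bs E' Bs'" by auto
    show "aug_hilb E Bs = aug_hilb E' Bs'"
      using iso_from_loopless(1)[of ?h, OF h h0 a] by (simp add: aug_hilb_def Let_def)
  next
    fix E Bs S assume "matroid E Bs \<and> matroid_subdivision E Bs S"
    then have M: "matroid E Bs" and S: "matroid_subdivision E Bs S" by auto
    show "aug_hilb E Bs = (\<Sum>P\<in>interior_faces Bs S.
        sign_pow (pdim (base_polytope Bs) - pdim P) (aug_hilb E (bases_of E P)))"
      using valuative_from_loopless[of ?h, OF h h0 M S] loops_interior_face[OF M S]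
      by (simp add: aug_hilb_def Let_def)
  qed
qed

end
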